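(* Let $G$ be a $3$-dimensional non-unimodular Lie group with Lie algebra $\mathfrak{g}$ and unimodular kernel $\mathfrak{u}$, and $g$ a left-invariant pseudo-Riemannian metric on $G$ with $g|_{\mathfrak{u}\times\mathfrak{u}}$ non-degenerate. Let $(v_a)_{1\le a\le3}$ be a $g$-orthonormal basis of $\mathfrak{g}$ with $v_1,v_3\in\mathfrak{u}$, $\epsilon_a=g(v_a,v_a)\in\{\pm1\}$, so that $$[v_1,v_3]=0,\quad[v_2,v_1]=\epsilon_1\lambda v_1+\epsilon_3\mu v_3,\quad[v_2,v_3]=\epsilon_1\nu v_1+\epsilon_3\rho v_3,$$ where $\lambda,\mu,\nu,\rho\in\mathbb{R}$ and $\epsilon_1\lambda+\epsilon_3\rho\neq0$. Let $E_{H,F}$ be a Courant algebroid of type $B_3$ over $G$ with left-invariant $H=h\,v_1^*\wedge v_2^*\wedge v_3^*$ and $F=\frac12F_{ab}v_a^*\wedge v_b^*\neq0$ (closedness of $F$ means $F_{13}=0$), and $\delta\in(\mathfrak{g}\oplus\mathfrak{g}^*\oplus\mathbb{R})^*$ a left-invariant divergence operator, $\delta_A=\delta(e_A)$. Then $E_-=\{X-g(X)\mid X\in TG\}$ is generalized Einstein with divergence $\delta$ on $E_{H,F}$ if and only if, in the basis $(v_a)$ (with $v_1$ and $v_3$ interchanged, if necessary), it belongs to one of the following seven classes (below $\epsilon,\tilde\epsilon\in\{\pm1\}$): 1) $\lambda\neq0$, $h=\mu$, $F_{23}=F_{13}=0$, $\delta_0F_{12}=\epsilon_3\mu\delta_3$,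 $\delta_1=\delta_4=0$, $\delta_2=\delta_5=-\epsilon_1\lambda$ and one of the following conditions holds: a) $\rho=\nu=0$ and $(F_{12})^2=-(\epsilon_1\lambda^2+\epsilon_3\mu^2)>0$; b) $\mu=0$, $\rho=-2\lambda$, $\nu=2\epsilon\lambda$, $\epsilon_1=-1$, $\epsilon_3=1$, $F_{12}=\tilde\epsilon\lambda\sqrt3$, $\delta_0=\delta_3=\delta_6=0$; 2) $\lambda=0$, $\mu\neq0$, $\nu=-2\mu$, $\rho=\tilde\epsilon\mu$, $\epsilon_1=-1$, $\epsilon_3=1$, $h=\mu$, $F_{13}=0$, $F_{23}=\epsilon\rho$, $F_{12}=\epsilon\mu$, $\delta_0=\delta_1=\delta_3=\delta_4=\delta_6=0$, $\delta_2=\delta_5=-\rho$; 3) $\lambda\nu(\epsilon_1\lambda+\epsilon_3\rho)\neq0$, $\epsilon_1\lambda^2+\epsilon_3\mu^2<0$, $\lambda\rho=\mu\nu$, $h=\mu-\nu$, $F_{23}=-\frac\nu\lambda F_{12}$, $(F_{12})^2=-(\epsilon_1\lambda^2+\epsilon_3\mu^2)$, $F_{13}=0$, $\delta_0F_{12}=\epsilon_1\frac\lambda\nu\delta_1(\nu-\mu)$, $\delta_2=\delta_5=-(\epsilon_1\lambda+\epsilon_3\rho)$, $\delta_3=-\epsilon_1\epsilon_3\frac\lambda\nu\delta_1$, $\delta_6=-\epsilon_1\epsilon_3\frac\lambda\nu\delta_4$, and one of the following conditions holds: a) $\delta_1=\delta_4\neq0$; b) $\delta_0=\delta_1=\delta_4=0$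 and either ($\rho=\mu=0$, $\epsilon_1=-1$) or $(\mu-\nu)\rho\neq0$; c) $\delta_1\neq\delta_4$ and either $\delta_1\neq0$ or $\delta_0=\delta_1=0$; 4) $\lambda=\nu=0$, $\rho\mu\neq0$, $\epsilon_3=-1$, $h=\mu$, $F_{12}=\epsilon\mu$, $F_{23}=-\epsilon\rho$, $F_{13}=0$, $\delta_2=\delta_5=\rho$, $\delta_3=-\epsilon\delta_0$, $\delta_3=\epsilon_1\frac\mu\rho\delta_1$, $\delta_6=\epsilon_1\frac\mu\rho\delta_4$ and one of the following conditions holds: a) either $\delta_0=0$ or $\delta_0(\delta_1-\delta_4)\neq0$; b) $\delta_4=\delta_1$ and $\delta_1\delta_3\neq0$; 5) $\lambda=\frac\epsilon3(2\mu+\nu)$, $\rho=\frac\epsilon3(2\nu+\mu)$, $\epsilon_1(\mu^2-\nu^2)>0$, $\mu+2\nu\neq0$, $\nu+2\mu\neq0$, $\epsilon_3=-\epsilon_1$, $h=\frac13(\mu-\nu)$, $F_{13}=0$, $F_{23}=-\epsilon F_{12}$, $(F_{12})^2=\frac{\epsilon_1}3(\mu^2-\nu^2)$, $\delta_0=\delta_1=\delta_3=\delta_4=\delta_6=0$, $\delta_2=\delta_5=\frac{\epsilon\epsilon_1}3(\nu-\mu)$; 6) $\rho=-2\lambda\neq0$, $\mu=2\epsilon\lambda$, $\nu=0$, $\epsilon_1=1$, $\epsilon_3=-1$, $h=0$, $F_{12}=\tilde\epsilon\lambda$, $F_{23}=2\epsilon\tilde\epsilon\lambda$, $F_{13}=0$,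 $\delta_0=\delta_1=\delta_3=\delta_4=\delta_6=0$, $\delta_2=\delta_5=-\lambda$; 7) all constants $\mu,\nu,F_{12},F_{23}$ and $\epsilon_1\lambda+\epsilon_3\rho$ are non-zero, $F_{13}=h=\delta_0=\delta_1=\delta_3=\delta_4=\delta_6=0$, $\delta_2=\delta_5$, and $$F_{12}\epsilon_3(\delta_2+\epsilon_1\lambda)=F_{23}\nu,\qquad F_{12}\mu=F_{23}\epsilon_1(\epsilon_3\rho+\delta_2),$$ $$(F_{12})^2=\tfrac{\epsilon_3}2(\nu^2-\mu^2)+\delta_2\lambda,\qquad(F_{23})^2=\tfrac{\epsilon_1}2(\mu^2-\nu^2)+\delta_2\rho,$$ $$\delta_2(\epsilon_1\lambda+\epsilon_3\rho)=-\lambda^2-\tfrac{\epsilon_1\epsilon_3}2(\mu+\nu)^2-\rho^2,$$ $$F_{12}F_{23}=\tfrac{\epsilon_1}2\lambda(\nu-\mu)+\tfrac{\epsilon_3}2\rho(\mu-\nu)-\tfrac{\delta_2}2(\mu+\nu).$$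
   Context: $\mathfrak{u}=\{x\in\mathfrak{g}\mid\mathrm{tr}\,\mathrm{ad}_x=0\}$ (a $2$-dimensional abelian ideal). When $v_1$ and $v_3$ are interchanged all constants are redefined by the same formulas in the new basis (so $\lambda\leftrightarrow\rho$, $\mu\leftrightarrow\nu$, $\epsilon_1\leftrightarrow\epsilon_3$, $\delta_1\leftrightarrow\delta_3$, $\delta_4\leftrightarrow\delta_6$, $h\mapsto-h$, $F_{12}\mapsto F_{32}$, $F_{23}\mapsto F_{21}$). Basis of $\tilde E=\mathfrak{g}\oplus\mathfrak{g}^*\oplus\mathbb{R}$: $e_0=1$, $e_a=v_a+g(v_a)$, $e_{a+3}=v_a-g(v_a)$ for $1\le a\le3$, where $g(X)=g(X,\cdot)$; $F_{ab}=F(v_a,v_b)$. Courant algebroid of type $B_3$: for left-invariant $H\in\Omega^3(G)$, $F\in\Omega^2(G)$ with $dF=0$, $E=E_{H,F}$ is the bundle $TG\oplus T^*G\oplus\mathbb{R}$ with anchor $\pi$ the projection to $TG$, scalar product $\langle X+\xi+\lambda,Y+\eta+\mu\rangle=\frac12(\xi(Y)+\eta(X))+\lambda\mu$ and Dorfman bracket $$[X+\xi+\lambda,Y+\eta+\mu]_{H,F}=\mathcal{L}_X(Y+\eta)-i_Yd\xi+2\mu\,d\lambda+i_Xi_YH-2(\mu\, i_XF-\lambda\, i_YF)+X(\mu)-Y(\lambda)+F(X,Y).$$ Left-invariant sections of $E$ (for the action of $G$ by left translations, trivial on the $\mathbb{R}$-fibre) form $\tilde E$. For $E_-=\{X-g(X)\mid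 X\in TG\}$ put $E_+=E_-^\perp$. A generalized connection is a linear map $D:\Gamma(E)\to\Gamma(E^*\otimes E)$ with $D_u(fv)=\pi(u)(f)v+fD_uv$ and $\pi(u)\langle v,w\rangle=\langle D_uv,w\rangle+\langle v,D_uw\rangle$. Its torsion is $T^D(u,v,w)=\langle D_uv-D_vu-[u,v]_{H,F},w\rangle+\langle v,D_wu\rangle$; $D$ is Levi-Civita for $E_-$ if $T^D=0$ and $D_u\Gamma(E_-)\subset\Gamma(E_-)$ for all $u$. A divergence operator is an additive map $\delta:\Gamma(E)\to C^\infty(G)$ with $\delta(fu)=\pi(u)(f)+f\delta(u)$; it is left-invariant if constant on left-invariant sections, and is then identified with an element of $\tilde E^*$; $\delta^D(u)=\mathrm{tr}\,Du$. For a Levi-Civita generalized connection $D$ of $E_-$ with $\delta^D=\delta$, put $R^D(u,v)w=D_uD_vw-D_vD_uw-D_{[u,v]_{H,F}}w$ and $\mathrm{Ric}^{\delta,+}(u,v)=\mathrm{tr}(E_+\ni w\mapsto R^D(w,u)v)$ ($u\in E_-,v\in E_+$), $\mathrm{Ric}^{\delta,-}(u,v)=\mathrm{tr}(E_-\ni w\mapsto R^D(w,u)v)$ ($u\in E_+,v\in E_-$). These are tensors depending only on $(E_-,\delta)$. $E_-$ is generalized Einstein with divergence $\delta$ if $\mathrm{Ric}^{\delta,+}=0$ and $\mathrm{Ric}^{\delta,-}=0$. *)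

theory Defs
  imports
    "HOL-Analysis.Analysis"
    "HOL-Algebra.Group"
    "HOL-Library.Function_Algebras"
    "HOL-Combinatorics.Transposition"
begin

section \<open>Smooth maps and Lie groups\<close>

primrec cont_diff_on ::
    "nat \<Rightarrow> ('a::real_normed_vector \<Rightarrow> 'b::real_normed_vector) \<Rightarrow> 'a set \<Rightarrow> bool" where
  "cont_diff_on 0 f S \<longleftrightarrow> continuous_on S f"
| "cont_diff_on (Suc k) f S \<longleftrightarrow>
     (\<forall>x\<in>S. f differentiable (at x)) \<and>
     (\<forall>v. cont_diff_on k (\<lambda>x. frechet_derivative f (at x) v) S)"

text \<open>Only used on open subsets of finite-dimensional spaces.\<close>

definition smooth_on :: "('a::real_normed_vector \<Rightarrow> 'b::real_normed_vector) \<Rightarrow> 'a set \<Rightarrow> bool" where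
  "smooth_on f S \<longleftrightarrow> (\<forall>k. cont_diff_on k f S)"

text \<open>A chart is a pair \<open>(U, \<phi>)\<close>; the values of \<open>\<phi>\<close> outside \<open>U\<close> are irrelevant. The underlying
  set of a Lie group is a whole type, whose type class topology is the manifold topology.\<close>

record 'g lie_structure = "'g monoid" +
  charts :: "('g set \<times> ('g \<Rightarrow> real ^ 3)) set"

definition smooth_atlas :: "('g::topological_space set \<times> ('g \<Rightarrow> real ^ 3)) set \<Rightarrow> bool" where
  "smooth_atlas \<A> \<longleftrightarrow>
     (\<Union>(U, \<phi>)\<in>\<A>. U) = UNIV \<and>
     (\<forall>(U, \<phi>)\<in>\<A>. open U \<and> open (\<phi> ` U) \<and> homeomorphism U (\<phi> ` U) \<phi> (inv_into U \<phi>)) \<and>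
     (\<forall>(U, \<phi>)\<in>\<A>. \<forall>(V, \<psi>)\<in>\<A>. smooth_on (\<psi> \<circ> inv_into U \<phi>) (\<phi> ` (U \<inter> V)))"

definition lie_group :: "'g::{t2_space,second_countable_topology} lie_structure \<Rightarrow> bool" where
  "lie_group G \<longleftrightarrow>
     group G \<and> carrier G = UNIV \<and> smooth_atlas (charts G) \<and>
     continuous_on UNIV (\<lambda>(a, b). a \<otimes>\<^bsub>G\<^esub> b) \<and>
     continuous_on UNIV (\<lambda>a. inv\<^bsub>G\<^esub> a) \<and>
     (\<forall>(U, \<phi>)\<in>charts G. \<forall>(V, \<psi>)\<in>charts G. \<forall>(W, \<theta>)\<in>charts G.
        smooth_on (\<lambda>(x, y). \<theta> (inv_into U \<phi> x \<otimes>\<^bsub>G\<^esub> inv_into V \<psi> y))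
          {(x, y). x \<in> \<phi> ` U \<and> y \<in> \<psi> ` V \<and> inv_into U \<phi> x \<otimes>\<^bsub>G\<^esub> inv_into V \<psi> y \<in> W}) \<and>
     (\<forall>(U, \<phi>)\<in>charts G. \<forall>(W, \<theta>)\<in>charts G.
        smooth_on (\<lambda>x. \<theta> (inv\<^bsub>G\<^esub> (inv_into U \<phi> x)))
          {x. x \<in> \<phi> ` U \<and> inv\<^bsub>G\<^esub> (inv_into U \<phi> x) \<in> W})"

section \<open>Functions, vector fields and tensors\<close>

definition smooth_functions :: "'g lie_structure \<Rightarrow> ('g \<Rightarrow> real) set" where
  "smooth_functions G = {f. \<forall>(U, \<phi>)\<in>charts G. smooth_on (f \<circ> inv_into U \<phi>) (\<phi> ` U)}"

abbreviation cst :: "real \<Rightarrow> 'g \<Rightarrow> real" where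
  "cst c \<equiv> (\<lambda>_. c)"

type_synonym 'g field = "('g \<Rightarrow> real) \<Rightarrow> 'g \<Rightarrow> real"
type_synonym 'g form1 = "'g field \<Rightarrow> 'g \<Rightarrow> real"
type_synonym 'g form2 = "'g field \<Rightarrow> 'g field \<Rightarrow> 'g \<Rightarrow> real"
type_synonym 'g form3 = "'g field \<Rightarrow> 'g field \<Rightarrow> 'g field \<Rightarrow> 'g \<Rightarrow> real"

text \<open>Vector fields are represented by their action on smooth functions: in every chart they are
  \<open>f \<mapsto> \<Sum>\<^sub>i a\<^sub>i \<partial>\<^sub>i f\<close> with smooth coefficients. Covariant tensors are represented as
  \<open>C\<^sup>\<infinity>\<close>-multilinear maps on vector fields. Operators vanish outside their domain of definition, so
  that equality of operators is equality as HOL functions. Sums, products and zero of functions are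
  the pointwise ones.\<close>

definition vector_fields :: "'g lie_structure \<Rightarrow> 'g field set" where
  "vector_fields G = {X.
     (\<forall>f. f \<notin> smooth_functions G \<longrightarrow> X f = 0) \<and>
     (\<forall>(U, \<phi>)\<in>charts G. \<exists>a. smooth_on a (\<phi> ` U) \<and>
        (\<forall>f\<in>smooth_functions G. \<forall>p\<in>U.
           X f p = frechet_derivative (f \<circ> inv_into U \<phi>) (at (\<phi> p)) (a (\<phi> p))))}"

definition fscale :: "('g \<Rightarrow> real) \<Rightarrow> ('a \<Rightarrow> 'g \<Rightarrow> real) \<Rightarrow> 'a \<Rightarrow> 'g \<Rightarrow> real" where
  "fscale f T = (\<lambda>x. f * T x)"

definition lie_bracket :: "'g field \<Rightarrow> 'g field \<Rightarrow> 'g field" where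
  "lie_bracket X Y = (\<lambda>f. X (Y f) - Y (X f))"

definition one_forms :: "'g lie_structure \<Rightarrow> 'g form1 set" where
  "one_forms G = {\<xi>.
     (\<forall>X. X \<notin> vector_fields G \<longrightarrow> \<xi> X = 0) \<and>
     (\<forall>X\<in>vector_fields G. \<xi> X \<in> smooth_functions G) \<and>
     (\<forall>X\<in>vector_fields G. \<forall>Y\<in>vector_fields G. \<xi> (X + Y) = \<xi> X + \<xi> Y) \<and>
     (\<forall>f\<in>smooth_functions G. \<forall>X\<in>vector_fields G. \<xi> (fscale f X) = f * \<xi> X)}"

definition tensors2 :: "'g lie_structure \<Rightarrow> 'g form2 set" where
  "tensors2 G = {B.
     (\<forall>X. X \<notin> vector_fields G \<longrightarrow> B X = 0) \<and>
     (\<forall>X\<in>vector_fields G. B X \<in> one_forms G) \<and>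
     (\<forall>Y\<in>vector_fields G. (\<lambda>X. B X Y) \<in> one_forms G)}"

definition two_forms :: "'g lie_structure \<Rightarrow> 'g form2 set" where
  "two_forms G = {F \<in> tensors2 G. \<forall>X\<in>vector_fields G. F X X = 0}"

definition three_forms :: "'g lie_structure \<Rightarrow> 'g form3 set" where
  "three_forms G = {H.
     (\<forall>X. X \<notin> vector_fields G \<longrightarrow> H X = 0) \<and>
     (\<forall>X\<in>vector_fields G. H X \<in> two_forms G) \<and>
     (\<forall>Y\<in>vector_fields G. \<forall>Z\<in>vector_fields G. (\<lambda>X. H X Y Z) \<in> one_forms G) \<and>
     (\<forall>X\<in>vector_fields G. \<forall>Y\<in>vector_fields G. H X X Y = 0)}"

definition ext_deriv0 :: "'g lie_structure \<Rightarrow> ('g \<Rightarrow> real) \<Rightarrow> 'g form1" where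
  "ext_deriv0 G f = (\<lambda>X. if X \<in> vector_fields G then X f else 0)"

definition ext_deriv1 :: "'g lie_structure \<Rightarrow> 'g form1 \<Rightarrow> 'g form2" where
  "ext_deriv1 G \<xi> = (\<lambda>X Y. if X \<in> vector_fields G \<and> Y \<in> vector_fields G
     then X (\<xi> Y) - Y (\<xi> X) - \<xi> (lie_bracket X Y) else 0)"

definition closed_two_form :: "'g lie_structure \<Rightarrow> 'g form2 \<Rightarrow> bool" where
  "closed_two_form G F \<longleftrightarrow> F \<in> two_forms G \<and>
     (\<forall>X\<in>vector_fields G. \<forall>Y\<in>vector_fields G. \<forall>Z\<in>vector_fields G.
        X (F Y Z) + Y (F Z X) + Z (F X Y)
          - F (lie_bracket X Y) Z - F (lie_bracket Y Z) X - F (lie_bracket Z X) Y = 0)"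

definition lie_deriv :: "'g lie_structure \<Rightarrow> 'g field \<Rightarrow> 'g form1 \<Rightarrow> 'g form1" where
  "lie_deriv G X \<eta> = (\<lambda>Z. if Z \<in> vector_fields G then X (\<eta> Z) - \<eta> (lie_bracket X Z) else 0)"

section \<open>Left-invariance and the Lie algebra\<close>

definition ltrans :: "'g lie_structure \<Rightarrow> 'g \<Rightarrow> 'g \<Rightarrow> 'g" where
  "ltrans G a = (\<lambda>x. a \<otimes>\<^bsub>G\<^esub> x)"

definition push_field :: "'g lie_structure \<Rightarrow> 'g \<Rightarrow> 'g field \<Rightarrow> 'g field" where
  "push_field G a X = (\<lambda>f. X (f \<circ> ltrans G a) \<circ> ltrans G (inv\<^bsub>G\<^esub> a))"

definition lie_algebra :: "'g lie_structure \<Rightarrow> 'g field set" where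
  "lie_algebra G = {X \<in> vector_fields G. \<forall>a. push_field G a X = X}"

definition left_invariant1 :: "'g lie_structure \<Rightarrow> 'g form1 \<Rightarrow> bool" where
  "left_invariant1 G \<xi> \<longleftrightarrow>
     (\<forall>a. \<forall>X\<in>vector_fields G. \<xi> (push_field G a X) \<circ> ltrans G a = \<xi> X)"

definition left_invariant2 :: "'g lie_structure \<Rightarrow> 'g form2 \<Rightarrow> bool" where
  "left_invariant2 G B \<longleftrightarrow> (\<forall>a. \<forall>X\<in>vector_fields G. \<forall>Y\<in>vector_fields G.
     B (push_field G a X) (push_field G a Y) \<circ> ltrans G a = B X Y)"

definition left_invariant3 :: "'g lie_structure \<Rightarrow> 'g form3 \<Rightarrow> bool" where
  "left_invariant3 G H \<longleftrightarrow>
     (\<forall>a. \<forall>X\<in>vector_fields G. \<forall>Y\<in>vector_fields G. \<forall>Z\<in>vector_fields G.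
        H (push_field G a X) (push_field G a Y) (push_field G a Z) \<circ> ltrans G a = H X Y Z)"

text \<open>\<open>X f p = 0\<close> for all smooth \<open>f\<close> expresses that the vector field \<open>X\<close> vanishes at \<open>p\<close>.\<close>

definition pseudo_riemannian :: "'g lie_structure \<Rightarrow> 'g form2 \<Rightarrow> bool" where
  "pseudo_riemannian G g \<longleftrightarrow> g \<in> tensors2 G \<and>
     (\<forall>X\<in>vector_fields G. \<forall>Y\<in>vector_fields G. g X Y = g Y X) \<and>
     (\<forall>p. \<forall>X\<in>vector_fields G. (\<forall>Y\<in>vector_fields G. g X Y p = 0) \<longrightarrow>
        (\<forall>f\<in>smooth_functions G. X f p = 0))"

text \<open>Bases and traces for finitely generated free modules \<open>M\<close> with scalars \<open>K\<close> acting by \<open>sm\<close>. They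
  are used over \<open>\<real>\<close> for the Lie algebra, and over \<open>C\<^sup>\<infinity>(G)\<close> for spaces of sections, which are free
  because a Lie group is parallelizable.\<close>

definition module_basis ::
    "'r::zero set \<Rightarrow> ('r \<Rightarrow> 'm \<Rightarrow> 'm) \<Rightarrow> 'm::comm_monoid_add set \<Rightarrow> nat set \<Rightarrow> (nat \<Rightarrow> 'm) \<Rightarrow> bool" where
  "module_basis K sm M I b \<longleftrightarrow> finite I \<and> b ` I \<subseteq> M \<and>
     (\<forall>x\<in>M. \<exists>!c. (\<forall>i\<in>I. c i \<in> K) \<and> (\<forall>i. i \<notin> I \<longrightarrow> c i = 0) \<and> x = (\<Sum>i\<in>I. sm (c i) (b i)))"

definition module_trace ::
    "'r::comm_monoid_add set \<Rightarrow> ('r \<Rightarrow> 'm \<Rightarrow> 'm) \<Rightarrow> 'm::comm_monoid_add set \<Rightarrow> ('m \<Rightarrow> 'm) \<Rightarrow> 'r" where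
  "module_trace K sm M A = (THE t. \<exists>I b c. module_basis K sm M I b \<and>
     (\<forall>j\<in>I. (\<forall>i\<in>I. c i j \<in> K) \<and> A (b j) = (\<Sum>i\<in>I. sm (c i j) (b i))) \<and>
     t = (\<Sum>i\<in>I. c i i))"

abbreviation rscale :: "real \<Rightarrow> 'g field \<Rightarrow> 'g field" where
  "rscale c X \<equiv> fscale (cst c) X"

definition unimodular_kernel :: "'g lie_structure \<Rightarrow> 'g field set" where
  "unimodular_kernel G =
     {x \<in> lie_algebra G. module_trace UNIV rscale (lie_algebra G) (lie_bracket x) = 0}"

definition unimodular :: "'g lie_structure \<Rightarrow> bool" where
  "unimodular G \<longleftrightarrow> unimodular_kernel G = lie_algebra G"

section \<open>The Courant algebroid of type $B_3$\<close>

type_synonym 'g sect = "'g field \<times> 'g form1 \<times> ('g \<Rightarrow> real)"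

definition sections :: "'g lie_structure \<Rightarrow> 'g sect set" where
  "sections G = vector_fields G \<times> one_forms G \<times> smooth_functions G"

definition left_inv_sections :: "'g lie_structure \<Rightarrow> 'g sect set" where
  "left_inv_sections G =
     lie_algebra G \<times> {\<xi> \<in> one_forms G. left_invariant1 G \<xi>} \<times> range cst"

fun sscale :: "('g \<Rightarrow> real) \<Rightarrow> 'g sect \<Rightarrow> 'g sect" where
  "sscale f (X, \<xi>, l) = (fscale f X, fscale f \<xi>, f * l)"

abbreviation anchor :: "'g sect \<Rightarrow> 'g field" where
  "anchor u \<equiv> fst u"

fun pairing :: "'g sect \<Rightarrow> 'g sect \<Rightarrow> 'g \<Rightarrow> real" where
  "pairing (X, \<xi>, l) (Y, \<eta>, m) = cst (1/2) * (\<xi> Y + \<eta> X) + l * m"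

text \<open>Here \<open>i\<^sub>X i\<^sub>Y H = H Y X\<close> and \<open>i\<^sub>X F = F X\<close>.\<close>

fun dorfman ::
    "'g lie_structure \<Rightarrow> 'g form3 \<Rightarrow> 'g form2 \<Rightarrow> 'g sect \<Rightarrow> 'g sect \<Rightarrow> 'g sect" where
  "dorfman G H F (X, \<xi>, l) (Y, \<eta>, m) =
     (lie_bracket X Y,
      lie_deriv G X \<eta> - ext_deriv1 G \<xi> Y + fscale (cst 2 * m) (ext_deriv0 G l) + H Y X
        - fscale (cst 2) (fscale m (F X) - fscale l (F Y)),
      X m - Y l + F X Y)"

definition E_minus :: "'g lie_structure \<Rightarrow> 'g form2 \<Rightarrow> 'g sect set" where
  "E_minus G g = {(X, - g X, 0) | X. X \<in> vector_fields G}"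

definition orth_compl :: "'g lie_structure \<Rightarrow> 'g sect set \<Rightarrow> 'g sect set" where
  "orth_compl G N = {u \<in> sections G. \<forall>w\<in>N. pairing u w = 0}"

section \<open>Generalized connections and Ricci curvature\<close>

definition gen_connection ::
    "'g lie_structure \<Rightarrow> ('g sect \<Rightarrow> 'g sect \<Rightarrow> 'g sect) \<Rightarrow> bool" where
  "gen_connection G D \<longleftrightarrow>
     (\<forall>u\<in>sections G. \<forall>v\<in>sections G. D u v \<in> sections G) \<and>
     (\<forall>u\<in>sections G. \<forall>u'\<in>sections G. \<forall>v\<in>sections G. D (u + u') v = D u v + D u' v) \<and>
     (\<forall>f\<in>smooth_functions G. \<forall>u\<in>sections G. \<forall>v\<in>sections G.
        D (sscale f u) v = sscale f (D u v)) \<and>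
     (\<forall>u\<in>sections G. \<forall>v\<in>sections G. \<forall>v'\<in>sections G. D u (v + v') = D u v + D u v') \<and>
     (\<forall>f\<in>smooth_functions G. \<forall>u\<in>sections G. \<forall>v\<in>sections G.
        D u (sscale f v) = sscale (anchor u f) v + sscale f (D u v)) \<and>
     (\<forall>u\<in>sections G. \<forall>v\<in>sections G. \<forall>w\<in>sections G.
        anchor u (pairing v w) = pairing (D u v) w + pairing v (D u w))"

definition torsion ::
    "'g lie_structure \<Rightarrow> 'g form3 \<Rightarrow> 'g form2 \<Rightarrow> ('g sect \<Rightarrow> 'g sect \<Rightarrow> 'g sect)
      \<Rightarrow> 'g sect \<Rightarrow> 'g sect \<Rightarrow> 'g sect \<Rightarrow> 'g \<Rightarrow> real" where
  "torsion G H F D u v w = pairing (D u v - D v u - dorfman G H F u v) w + pairing v (D w u)"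

definition levi_civita ::
    "'g lie_structure \<Rightarrow> 'g form3 \<Rightarrow> 'g form2 \<Rightarrow> 'g sect set
      \<Rightarrow> ('g sect \<Rightarrow> 'g sect \<Rightarrow> 'g sect) \<Rightarrow> bool" where
  "levi_civita G H F N D \<longleftrightarrow> gen_connection G D \<and>
     (\<forall>u\<in>sections G. \<forall>v\<in>sections G. \<forall>w\<in>sections G. torsion G H F D u v w = 0) \<and>
     (\<forall>u\<in>sections G. \<forall>v\<in>N. D u v \<in> N)"

definition divergence_operator ::
    "'g lie_structure \<Rightarrow> ('g sect \<Rightarrow> 'g \<Rightarrow> real) \<Rightarrow> bool" where
  "divergence_operator G \<delta> \<longleftrightarrow>
     (\<forall>u\<in>sections G. \<delta> u \<in> smooth_functions G) \<and>
     (\<forall>u\<in>sections G. \<forall>v\<in>sections G. \<delta> (u + v) = \<delta> u + \<delta> v) \<and>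
     (\<forall>f\<in>smooth_functions G. \<forall>u\<in>sections G. \<delta> (sscale f u) = anchor u f + f * \<delta> u)"

definition left_inv_divergence ::
    "'g lie_structure \<Rightarrow> ('g sect \<Rightarrow> 'g \<Rightarrow> real) \<Rightarrow> bool" where
  "left_inv_divergence G \<delta> \<longleftrightarrow> divergence_operator G \<delta> \<and>
     (\<forall>u\<in>left_inv_sections G. \<delta> u \<in> range cst)"

definition connection_divergence ::
    "'g lie_structure \<Rightarrow> ('g sect \<Rightarrow> 'g sect \<Rightarrow> 'g sect) \<Rightarrow> 'g sect \<Rightarrow> 'g \<Rightarrow> real" where
  "connection_divergence G D u = module_trace (smooth_functions G) sscale (sections G) (\<lambda>w. D w u)"

definition gen_curvature ::
    "'g lie_structure \<Rightarrow> 'g form3 \<Rightarrow> 'g form2 \<Rightarrow> ('g sect \<Rightarrow> 'g sect \<Rightarrow> 'g sect)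
      \<Rightarrow> 'g sect \<Rightarrow> 'g sect \<Rightarrow> 'g sect \<Rightarrow> 'g sect" where
  "gen_curvature G H F D u v w = D u (D v w) - D v (D u w) - D (dorfman G H F u v) w"

definition ricci_on ::
    "'g lie_structure \<Rightarrow> 'g form3 \<Rightarrow> 'g form2 \<Rightarrow> ('g sect \<Rightarrow> 'g sect \<Rightarrow> 'g sect)
      \<Rightarrow> 'g sect set \<Rightarrow> 'g sect \<Rightarrow> 'g sect \<Rightarrow> 'g \<Rightarrow> real" where
  "ricci_on G H F D N u v =
     module_trace (smooth_functions G) sscale N (\<lambda>w. gen_curvature G H F D w u v)"

text \<open>The Ricci tensors depend only on \<open>N\<close> and \<open>\<delta>\<close>, not on the choice of \<open>D\<close>; the existential
  quantifier picks any admissible \<open>D\<close>.\<close>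

definition generalized_einstein ::
    "'g lie_structure \<Rightarrow> 'g form3 \<Rightarrow> 'g form2 \<Rightarrow> 'g sect set
      \<Rightarrow> ('g sect \<Rightarrow> 'g \<Rightarrow> real) \<Rightarrow> bool" where
  "generalized_einstein G H F N \<delta> \<longleftrightarrow>
     (\<exists>D. levi_civita G H F N D \<and>
          (\<forall>u\<in>sections G. connection_divergence G D u = \<delta> u) \<and>
          (\<forall>u\<in>N. \<forall>v\<in>orth_compl G N. ricci_on G H F D (orth_compl G N) u v = 0) \<and>
          (\<forall>u\<in>orth_compl G N. \<forall>v\<in>N. ricci_on G H F D N u v = 0))"

definition e_basis :: "'g form2 \<Rightarrow> (nat \<Rightarrow> 'g field) \<Rightarrow> nat \<Rightarrow> 'g sect" where
  "e_basis g v A =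
     (if A = 0 then (0, 0, 1)
      else if A \<le> 3 then (v A, g (v A), 0)
      else (v (A - 3), - g (v (A - 3)), 0))"

section \<open>The seven classes\<close>

text \<open>Arguments: structure constants \<open>lam, \<mu>, \<nu>, \<rho>\<close>, signs \<open>\<epsilon>\<^sub>a\<close>, and the components \<open>h\<close>,
  \<open>F\<^sub>a\<^sub>b\<close>, \<open>\<delta>\<^sub>A\<close> with respect to the basis under consideration. The free signs of the classification
  are called \<open>s\<close> and \<open>t\<close>.\<close>

definition class1 :: "real \<Rightarrow> real \<Rightarrow> real \<Rightarrow> real \<Rightarrow> (nat \<Rightarrow> real) \<Rightarrow> real
    \<Rightarrow> (nat \<Rightarrow> nat \<Rightarrow> real) \<Rightarrow> (nat \<Rightarrow> real) \<Rightarrow> bool" where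
  "class1 lam \<mu> \<nu> \<rho> \<epsilon> h F \<delta> \<longleftrightarrow>
     lam \<noteq> 0 \<and> h = \<mu> \<and> F 2 3 = 0 \<and> F 1 3 = 0 \<and> \<delta> 0 * F 1 2 = \<epsilon> 3 * \<mu> * \<delta> 3 \<and>
     \<delta> 1 = 0 \<and> \<delta> 4 = 0 \<and> \<delta> 2 = - \<epsilon> 1 * lam \<and> \<delta> 5 = - \<epsilon> 1 * lam \<and>
     ((\<rho> = 0 \<and> \<nu> = 0 \<and> (F 1 2)\<^sup>2 = - (\<epsilon> 1 * lam\<^sup>2 + \<epsilon> 3 * \<mu>\<^sup>2) \<and>
         - (\<epsilon> 1 * lam\<^sup>2 + \<epsilon> 3 * \<mu>\<^sup>2) > 0)
      \<or> (\<exists>s\<in>{-1, 1}. \<exists>t\<in>{-1, 1}. \<mu> = 0 \<and> \<rho> = - 2 * lam \<and> \<nu> = 2 * s * lam \<and>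
           \<epsilon> 1 = -1 \<and> \<epsilon> 3 = 1 \<and> F 1 2 = t * lam * sqrt 3 \<and>
           \<delta> 0 = 0 \<and> \<delta> 3 = 0 \<and> \<delta> 6 = 0))"

definition class2 :: "real \<Rightarrow> real \<Rightarrow> real \<Rightarrow> real \<Rightarrow> (nat \<Rightarrow> real) \<Rightarrow> real
    \<Rightarrow> (nat \<Rightarrow> nat \<Rightarrow> real) \<Rightarrow> (nat \<Rightarrow> real) \<Rightarrow> bool" where
  "class2 lam \<mu> \<nu> \<rho> \<epsilon> h F \<delta> \<longleftrightarrow>
     (\<exists>s\<in>{-1, 1}. \<exists>t\<in>{-1, 1}.
        lam = 0 \<and> \<mu> \<noteq> 0 \<and> \<nu> = - 2 * \<mu> \<and> \<rho> = t * \<mu> \<and> \<epsilon> 1 = -1 \<and> \<epsilon> 3 = 1 \<and> h = \<mu> \<and>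
        F 1 3 = 0 \<and> F 2 3 = s * \<rho> \<and> F 1 2 = s * \<mu> \<and>
        \<delta> 0 = 0 \<and> \<delta> 1 = 0 \<and> \<delta> 3 = 0 \<and> \<delta> 4 = 0 \<and> \<delta> 6 = 0 \<and> \<delta> 2 = - \<rho> \<and> \<delta> 5 = - \<rho>)"

definition class3 :: "real \<Rightarrow> real \<Rightarrow> real \<Rightarrow> real \<Rightarrow> (nat \<Rightarrow> real) \<Rightarrow> real
    \<Rightarrow> (nat \<Rightarrow> nat \<Rightarrow> real) \<Rightarrow> (nat \<Rightarrow> real) \<Rightarrow> bool" where
  "class3 lam \<mu> \<nu> \<rho> \<epsilon> h F \<delta> \<longleftrightarrow>
     lam * \<nu> * (\<epsilon> 1 * lam + \<epsilon> 3 * \<rho>) \<noteq> 0 \<and> \<epsilon> 1 * lam\<^sup>2 + \<epsilon> 3 * \<mu>\<^sup>2 < 0 \<and> lam * \<rho> = \<mu> * \<nu> \<and>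
     h = \<mu> - \<nu> \<and> F 2 3 = - (\<nu> / lam) * F 1 2 \<and>
     (F 1 2)\<^sup>2 = - (\<epsilon> 1 * lam\<^sup>2 + \<epsilon> 3 * \<mu>\<^sup>2) \<and> F 1 3 = 0 \<and>
     \<delta> 0 * F 1 2 = \<epsilon> 1 * (lam / \<nu>) * \<delta> 1 * (\<nu> - \<mu>) \<and>
     \<delta> 2 = - (\<epsilon> 1 * lam + \<epsilon> 3 * \<rho>) \<and> \<delta> 5 = - (\<epsilon> 1 * lam + \<epsilon> 3 * \<rho>) \<and>
     \<delta> 3 = - \<epsilon> 1 * \<epsilon> 3 * (lam / \<nu>) * \<delta> 1 \<and> \<delta> 6 = - \<epsilon> 1 * \<epsilon> 3 * (lam / \<nu>) * \<delta> 4 \<and>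
     ((\<delta> 1 = \<delta> 4 \<and> \<delta> 4 \<noteq> 0)
      \<or> (\<delta> 0 = 0 \<and> \<delta> 1 = 0 \<and> \<delta> 4 = 0 \<and> ((\<rho> = 0 \<and> \<mu> = 0 \<and> \<epsilon> 1 = -1) \<or> (\<mu> - \<nu>) * \<rho> \<noteq> 0))
      \<or> (\<delta> 1 \<noteq> \<delta> 4 \<and> (\<delta> 1 \<noteq> 0 \<or> (\<delta> 0 = 0 \<and> \<delta> 1 = 0))))"

definition class4 :: "real \<Rightarrow> real \<Rightarrow> real \<Rightarrow> real \<Rightarrow> (nat \<Rightarrow> real) \<Rightarrow> real
    \<Rightarrow> (nat \<Rightarrow> nat \<Rightarrow> real) \<Rightarrow> (nat \<Rightarrow> real) \<Rightarrow> bool" where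
  "class4 lam \<mu> \<nu> \<rho> \<epsilon> h F \<delta> \<longleftrightarrow>
     (\<exists>s\<in>{-1, 1}.
        lam = 0 \<and> \<nu> = 0 \<and> \<rho> * \<mu> \<noteq> 0 \<and> \<epsilon> 3 = -1 \<and> h = \<mu> \<and>
        F 1 2 = s * \<mu> \<and> F 2 3 = - s * \<rho> \<and> F 1 3 = 0 \<and> \<delta> 2 = \<rho> \<and> \<delta> 5 = \<rho> \<and>
        \<delta> 3 = - s * \<delta> 0 \<and> \<delta> 3 = \<epsilon> 1 * (\<mu> / \<rho>) * \<delta> 1 \<and> \<delta> 6 = \<epsilon> 1 * (\<mu> / \<rho>) * \<delta> 4 \<and>
        ((\<delta> 0 = 0 \<or> \<delta> 0 * (\<delta> 1 - \<delta> 4) \<noteq> 0)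
         \<or> (\<delta> 4 = \<delta> 1 \<and> \<delta> 1 * \<delta> 3 \<noteq> 0)))"

definition class5 :: "real \<Rightarrow> real \<Rightarrow> real \<Rightarrow> real \<Rightarrow> (nat \<Rightarrow> real) \<Rightarrow> real
    \<Rightarrow> (nat \<Rightarrow> nat \<Rightarrow> real) \<Rightarrow> (nat \<Rightarrow> real) \<Rightarrow> bool" where
  "class5 lam \<mu> \<nu> \<rho> \<epsilon> h F \<delta> \<longleftrightarrow>
     (\<exists>s\<in>{-1, 1}.
        lam = s / 3 * (2 * \<mu> + \<nu>) \<and> \<rho> = s / 3 * (2 * \<nu> + \<mu>) \<and> \<epsilon> 1 * (\<mu>\<^sup>2 - \<nu>\<^sup>2) > 0 \<and>
        \<mu> + 2 * \<nu> \<noteq> 0 \<and> \<nu> + 2 * \<mu> \<noteq> 0 \<and> \<epsilon> 3 = - \<epsilon> 1 \<and> h = 1 / 3 * (\<mu> - \<nu>) \<and>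
        F 1 3 = 0 \<and> F 2 3 = - s * F 1 2 \<and> (F 1 2)\<^sup>2 = \<epsilon> 1 / 3 * (\<mu>\<^sup>2 - \<nu>\<^sup>2) \<and>
        \<delta> 0 = 0 \<and> \<delta> 1 = 0 \<and> \<delta> 3 = 0 \<and> \<delta> 4 = 0 \<and> \<delta> 6 = 0 \<and>
        \<delta> 2 = s * \<epsilon> 1 / 3 * (\<nu> - \<mu>) \<and> \<delta> 5 = s * \<epsilon> 1 / 3 * (\<nu> - \<mu>))"

definition class6 :: "real \<Rightarrow> real \<Rightarrow> real \<Rightarrow> real \<Rightarrow> (nat \<Rightarrow> real) \<Rightarrow> real
    \<Rightarrow> (nat \<Rightarrow> nat \<Rightarrow> real) \<Rightarrow> (nat \<Rightarrow> real) \<Rightarrow> bool" where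
  "class6 lam \<mu> \<nu> \<rho> \<epsilon> h F \<delta> \<longleftrightarrow>
     (\<exists>s\<in>{-1, 1}. \<exists>t\<in>{-1, 1}.
        \<rho> = - 2 * lam \<and> \<rho> \<noteq> 0 \<and> \<mu> = 2 * s * lam \<and> \<nu> = 0 \<and> \<epsilon> 1 = 1 \<and> \<epsilon> 3 = -1 \<and> h = 0 \<and>
        F 1 2 = t * lam \<and> F 2 3 = 2 * s * t * lam \<and> F 1 3 = 0 \<and>
        \<delta> 0 = 0 \<and> \<delta> 1 = 0 \<and> \<delta> 3 = 0 \<and> \<delta> 4 = 0 \<and> \<delta> 6 = 0 \<and> \<delta> 2 = - lam \<and> \<delta> 5 = - lam)"

definition class7 :: "real \<Rightarrow> real \<Rightarrow> real \<Rightarrow> real \<Rightarrow> (nat \<Rightarrow> real) \<Rightarrow> real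
    \<Rightarrow> (nat \<Rightarrow> nat \<Rightarrow> real) \<Rightarrow> (nat \<Rightarrow> real) \<Rightarrow> bool" where
  "class7 lam \<mu> \<nu> \<rho> \<epsilon> h F \<delta> \<longleftrightarrow>
     \<mu> \<noteq> 0 \<and> \<nu> \<noteq> 0 \<and> F 1 2 \<noteq> 0 \<and> F 2 3 \<noteq> 0 \<and> \<epsilon> 1 * lam + \<epsilon> 3 * \<rho> \<noteq> 0 \<and>
     F 1 3 = 0 \<and> h = 0 \<and> \<delta> 0 = 0 \<and> \<delta> 1 = 0 \<and> \<delta> 3 = 0 \<and> \<delta> 4 = 0 \<and> \<delta> 6 = 0 \<and> \<delta> 2 = \<delta> 5 \<and>
     F 1 2 * \<epsilon> 3 * (\<delta> 2 + \<epsilon> 1 * lam) = F 2 3 * \<nu> \<and>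
     F 1 2 * \<mu> = F 2 3 * \<epsilon> 1 * (\<epsilon> 3 * \<rho> + \<delta> 2) \<and>
     (F 1 2)\<^sup>2 = \<epsilon> 3 / 2 * (\<nu>\<^sup>2 - \<mu>\<^sup>2) + \<delta> 2 * lam \<and>
     (F 2 3)\<^sup>2 = \<epsilon> 1 / 2 * (\<mu>\<^sup>2 - \<nu>\<^sup>2) + \<delta> 2 * \<rho> \<and>
     \<delta> 2 * (\<epsilon> 1 * lam + \<epsilon> 3 * \<rho>) = - lam\<^sup>2 - \<epsilon> 1 * \<epsilon> 3 / 2 * (\<mu> + \<nu>)\<^sup>2 - \<rho>\<^sup>2 \<and>
     F 1 2 * F 2 3 = \<epsilon> 1 / 2 * lam * (\<nu> - \<mu>) + \<epsilon> 3 / 2 * \<rho> * (\<mu> - \<nu>) - \<delta> 2 / 2 * (\<mu> + \<nu>)"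

definition in_classes :: "real \<Rightarrow> real \<Rightarrow> real \<Rightarrow> real \<Rightarrow> (nat \<Rightarrow> real) \<Rightarrow> real
    \<Rightarrow> (nat \<Rightarrow> nat \<Rightarrow> real) \<Rightarrow> (nat \<Rightarrow> real) \<Rightarrow> bool" where
  "in_classes lam \<mu> \<nu> \<rho> \<epsilon> h F \<delta> \<longleftrightarrow>
     class1 lam \<mu> \<nu> \<rho> \<epsilon> h F \<delta> \<or> class2 lam \<mu> \<nu> \<rho> \<epsilon> h F \<delta> \<or> class3 lam \<mu> \<nu> \<rho> \<epsilon> h F \<delta> \<or>
     class4 lam \<mu> \<nu> \<rho> \<epsilon> h F \<delta> \<or> class5 lam \<mu> \<nu> \<rho> \<epsilon> h F \<delta> \<or> class6 lam \<mu> \<nu> \<rho> \<epsilon> h F \<delta> \<or>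
     class7 lam \<mu> \<nu> \<rho> \<epsilon> h F \<delta>"

abbreviation swap13 :: "nat \<Rightarrow> nat" where
  "swap13 \<equiv> Transposition.transpose 1 3"

abbreviation swap13_46 :: "nat \<Rightarrow> nat" where
  "swap13_46 \<equiv> Transposition.transpose 1 3 \<circ> Transposition.transpose 4 6"

text \<open>Interchanging \<open>v\<^sub>1\<close> and \<open>v\<^sub>3\<close> interchanges \<open>lam\<close> with \<open>\<rho>\<close> and \<open>\<mu>\<close> with \<open>\<nu>\<close>, and changes the
  sign of \<open>h = H(v\<^sub>1, v\<^sub>2, v\<^sub>3)\<close>.\<close>

definition in_classes_swapped :: "real \<Rightarrow> real \<Rightarrow> real \<Rightarrow> real \<Rightarrow> (nat \<Rightarrow> real) \<Rightarrow> real
    \<Rightarrow> (nat \<Rightarrow> nat \<Rightarrow> real) \<Rightarrow> (nat \<Rightarrow> real) \<Rightarrow> bool" where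
  "in_classes_swapped lam \<mu> \<nu> \<rho> \<epsilon> h F \<delta> \<longleftrightarrow>
     in_classes \<rho> \<nu> \<mu> lam (\<epsilon> \<circ> swap13) (- h) (\<lambda>a b. F (swap13 a) (swap13 b)) (\<delta> \<circ> swap13_46)"

end

theory Submission
  imports Defs
begin

text \<open>
  All data are left-invariant, so the theorem becomes algebra as soon as two things are known: the
  sections form a free module over the smooth functions with a frame of left-invariant sections,
  and the Ricci tensors can be expressed through the structure constants of that frame.

  For the frame, a left-invariant vector field that vanishes at one point vanishes everywhere. Hence
  \<open>v\<^sub>1, v\<^sub>2, v\<^sub>3\<close> are independent at each point, and Cramer's rule in a chart shows that every vector
  field is a combination of them with smooth coefficients (\<open>frame_coeffs_exist\<close>). The sections
  \<open>e\<^sub>0, \<dots>, e\<^sub>6\<close> are then an orthogonal basis, \<open>\<langle>e\<^sub>A, e\<^sub>A\<rangle> = \<eta>\<^sub>A\<close>, and the functions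
  \<open>B\<^sub>A\<^sub>B\<^sub>C = \<langle>[e\<^sub>A, e\<^sub>B], e\<^sub>C\<rangle>\<close> are constant and totally skew.

  For the curvature, let \<open>D\<close> be any Levi-Civita generalized connection and put
  \<open>\<Gamma>\<^sub>A\<^sub>B\<^sub>C = \<langle>D\<^sub>A e\<^sub>B, e\<^sub>C\<rangle>\<close>. If the index \<open>A\<close> belongs to one of the two subbundles and \<open>B, C\<close> to the other,
  then vanishing torsion gives \<open>\<Gamma>\<^sub>A\<^sub>B\<^sub>C = B\<^sub>A\<^sub>B\<^sub>C\<close>. The remaining coefficients are not determined and need
  not be constant, but they enter \<open>Ric(e\<^sub>p, e\<^sub>j)\<close> only through the traces \<open>\<Sum>\<^sub>i \<eta>\<^sub>i \<Gamma>\<^sub>i\<^sub>k\<^sub>i\<close>, which are the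
  components \<open>\<delta>\<^sub>k\<close> of the divergence. This gives (\<open>ricci_e\<close>)
  \<open>Ric(e\<^sub>p, e\<^sub>j) = \<Sum>\<^sub>k \<eta>\<^sub>k B\<^sub>p\<^sub>j\<^sub>k \<delta>\<^sub>k - \<Sum>\<^sub>i\<^sub>,\<^sub>q \<eta>\<^sub>i \<eta>\<^sub>q B\<^sub>i\<^sub>p\<^sub>q B\<^sub>q\<^sub>j\<^sub>i\<close>, where \<open>i, k\<close> run over the subbundle of \<open>j\<close> and \<open>q\<close> over
  that of \<open>p\<close>. As a connection with any prescribed divergence exists (\<open>conn\<close>), being generalized
  Einstein is equivalent to \<open>24\<close> polynomial equations in the structure constants
  (\<open>generalized_einstein_iff\<close>), which reduce to \<open>einstein_system\<close>.

  The classification of the solutions (\<open>einstein_system_iff_classes\<close>) starts from the equation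
  \<open>h (\<epsilon>\<^sub>1 \<lambda> + \<epsilon>\<^sub>3 \<rho> + \<delta>\<^sub>2) = 0\<close>. If the second factor vanishes, the quadratic equations imply
  \<open>(\<nu> - \<mu> + h) (3 (\<nu> - \<mu> + h) + 2 (\<mu> - \<nu>)) = 0\<close>. The solutions with \<open>h = \<mu> - \<nu>\<close> form the classes 1a
  and 3, and those with \<open>3 h = \<mu> - \<nu> \<noteq> 0\<close> the classes 2 and 5. If \<open>h = 0\<close>, then \<open>F\<^sub>2\<^sub>3 = 0\<close> leads to class 1,
  \<open>\<nu> = 0\<close> to class 6, and the generic case to class 7, except that a nonzero \<open>\<delta>\<^sub>i\<close> with \<open>i \<noteq> 2, 5\<close>
  forces \<open>\<delta>\<^sub>2 = - (\<epsilon>\<^sub>1 \<lambda> + \<epsilon>\<^sub>3 \<rho>)\<close> and \<open>\<mu> = \<nu>\<close>, which is the case \<open>h = \<mu> - \<nu>\<close> again. The cases left over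
  arise from these by interchanging \<open>v\<^sub>1\<close> and \<open>v\<^sub>3\<close>; in particular class 4 becomes a part of class 3
  in this way.
\<close>

section \<open>Calculus of smooth maps\<close>

lemma cont_diff_on_cong:
  assumes "open S" "\<And>x. x \<in> S \<Longrightarrow> f x = g x" "cont_diff_on k f S"
  shows "cont_diff_on k g S"
  using assms(2,3)
proof (induction k arbitrary: f g)
  case 0
  then show ?case by (simp cong: continuous_on_cong)
next
  case (Suc k)
  have D: "(g has_derivative frechet_derivative f (at x)) (at x)" if "x \<in> S" for x
    by (rule has_derivative_transform_within_open[of f _ x UNIV S])
      (use Suc.prems that assms(1) in \<open>auto simp: frechet_derivative_works[symmetric]\<close>)
  have E: "frechet_derivative f (at x) = frechet_derivative g (at x)" if "x \<in> S" for x
    by (rule frechet_derivative_at[OF D[OF that]])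
  have "cont_diff_on k (\<lambda>x. frechet_derivative g (at x) v) S" for v
  proof (rule Suc.IH[of "\<lambda>x. frechet_derivative f (at x) v", rotated])
    show "cont_diff_on k (\<lambda>x. frechet_derivative f (at x) v) S" using Suc.prems(2) by simp
  qed (simp add: E)
  with D show ?case by (auto simp: differentiable_def)
qed

lemma smooth_on_cong:
  "open S \<Longrightarrow> (\<And>x. x \<in> S \<Longrightarrow> f x = g x) \<Longrightarrow> smooth_on f S \<Longrightarrow> smooth_on g S"
  unfolding smooth_on_def using cont_diff_on_cong by blast

lemma cont_diff_on_Suc_D: "cont_diff_on (Suc k) f S \<Longrightarrow> cont_diff_on k f S"
proof (induction k arbitrary: f)
  case 0
  then show ?case
    by (auto intro!: continuous_at_imp_continuous_on differentiable_imp_continuous_within)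
qed auto

lemma cont_diff_on_const: "cont_diff_on k (\<lambda>_. c) S"
proof (induction k arbitrary: c)
  case (Suc k)
  have "frechet_derivative (\<lambda>_. c) (at x) = (\<lambda>_. 0)" for x :: 'a
    by (metis frechet_derivative_at has_derivative_const)
  with Suc show ?case by simp
qed simp

lemma cont_diff_on_add:
  assumes "open S" "cont_diff_on k f S" "cont_diff_on k g S"
  shows "cont_diff_on k (\<lambda>x. f x + g x) S"
  using assms(2,3)
proof (induction k arbitrary: f g)
  case 0
  then show ?case by (simp add: continuous_on_add)
next
  case (Suc k)
  have D: "((\<lambda>x. f x + g x) has_derivative
      (\<lambda>v. frechet_derivative f (at x) v + frechet_derivative g (at x) v)) (at x)" if "x \<in> S" for x
    using Suc.prems that by (auto intro!: has_derivative_add simp: frechet_derivative_works[symmetric])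
  then have E: "frechet_derivative (\<lambda>x. f x + g x) (at x) v
      = frechet_derivative f (at x) v + frechet_derivative g (at x) v" if "x \<in> S" for x v
    using fun_cong[OF frechet_derivative_at[OF D[OF that]], of v] by simp
  have "cont_diff_on k (\<lambda>x. frechet_derivative (\<lambda>x. f x + g x) (at x) v) S" for v
    using Suc by (intro cont_diff_on_cong[OF assms(1) E[symmetric]] Suc.IH) auto
  with D show ?case by (auto simp: differentiable_def)
qed

text \<open>The derivative of a product is a sum of products of the same kind with one factor of lower
  regularity, so a single induction over the order covers real multiples, scalar multiples of vectors
  and components.\<close>

lemma cont_diff_on_bilinear:
  assumes "bounded_bilinear bl" "open S" "cont_diff_on k f S" "cont_diff_on k g S"
  shows "cont_diff_on k (\<lambda>x. bl (f x) (g x)) S"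
  using assms(3,4)
proof (induction k arbitrary: f g)
  case 0
  then show ?case using bounded_bilinear.continuous_on[OF assms(1)] by simp
next
  case (Suc k)
  have D: "((\<lambda>x. bl (f x) (g x)) has_derivative
      (\<lambda>v. bl (f x) (frechet_derivative g (at x) v) + bl (frechet_derivative f (at x) v) (g x))) (at x)"
    if "x \<in> S" for x
    using Suc.prems that
    by (auto intro!: bounded_bilinear.FDERIV[OF assms(1)] simp: frechet_derivative_works[symmetric])
  then have E: "frechet_derivative (\<lambda>x. bl (f x) (g x)) (at x) v
      = bl (f x) (frechet_derivative g (at x) v) + bl (frechet_derivative f (at x) v) (g x)"
    if "x \<in> S" for x v
    using fun_cong[OF frechet_derivative_at[OF D[OF that]], of v] by simp
  have "cont_diff_on k (\<lambda>x. frechet_derivative (\<lambda>x. bl (f x) (g x)) (at x) v) S" for v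
    using Suc.prems cont_diff_on_Suc_D[OF Suc.prems(1)] cont_diff_on_Suc_D[OF Suc.prems(2)]
    by (intro cont_diff_on_cong[OF assms(2) E[symmetric]] cont_diff_on_add[OF assms(2)] Suc.IH) auto
  with D show ?case by (auto simp: differentiable_def)
qed

text \<open>The derivative of \<open>1 / f\<close> is a product of \<open>1 / f\<close>, \<open>1 / f\<close> and \<open>f'\<close>, to which the induction
  hypothesis applies.\<close>

lemma cont_diff_on_inverse:
  fixes f :: "'a::real_normed_vector \<Rightarrow> real"
  assumes "open S" "cont_diff_on k f S" "\<And>x. x \<in> S \<Longrightarrow> f x \<noteq> 0"
  shows "cont_diff_on k (\<lambda>x. inverse (f x)) S"
  using assms(2)
proof (induction k)
  case 0
  then show ?case using assms(3) by (auto intro!: continuous_on_inverse)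
next
  case (Suc k)
  note mult = cont_diff_on_bilinear[OF bounded_bilinear_mult assms(1)]
  have D: "((\<lambda>x. inverse (f x)) has_derivative
      (\<lambda>v. (-1 * (inverse (f x) * inverse (f x))) * frechet_derivative f (at x) v)) (at x)" if "x \<in> S" for x
  proof -
    have "(f has_derivative frechet_derivative f (at x)) (at x)"
      using Suc.prems that by (auto simp: frechet_derivative_works[symmetric])
    from Deriv.has_derivative_inverse[OF assms(3)[OF that] this] show ?thesis
      by (rule has_derivative_eq_rhs) (simp add: mult_ac fun_eq_iff)
  qed
  then have E: "frechet_derivative (\<lambda>x. inverse (f x)) (at x) v
      = (-1 * (inverse (f x) * inverse (f x))) * frechet_derivative f (at x) v" if "x \<in> S" for x v
    using fun_cong[OF frechet_derivative_at[OF D[OF that]], of v] by simp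
  have "cont_diff_on k (\<lambda>x. inverse (f x)) S"
    using Suc.IH cont_diff_on_Suc_D[OF Suc.prems] by blast
  then have "cont_diff_on k (\<lambda>x. frechet_derivative (\<lambda>x. inverse (f x)) (at x) v) S" for v
    using Suc.prems
    by (intro cont_diff_on_cong[OF assms(1) E[symmetric]] mult cont_diff_on_const) auto
  with D show ?case by (auto simp: differentiable_def)
qed

lemma smooth_on_const: "smooth_on (\<lambda>_. c) S"
  by (simp add: smooth_on_def cont_diff_on_const)

lemma smooth_on_add:
  "open S \<Longrightarrow> smooth_on f S \<Longrightarrow> smooth_on g S \<Longrightarrow> smooth_on (\<lambda>x. f x + g x) S"
  by (simp add: smooth_on_def cont_diff_on_add)

lemma smooth_on_bilinear:
  "bounded_bilinear bl \<Longrightarrow> open S \<Longrightarrow> smooth_on f S \<Longrightarrow> smooth_on g S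
    \<Longrightarrow> smooth_on (\<lambda>x. bl (f x) (g x)) S"
  by (simp add: smooth_on_def cont_diff_on_bilinear)

lemmas smooth_on_mult =
  smooth_on_bilinear[OF bounded_bilinear_mult[where 'a = real]]
lemmas smooth_on_scaleR = smooth_on_bilinear[OF bounded_bilinear_scaleR]

lemma smooth_on_nth:
  fixes f :: "'a::real_normed_vector \<Rightarrow> real ^ 'n"
  assumes "open S" "smooth_on f S"
  shows "smooth_on (\<lambda>x. f x $ i) S"
  using smooth_on_bilinear[OF bounded_bilinear_inner assms(1) smooth_on_const assms(2), of "axis i 1"]
  by (simp add: cart_eq_inner_axis inner_commute)

lemma smooth_on_inverse:
  fixes f :: "'a::real_normed_vector \<Rightarrow> real"
  shows "open S \<Longrightarrow> smooth_on f S \<Longrightarrow> (\<And>x. x \<in> S \<Longrightarrow> f x \<noteq> 0) \<Longrightarrow> smooth_on (\<lambda>x. inverse (f x)) S"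
  by (simp add: smooth_on_def cont_diff_on_inverse)

lemma smooth_on_diff:
  fixes f g :: "'a::real_normed_vector \<Rightarrow> real"
  assumes "open S" "smooth_on f S" "smooth_on g S"
  shows "smooth_on (\<lambda>x. f x - g x) S"
  using smooth_on_add[OF assms(1,2) smooth_on_mult[OF assms(1) smooth_on_const assms(3)], of "-1"]
  by simp

lemma smooth_on_sum:
  assumes "open S" "finite I" "\<And>i. i \<in> I \<Longrightarrow> smooth_on (f i) S"
  shows "smooth_on (\<lambda>x. \<Sum>i\<in>I. f i x) S"
  using assms(2,3)
  by (induction I rule: finite_induct) (auto intro!: smooth_on_const smooth_on_add[OF assms(1)])

lemma smooth_on_differentiable: "smooth_on f S \<Longrightarrow> x \<in> S \<Longrightarrow> f differentiable (at x)"
  unfolding smooth_on_def by (metis cont_diff_on.simps(2))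

lemma smooth_on_derivative: "smooth_on f S \<Longrightarrow> smooth_on (\<lambda>x. frechet_derivative f (at x) v) S"
  unfolding smooth_on_def by (metis cont_diff_on.simps(2))

lemma smooth_on_det3:
  fixes A :: "'a::real_normed_vector \<Rightarrow> real ^ 3 ^ 3"
  assumes "open S" "\<And>i j. smooth_on (\<lambda>x. A x $ i $ j) S"
  shows "smooth_on (\<lambda>x. det (A x)) S"
  unfolding det_3
  by (intro smooth_on_add[OF assms(1)] smooth_on_diff[OF assms(1)] smooth_on_mult[OF assms(1)] assms(2))

text \<open>In every chart this is the function \<open>X f\<close> for the vector field \<open>X\<close> with coefficients \<open>a\<close>.\<close>

lemma smooth_on_directional_derivative:
  fixes f :: "real ^ 'n \<Rightarrow> real" and a :: "real ^ 'n \<Rightarrow> real ^ 'n"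
  assumes "open S" "smooth_on f S" "smooth_on a S"
  shows "smooth_on (\<lambda>x. frechet_derivative f (at x) (a x)) S"
proof -
  have "(\<Sum>i\<in>UNIV. a x $ i * frechet_derivative f (at x) (axis i 1)) = frechet_derivative f (at x) (a x)"
    if "x \<in> S" for x
  proof -
    interpret linear "frechet_derivative f (at x)"
      using smooth_on_differentiable[OF assms(2) that] linear_frechet_derivative by blast
    have "frechet_derivative f (at x) (\<Sum>i\<in>UNIV. a x $ i *\<^sub>R axis i 1)
        = (\<Sum>i\<in>UNIV. a x $ i * frechet_derivative f (at x) (axis i 1))"
      by (simp add: sum scale)
    then show ?thesis by (simp add: basis_expansion flip: scalar_mult_eq_scaleR)
  qed
  moreover have "smooth_on (\<lambda>x. \<Sum>i\<in>UNIV. a x $ i * frechet_derivative f (at x) (axis i 1)) S"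
    by (intro smooth_on_sum[OF assms(1)] smooth_on_mult[OF assms(1)] smooth_on_nth[OF assms(1,3)]
        smooth_on_derivative[OF assms(2)]) simp
  ultimately show ?thesis by (rule smooth_on_cong[OF assms(1)])
qed

section \<open>Modules of functions, vector fields and one-forms\<close>

locale manifold =
  fixes G :: "'g::{t2_space,second_countable_topology} lie_structure"
  assumes atlas: "smooth_atlas (charts G)"
begin

abbreviation K :: "('g \<Rightarrow> real) set" where "K \<equiv> smooth_functions G"
abbreviation VF :: "'g field set" where "VF \<equiv> vector_fields G"

lemma chart_at: obtains U \<phi> where "(U, \<phi>) \<in> charts G" "p \<in> U"
proof -
  have "p \<in> (\<Union>(U, \<phi>)\<in>charts G. U)" using atlas by (simp add: smooth_atlas_def)
  then show thesis using that by auto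
qed

lemma chart:
  assumes "(U, \<phi>) \<in> charts G"
  shows "open (\<phi> ` U)" "p \<in> U \<Longrightarrow> inv_into U \<phi> (\<phi> p) = p"
proof -
  from atlas assms have *: "open (\<phi> ` U)" "homeomorphism U (\<phi> ` U) \<phi> (inv_into U \<phi>)"
    unfolding smooth_atlas_def by blast+
  then show "open (\<phi> ` U)" by blast
  show "p \<in> U \<Longrightarrow> inv_into U \<phi> (\<phi> p) = p"
    using homeomorphism_apply1[OF *(2)] .
qed

lemma K_iff: "f \<in> K \<longleftrightarrow> (\<forall>(U, \<phi>)\<in>charts G. smooth_on (\<lambda>x. f (inv_into U \<phi> x)) (\<phi> ` U))"
  by (simp add: smooth_functions_def o_def)

lemma K_cst [simp]: "cst c \<in> K"
  by (auto simp: K_iff smooth_on_const)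

lemma K_0 [simp]: "0 \<in> K" and K_1 [simp]: "1 \<in> K"
  using K_cst[of 0] K_cst[of 1] by (simp_all add: zero_fun_def one_fun_def)

lemma K_add [simp]: "f \<in> K \<Longrightarrow> g \<in> K \<Longrightarrow> f + g \<in> K"
  by (auto simp: K_iff intro!: smooth_on_add chart(1))

lemma K_mult [simp]: "f \<in> K \<Longrightarrow> g \<in> K \<Longrightarrow> f * g \<in> K"
  by (auto simp: K_iff intro!: smooth_on_mult chart(1))

lemma K_uminus [simp]: "f \<in> K \<Longrightarrow> - f \<in> K"
  using K_mult[OF K_cst[of "-1"], of f] by (simp add: times_fun_def fun_Compl_def)

lemma K_diff [simp]: "f \<in> K \<Longrightarrow> g \<in> K \<Longrightarrow> f - g \<in> K"
  using K_add[of f "- g"] by simp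

lemma K_sum [simp]: "(\<And>i. i \<in> I \<Longrightarrow> f i \<in> K) \<Longrightarrow> sum f I \<in> K"
  by (induction I rule: infinite_finite_induct) auto

lemma K_differentiable:
  assumes "(U, \<phi>) \<in> charts G" "p \<in> U" "f \<in> K"
  shows "(f \<circ> inv_into U \<phi>) differentiable (at (\<phi> p))"
  using assms smooth_on_differentiable[of "f \<circ> inv_into U \<phi>" "\<phi> ` U"]
  by (force simp: smooth_functions_def)

text \<open>By the next lemmas a vector field is a derivation of the smooth functions with smooth values,
  and vector fields form a module. Beyond them, charts only occur in the construction of the frame.\<close>

lemma vf_coeff:
  assumes "X \<in> VF" "(U, \<phi>) \<in> charts G"
  obtains a where "smooth_on a (\<phi> ` U)"
    "\<And>f p. f \<in> K \<Longrightarrow> p \<in> U \<Longrightarrow>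
       X f p = frechet_derivative (f \<circ> inv_into U \<phi>) (at (\<phi> p)) (a (\<phi> p))"
proof -
  have "\<forall>(U, \<phi>)\<in>charts G. \<exists>a. smooth_on a (\<phi> ` U) \<and> (\<forall>f\<in>K. \<forall>p\<in>U.
           X f p = frechet_derivative (f \<circ> inv_into U \<phi>) (at (\<phi> p)) (a (\<phi> p)))"
    using assms(1) by (simp add: vector_fields_def)
  from bspec[OF this assms(2)] show thesis using that by auto
qed

lemma vf_outside: "X \<in> VF \<Longrightarrow> f \<notin> K \<Longrightarrow> X f = 0"
  by (simp add: vector_fields_def)

lemma vf_K:
  assumes "X \<in> VF"
  shows "X f \<in> K"
proof (cases "f \<in> K")
  case True
  show ?thesis unfolding K_iff
  proof clarify
    fix U and \<phi> :: "'g \<Rightarrow> real ^ 3" assume c: "(U, \<phi>) \<in> charts G"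
    obtain a where a: "smooth_on a (\<phi> ` U)" "\<And>p. p \<in> U \<Longrightarrow>
       X f p = frechet_derivative (f \<circ> inv_into U \<phi>) (at (\<phi> p)) (a (\<phi> p))"
      using vf_coeff[OF assms c] True by metis
    show "smooth_on (\<lambda>x. X f (inv_into U \<phi> x)) (\<phi> ` U)"
    proof (rule smooth_on_cong[OF chart(1)[OF c]])
      show "smooth_on (\<lambda>x. frechet_derivative (f \<circ> inv_into U \<phi>) (at x) (a x)) (\<phi> ` U)"
        using True c a chart(1)[OF c]
        by (intro smooth_on_directional_derivative) (auto simp: smooth_functions_def)
    qed (use a(2) chart(2)[OF c] in auto)
  qed
qed (simp add: vf_outside[OF assms])

lemma vf_add:
  assumes "X \<in> VF" "f \<in> K" "f' \<in> K"
  shows "X (f + f') = X f + X f'"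
proof
  fix p
  obtain U \<phi> where c: "(U, \<phi>) \<in> charts G" "p \<in> U" by (rule chart_at)
  obtain a where a: "\<And>f p. f \<in> K \<Longrightarrow> p \<in> U \<Longrightarrow>
       X f p = frechet_derivative (f \<circ> inv_into U \<phi>) (at (\<phi> p)) (a (\<phi> p))"
    using vf_coeff[OF assms(1) c(1)] by metis
  let ?c = "\<lambda>f. f \<circ> inv_into U \<phi>"
  have d: "(?c f has_derivative frechet_derivative (?c f) (at (\<phi> p))) (at (\<phi> p))" if "f \<in> K" for f
    using K_differentiable[OF c that] by (simp flip: frechet_derivative_works)
  have D: "((\<lambda>x. ?c f x + ?c f' x) has_derivative (\<lambda>v. frechet_derivative (?c f) (at (\<phi> p)) v
      + frechet_derivative (?c f') (at (\<phi> p)) v)) (at (\<phi> p))"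
    by (intro has_derivative_add d assms)
  have E: "?c (f + f') = (\<lambda>x. ?c f x + ?c f' x)" by auto
  have "frechet_derivative (?c (f + f')) (at (\<phi> p))
      = (\<lambda>v. frechet_derivative (?c f) (at (\<phi> p)) v + frechet_derivative (?c f') (at (\<phi> p)) v)"
    unfolding E by (rule frechet_derivative_at[OF D, symmetric])
  then show "X (f + f') p = (X f + X f') p"
    using assms c by (simp add: a)
qed

lemma vf_mult:
  assumes "X \<in> VF" "f \<in> K" "f' \<in> K"
  shows "X (f * f') = f * X f' + X f * f'"
proof
  fix p
  obtain U \<phi> where c: "(U, \<phi>) \<in> charts G" "p \<in> U" by (rule chart_at)
  obtain a where a: "\<And>f p. f \<in> K \<Longrightarrow> p \<in> U \<Longrightarrow>
       X f p = frechet_derivative (f \<circ> inv_into U \<phi>) (at (\<phi> p)) (a (\<phi> p))"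
    using vf_coeff[OF assms(1) c(1)] by metis
  let ?c = "\<lambda>f. f \<circ> inv_into U \<phi>"
  have d: "(?c f has_derivative frechet_derivative (?c f) (at (\<phi> p))) (at (\<phi> p))" if "f \<in> K" for f
    using K_differentiable[OF c that] by (simp flip: frechet_derivative_works)
  have D: "((\<lambda>x. ?c f x * ?c f' x) has_derivative (\<lambda>v. ?c f (\<phi> p) * frechet_derivative (?c f') (at (\<phi> p)) v
      + frechet_derivative (?c f) (at (\<phi> p)) v * ?c f' (\<phi> p))) (at (\<phi> p))"
    by (intro has_derivative_mult d assms)
  have E: "?c (f * f') = (\<lambda>x. ?c f x * ?c f' x)" by auto
  have "frechet_derivative (?c (f * f')) (at (\<phi> p))
      = (\<lambda>v. ?c f (\<phi> p) * frechet_derivative (?c f') (at (\<phi> p)) v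
          + frechet_derivative (?c f) (at (\<phi> p)) v * ?c f' (\<phi> p))"
    unfolding E by (rule frechet_derivative_at[OF D, symmetric])
  then show "X (f * f') p = (f * X f' + X f * f') p"
    using assms c by (simp add: a chart(2))
qed

lemma vf_cst:
  assumes "X \<in> VF"
  shows "X (cst c) = 0"
proof
  fix p
  obtain U \<phi> where c: "(U, \<phi>) \<in> charts G" "p \<in> U" by (rule chart_at)
  obtain a where a: "\<And>f p. f \<in> K \<Longrightarrow> p \<in> U \<Longrightarrow>
       X f p = frechet_derivative (f \<circ> inv_into U \<phi>) (at (\<phi> p)) (a (\<phi> p))"
    using vf_coeff[OF assms(1) c(1)] by metis
  have "frechet_derivative (\<lambda>_. c) (at (\<phi> p)) = (\<lambda>_. 0)"
    by (metis frechet_derivative_at has_derivative_const)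
  then show "X (cst c) p = 0 p" using a[OF K_cst c(2)] by (simp add: o_def)
qed

lemma vf_0: "X \<in> VF \<Longrightarrow> X 0 = 0"
  using vf_cst[of X 0] by (simp add: zero_fun_def)

lemma vf_uminus: "X \<in> VF \<Longrightarrow> f \<in> K \<Longrightarrow> X (- f) = - X f"
  using vf_add[of X f "- f"] vf_0[of X] by (simp add: eq_neg_iff_add_eq_0 add.commute)

lemma vf_diff: "X \<in> VF \<Longrightarrow> f \<in> K \<Longrightarrow> f' \<in> K \<Longrightarrow> X (f - f') = X f - X f'"
  using vf_add[of X f "- f'"] vf_uminus[of X f'] by simp

lemma vf_sum: "X \<in> VF \<Longrightarrow> (\<And>i. i \<in> I \<Longrightarrow> f i \<in> K) \<Longrightarrow> X (sum f I) = (\<Sum>i\<in>I. X (f i))"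
proof (induction I rule: infinite_finite_induct)
  case (insert i I)
  then show ?case using vf_add[OF insert.prems(1), of "f i" "sum f I"] by simp
qed (use vf_0[of X] in auto)

lemma VF_0 [simp]: "0 \<in> VF"
  unfolding vector_fields_def
  by (auto intro!: exI[of _ "\<lambda>_. 0"] smooth_on_const linear_0 linear_frechet_derivative K_differentiable
      simp: linear_0[OF linear_frechet_derivative])

lemma VF_add [simp]:
  assumes "X \<in> VF" "Y \<in> VF"
  shows "X + Y \<in> VF"
  unfolding vector_fields_def
proof (intro CollectI conjI allI impI, goal_cases)
  case (1 f) then show ?case using vf_outside[OF assms(1) 1] vf_outside[OF assms(2) 1] by simp
next
  case 2
  show ?case
  proof clarify
    fix U and \<phi> :: "'g \<Rightarrow> real ^ 3" assume c: "(U, \<phi>) \<in> charts G"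
    obtain a where a: "smooth_on a (\<phi> ` U)" "\<And>f p. f \<in> K \<Longrightarrow> p \<in> U \<Longrightarrow>
       X f p = frechet_derivative (f \<circ> inv_into U \<phi>) (at (\<phi> p)) (a (\<phi> p))"
      using vf_coeff[OF assms(1) c] by metis
    obtain b where b: "smooth_on b (\<phi> ` U)" "\<And>f p. f \<in> K \<Longrightarrow> p \<in> U \<Longrightarrow>
       Y f p = frechet_derivative (f \<circ> inv_into U \<phi>) (at (\<phi> p)) (b (\<phi> p))"
      using vf_coeff[OF assms(2) c] by metis
    show "\<exists>a. smooth_on a (\<phi> ` U) \<and> (\<forall>f\<in>K. \<forall>p\<in>U. (X + Y) f p
        = frechet_derivative (f \<circ> inv_into U \<phi>) (at (\<phi> p)) (a (\<phi> p)))"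
      using smooth_on_add[OF chart(1)[OF c] a(1) b(1)] a(2) b(2)
      by (intro exI[of _ "\<lambda>x. a x + b x"])
        (auto simp: linear_add[OF linear_frechet_derivative[OF K_differentiable[OF c]]])
  qed
qed

lemma VF_fscale [simp]:
  assumes "h \<in> K" "X \<in> VF"
  shows "fscale h X \<in> VF"
  unfolding vector_fields_def
proof (intro CollectI conjI allI impI, goal_cases)
  case (1 f) then show ?case using vf_outside[OF assms(2) 1] by (simp add: fscale_def)
next
  case 2
  show ?case
  proof clarify
    fix U and \<phi> :: "'g \<Rightarrow> real ^ 3" assume c: "(U, \<phi>) \<in> charts G"
    obtain a where a: "smooth_on a (\<phi> ` U)" "\<And>f p. f \<in> K \<Longrightarrow> p \<in> U \<Longrightarrow>
       X f p = frechet_derivative (f \<circ> inv_into U \<phi>) (at (\<phi> p)) (a (\<phi> p))"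
      using vf_coeff[OF assms(2) c] by metis
    have "smooth_on (h \<circ> inv_into U \<phi>) (\<phi> ` U)" using assms(1) c by (auto simp: smooth_functions_def)
    from smooth_on_scaleR[OF chart(1)[OF c] this a(1)] a(2)
    show "\<exists>a. smooth_on a (\<phi> ` U) \<and> (\<forall>f\<in>K. \<forall>p\<in>U. fscale h X f p
        = frechet_derivative (f \<circ> inv_into U \<phi>) (at (\<phi> p)) (a (\<phi> p)))"
      by (intro exI[of _ "\<lambda>x. (h \<circ> inv_into U \<phi>) x *\<^sub>R a x"])
        (auto simp: linear_scale[OF linear_frechet_derivative[OF K_differentiable[OF c]]] chart(2)[OF c]
          fscale_def)
  qed
qed

end

lemma fscale_simps [simp]:
  "fscale f (X + Y) = fscale f X + fscale f Y"
  "fscale f (X - Y) = fscale f X - fscale f Y"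
  "fscale f (- X) = - fscale f X"
  "fscale f 0 = 0"
  "fscale 0 X = 0"
  "fscale 1 X = X"
  "fscale (- f) X = - fscale f X"
  "fscale f (fscale g X) = fscale (f * g) X"
  by (auto simp: fscale_def fun_eq_iff algebra_simps)

lemma fscale_add_left: "fscale (f + g) X = fscale f X + fscale g X"
  and fscale_diff_left: "fscale (f - g) X = fscale f X - fscale g X"
  by (auto simp: fscale_def fun_eq_iff algebra_simps)

lemma fscale_apply: "fscale f X y = f * X y"
  by (simp add: fscale_def)

lemma cst_simps:
  "cst a + cst b = cst (a + b)" "cst a - cst b = cst (a - b)" "cst a * cst b = cst (a * b)"
  "- cst a = cst (- a)"
  by (auto simp: fun_eq_iff)

lemma lie_bracket_skew: "lie_bracket X Y = - lie_bracket Y X"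
  by (auto simp: lie_bracket_def fun_eq_iff)

lemma lie_bracket_self [simp]: "lie_bracket X X = 0"
  by (auto simp: lie_bracket_def fun_eq_iff)

context manifold
begin

lemma VF_uminus [simp]: "X \<in> VF \<Longrightarrow> - X \<in> VF"
  using VF_fscale[OF K_cst[of "-1"], of X] by (simp add: fscale_def times_fun_def fun_Compl_def)

lemma VF_diff [simp]: "X \<in> VF \<Longrightarrow> Y \<in> VF \<Longrightarrow> X - Y \<in> VF"
  using VF_add[of X "- Y"] by simp

lemma VF_sum [simp]: "(\<And>i. i \<in> I \<Longrightarrow> f i \<in> VF) \<Longrightarrow> sum f I \<in> VF"
  by (induction I rule: infinite_finite_induct) auto

lemma lie_bracket_apply: "lie_bracket X Y f = X (Y f) - Y (X f)"
  by (simp add: lie_bracket_def)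

lemma lie_bracket_add_right:
  assumes "X \<in> VF" "Y \<in> VF" "Z \<in> VF"
  shows "lie_bracket X (Y + Z) = lie_bracket X Y + lie_bracket X Z"
proof
  fix f
  show "lie_bracket X (Y + Z) f = (lie_bracket X Y + lie_bracket X Z) f"
    using vf_add[OF assms(1) vf_K[OF assms(2)] vf_K[OF assms(3)], of f f]
    by (simp add: lie_bracket_apply)
qed

lemma lie_bracket_add_left:
  assumes "X \<in> VF" "Y \<in> VF" "Z \<in> VF"
  shows "lie_bracket (X + Y) Z = lie_bracket X Z + lie_bracket Y Z"
  unfolding lie_bracket_skew[of _ Z] lie_bracket_add_right[OF assms(3,1,2)] by simp

lemma lie_bracket_fscale_right:
  assumes "X \<in> VF" "Y \<in> VF" "f \<in> K"
  shows "lie_bracket X (fscale f Y) = fscale f (lie_bracket X Y) + fscale (X f) Y"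
proof
  fix h
  show "lie_bracket X (fscale f Y) h = (fscale f (lie_bracket X Y) + fscale (X f) Y) h"
    using vf_mult[OF assms(1,3) vf_K[OF assms(2)], of h]
    by (simp add: lie_bracket_apply fscale_apply algebra_simps)
qed

lemma lie_bracket_fscale_left:
  assumes "X \<in> VF" "Y \<in> VF" "f \<in> K"
  shows "lie_bracket (fscale f X) Y = fscale f (lie_bracket X Y) - fscale (Y f) X"
  unfolding lie_bracket_skew[of _ Y] lie_bracket_fscale_right[OF assms(2,1,3)] by simp

abbreviation F1 :: "'g form1 set" where "F1 \<equiv> one_forms G"

lemma F1_K: assumes "\<xi> \<in> F1" shows "\<xi> X \<in> K"
proof (cases "X \<in> VF")
  case False
  then have "\<xi> X = 0" using assms by (simp add: one_forms_def)
  then show ?thesis by simp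
qed (use assms in \<open>simp add: one_forms_def\<close>)

lemma F1_outside: "\<xi> \<in> F1 \<Longrightarrow> X \<notin> VF \<Longrightarrow> \<xi> X = 0"
  by (simp add: one_forms_def)

lemma F1_add: "\<xi> \<in> F1 \<Longrightarrow> X \<in> VF \<Longrightarrow> Y \<in> VF \<Longrightarrow> \<xi> (X + Y) = \<xi> X + \<xi> Y"
  by (simp add: one_forms_def)

lemma F1_fscale: "\<xi> \<in> F1 \<Longrightarrow> X \<in> VF \<Longrightarrow> f \<in> K \<Longrightarrow> \<xi> (fscale f X) = f * \<xi> X"
  by (simp add: one_forms_def)

lemma F1_0: "\<xi> \<in> F1 \<Longrightarrow> \<xi> 0 = 0"
  using F1_fscale[OF _ VF_0 K_0, of \<xi>] by simp

lemma F1_uminus: "\<xi> \<in> F1 \<Longrightarrow> X \<in> VF \<Longrightarrow> \<xi> (- X) = - \<xi> X"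
  using F1_add[of \<xi> X "- X"] F1_0[of \<xi>] by (simp add: eq_neg_iff_add_eq_0 add.commute)

lemma F1_diff: "\<xi> \<in> F1 \<Longrightarrow> X \<in> VF \<Longrightarrow> Y \<in> VF \<Longrightarrow> \<xi> (X - Y) = \<xi> X - \<xi> Y"
  using F1_add[of \<xi> X "- Y"] F1_uminus[of \<xi> Y] by simp

lemma F1_sum: "\<xi> \<in> F1 \<Longrightarrow> (\<And>i. i \<in> I \<Longrightarrow> f i \<in> VF) \<Longrightarrow> \<xi> (sum f I) = (\<Sum>i\<in>I. \<xi> (f i))"
proof (induction I rule: infinite_finite_induct)
  case (insert i I)
  then show ?case using F1_add[OF insert.prems(1), of "f i" "sum f I"] by simp
qed (use F1_0[of \<xi>] in auto)

lemma zero_F1 [simp]: "0 \<in> F1"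
  by (simp add: one_forms_def)

lemma add_F1 [simp]: "\<xi> \<in> F1 \<Longrightarrow> \<eta> \<in> F1 \<Longrightarrow> \<xi> + \<eta> \<in> F1"
  by (simp add: one_forms_def algebra_simps)

lemma fscale_F1 [simp]: "f \<in> K \<Longrightarrow> \<xi> \<in> F1 \<Longrightarrow> fscale f \<xi> \<in> F1"
  by (simp add: one_forms_def algebra_simps fscale_apply)

lemma uminus_F1 [simp]: "\<xi> \<in> F1 \<Longrightarrow> - \<xi> \<in> F1"
  by (simp add: one_forms_def algebra_simps)

lemma diff_F1 [simp]: "\<xi> \<in> F1 \<Longrightarrow> \<eta> \<in> F1 \<Longrightarrow> \<xi> - \<eta> \<in> F1"
  using add_F1[of \<xi> "- \<eta>"] by simp

end

section \<open>Left-invariant frames\<close>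

lemma nat_1_3: "{1..3::nat} = {1, 2, 3}" "{Suc 0..3} = {1, 2, 3}"
  by auto

locale lie_frame = manifold G for G :: "'g::{t2_space,second_countable_topology} lie_structure" +
  fixes v :: "nat \<Rightarrow> 'g field"
  assumes group_G: "group G" and carrier_G: "carrier G = UNIV"
    and v_basis: "module_basis UNIV rscale (lie_algebra G) {1..3} v"
begin

lemma v_lie_algebra: "a \<in> {1..3} \<Longrightarrow> v a \<in> lie_algebra G"
  using v_basis unfolding module_basis_def by blast

lemma v_VF [simp]: "a \<in> {1..3} \<Longrightarrow> v a \<in> VF"
  using v_lie_algebra by (simp add: lie_algebra_def)

lemma v_independent:
  assumes "(\<Sum>a\<in>{1..3}. rscale (c a) (v a)) = 0" "b \<in> {1..3}"
  shows "c b = 0"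
proof -
  let ?P = "\<lambda>c. (\<forall>i\<in>{1..3}. c i \<in> UNIV) \<and> (\<forall>i. i \<notin> {1..3} \<longrightarrow> c i = 0) \<and>
      0 = (\<Sum>i\<in>{1..3}. rscale (c i) (v i))"
  let ?c = "\<lambda>i. if i \<in> {1..3} then c i else 0"
  have "0 \<in> lie_algebra G" by (simp add: lie_algebra_def push_field_def fun_eq_iff)
  then have "\<exists>!c. ?P c"
    using v_basis unfolding module_basis_def by blast
  then obtain d where d: "\<And>c. ?P c \<Longrightarrow> c = d" by auto
  have "?c = d"
    using assms(1) by (intro d) (simp add: nat_1_3)
  moreover have "(\<lambda>_. 0) = d"
    by (intro d) (simp add: fun_eq_iff fscale_def nat_1_3)
  ultimately have "?c = (\<lambda>_. 0)" by simp
  then show ?thesis using assms(2) by (metis (full_types))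
qed

text \<open>A left translation carries the value of the field at \<open>p\<close> to any other point: \<open>Z f (x)\<close> is the
  derivative at \<open>p\<close> of a translate of \<open>f\<close>. If that translate is not smooth, the derivative is zero by
  the convention on vector fields.\<close>

lemma left_invariant_zero:
  assumes "Z \<in> lie_algebra G" "\<And>f. f \<in> K \<Longrightarrow> Z f p = 0"
  shows "Z = 0"
proof (intro ext)
  fix f x
  interpret group G by (rule group_G)
  define b where "b = x \<otimes>\<^bsub>G\<^esub> inv\<^bsub>G\<^esub> p"
  have c: "y \<in> carrier G" for y by (simp add: carrier_G)
  have "inv\<^bsub>G\<^esub> b \<otimes>\<^bsub>G\<^esub> x = p"
    unfolding b_def by (simp add: inv_mult_group m_assoc c)
  moreover have "Z f = push_field G b Z f" using assms(1) by (simp add: lie_algebra_def)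
  ultimately have "Z f x = Z (f \<circ> ltrans G b) p"
    by (simp add: push_field_def ltrans_def)
  also have "\<dots> = 0"
    using assms vf_outside[of Z "f \<circ> ltrans G b"] by (cases "f \<circ> ltrans G b \<in> K") (auto simp: lie_algebra_def)
  finally show "Z f x = 0 f x" by simp
qed

text \<open>A combination with constant coefficients is left-invariant, so it vanishes as a field if it
  vanishes at a point.\<close>

lemma v_independent_at:
  assumes "\<And>f. f \<in> K \<Longrightarrow> (\<Sum>a\<in>{1..3}. c a * v a f p) = 0" "b \<in> {1..3}"
  shows "c b = 0"
proof (rule v_independent[OF left_invariant_zero[of _ p] assms(2)])
  show "(\<Sum>a\<in>{1..3}. rscale (c a) (v a)) \<in> lie_algebra G"
  proof -
    have "push_field G b (\<Sum>a\<in>{1..3}. rscale (c a) (v a)) = (\<Sum>a\<in>{1..3}. rscale (c a) (v a))" for b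
    proof -
      have "push_field G b (v a) f x = v a f x" if "a \<in> {1..3}" for a f x
        using v_lie_algebra[OF that] by (simp add: lie_algebra_def)
      then show ?thesis
        by (simp add: push_field_def fun_eq_iff fscale_def nat_1_3)
    qed
    then show ?thesis by (auto simp: lie_algebra_def intro!: VF_sum VF_fscale)
  qed
qed (use assms(1) in \<open>simp add: nat_1_3 fscale_def\<close>)

text \<open>In a chart the coefficients of a vector field with respect to the frame are given by
  Cramer's rule, hence are smooth.\<close>

lemma frame_coeffs_exist:
  assumes X: "X \<in> VF"
  obtains c where "\<And>a. c a \<in> K" "X = (\<Sum>a\<in>{1..3}. fscale (c a) (v a))"
proof -
  \<comment> \<open>\<open>n\<close> identifies the index type of \<open>\<real>\<^sup>3\<close> with the indices of the frame.\<close>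
  define n :: "3 \<Rightarrow> nat" where "n = (\<lambda>i. if i = 1 then 1 else if i = 2 then 2 else 3)"
  have n: "n i \<in> {1..3}" for i by (auto simp: n_def)
  have sum_n: "(\<Sum>i\<in>UNIV. h (n i)) = (\<Sum>a\<in>{1..3}. h a)" for h :: "nat \<Rightarrow> real"
    by (simp add: n_def sum_3 nat_1_3)
  have zero: "y = 0" if assm: "\<And>f. f \<in> K \<Longrightarrow> (\<Sum>i\<in>UNIV. y $ i * v (n i) f p) = 0" for p y
  proof -
    define c where "c a = y $ (if a = 1 then 1 else if a = 2 then 2 else (3::3))" for a :: nat
    have "(\<Sum>a\<in>{1..3}. c a * v a f p) = 0" if "f \<in> K" for f
      using assm[OF that] by (simp add: c_def n_def sum_3 nat_1_3)
    then have "c a = 0" if "a \<in> {1..3}" for a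
      using v_independent_at that by blast
    from this[of 1] this[of 2] this[of 3] show ?thesis
      by (simp add: c_def vec_eq_iff forall_3)
  qed
  have unique: "y = y'"
    if "\<And>f. f \<in> K \<Longrightarrow> X f p = (\<Sum>i\<in>UNIV. y $ i * v (n i) f p)"
      "\<And>f. f \<in> K \<Longrightarrow> X f p = (\<Sum>i\<in>UNIV. y' $ i * v (n i) f p)" for p y y'
    using zero[of "y - y'" p] that by (simp add: left_diff_distrib sum_subtractf)
  \<comment> \<open>In a chart, \<open>M\<close> is the matrix whose columns are the coefficients of the frame.\<close>
  have local: "\<exists>w. (\<forall>p\<in>U. \<forall>f\<in>K. X f p = (\<Sum>i\<in>UNIV. w p $ i * v (n i) f p)) \<and>
      (\<forall>i. smooth_on (\<lambda>x. w (inv_into U \<phi> x) $ i) (\<phi> ` U))" if c: "(U, \<phi>) \<in> charts G" for U \<phi>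
  proof -
    have "\<exists>A. \<forall>i. smooth_on (A i) (\<phi> ` U) \<and> (\<forall>f\<in>K. \<forall>p\<in>U. v (n i) f p
        = frechet_derivative (f \<circ> inv_into U \<phi>) (at (\<phi> p)) (A i (\<phi> p)))"
      by (rule choice) (metis vf_coeff[OF v_VF[OF n] c])
    then obtain A where A: "\<And>i. smooth_on (A i) (\<phi> ` U)"
      "\<And>i f p. f \<in> K \<Longrightarrow> p \<in> U \<Longrightarrow> v (n i) f p
        = frechet_derivative (f \<circ> inv_into U \<phi>) (at (\<phi> p)) (A i (\<phi> p))" by auto
    obtain b where b: "smooth_on b (\<phi> ` U)" "\<And>f p. f \<in> K \<Longrightarrow> p \<in> U \<Longrightarrow> X f p
        = frechet_derivative (f \<circ> inv_into U \<phi>) (at (\<phi> p)) (b (\<phi> p))"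
      using vf_coeff[OF X c] by metis
    define M :: "real ^ 3 \<Rightarrow> real ^ 3 ^ 3" where "M x = (\<chi> i j. A j x $ i)" for x
    have M_mult: "M x *v y = (\<Sum>j\<in>UNIV. y $ j *\<^sub>R A j x)" for x y
      by (simp add: M_def matrix_vector_mult_def vec_eq_iff mult.commute)
    have lin: "(\<Sum>j\<in>UNIV. y $ j * v (n j) f p)
        = frechet_derivative (f \<circ> inv_into U \<phi>) (at (\<phi> p)) (M (\<phi> p) *v y)"
      if "f \<in> K" "p \<in> U" for f p y
      using that
      by (simp add: M_mult A(2) linear_sum[OF linear_frechet_derivative[OF K_differentiable[OF c]]]
          linear_scale[OF linear_frechet_derivative[OF K_differentiable[OF c]]])
    have det: "det (M (\<phi> p)) \<noteq> 0" if "p \<in> U" for p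
    proof -
      have "y = 0" if "M (\<phi> p) *v y = 0" for y
      proof -
        have "(\<Sum>j\<in>UNIV. y $ j * v (n j) f p) = 0" if "f \<in> K" for f
          using lin[OF that \<open>p \<in> U\<close>, of y] \<open>M (\<phi> p) *v y = 0\<close>
          by (simp add: linear_0[OF linear_frechet_derivative[OF K_differentiable[OF c \<open>p \<in> U\<close> that]]])
        then show ?thesis by (rule zero)
      qed
      then have "invertible (M (\<phi> p))"
        using invertible_left_inverse matrix_left_invertible_ker by blast
      then show ?thesis by (simp add: invertible_det_nz)
    qed
    define y where "y x = (\<chi> k. det (\<chi> i j. if j = k then b x $ i else M x $ i $ j) / det (M x))" for x
    have "M (\<phi> p) *v y (\<phi> p) = b (\<phi> p)" if "p \<in> U" for p
      using cramer[OF det[OF that]] unfolding y_def by blast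
    then have "X f p = (\<Sum>i\<in>UNIV. y (\<phi> p) $ i * v (n i) f p)" if "p \<in> U" "f \<in> K" for f p
      using that by (simp add: lin b(2))
    moreover have "smooth_on (\<lambda>x. y x $ i) (\<phi> ` U)" for i
    proof -
      note op = chart(1)[OF c]
      have MS: "smooth_on (\<lambda>x. M x $ i $ j) (\<phi> ` U)" for i j
        using smooth_on_nth[OF op A(1)] by (simp add: M_def)
      have "smooth_on (\<lambda>x. det (\<chi> i' j. if j = i then b x $ i' else M x $ i' $ j)) (\<phi> ` U)"
        proof (rule smooth_on_det3[OF op])
        show "smooth_on (\<lambda>x. (\<chi> i' j. if j = i then b x $ i' else M x $ i' $ j) $ i' $ j) (\<phi> ` U)" for i' j
          using MS smooth_on_nth[OF op b(1)] by (cases "j = i") auto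
      qed
      from smooth_on_mult[OF op this smooth_on_inverse[OF op smooth_on_det3[OF op MS]]] det
      show ?thesis by (auto simp: y_def divide_inverse)
    qed
    then have "smooth_on (\<lambda>x. y (\<phi> (inv_into U \<phi> x)) $ i) (\<phi> ` U)" for i
      by (rule smooth_on_cong[OF chart(1)[OF c], rotated]) (auto simp: chart(2)[OF c])
    ultimately show ?thesis by (intro exI[of _ "\<lambda>p. y (\<phi> p)"]) auto
  qed
  have "\<exists>y. \<forall>f\<in>K. X f p = (\<Sum>i\<in>UNIV. y $ i * v (n i) f p)" for p
  proof -
    obtain U \<phi> where c: "(U, \<phi>) \<in> charts G" "p \<in> U" by (rule chart_at)
    then show ?thesis using local[OF c(1)] by auto
  qed
  then have "\<exists>Y. \<forall>p. \<forall>f\<in>K. X f p = (\<Sum>i\<in>UNIV. Y p $ i * v (n i) f p)"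
    by (intro choice allI)
  then obtain Y where Y: "\<And>p f. f \<in> K \<Longrightarrow> X f p = (\<Sum>i\<in>UNIV. Y p $ i * v (n i) f p)" by auto
  have YK: "(\<lambda>p. Y p $ i) \<in> K" for i
    unfolding K_iff
  proof clarify
    fix U and \<phi> :: "'g \<Rightarrow> real ^ 3" assume c: "(U, \<phi>) \<in> charts G"
    obtain w where w: "\<And>p f. p \<in> U \<Longrightarrow> f \<in> K \<Longrightarrow> X f p = (\<Sum>i\<in>UNIV. w p $ i * v (n i) f p)"
      "\<And>i. smooth_on (\<lambda>x. w (inv_into U \<phi> x) $ i) (\<phi> ` U)"
      using local[OF c] by auto
    have "w p = Y p" if "p \<in> U" for p
      using w(1)[OF that] Y by (rule unique)
    then show "smooth_on (\<lambda>x. Y (inv_into U \<phi> x) $ i) (\<phi> ` U)"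
      by (intro smooth_on_cong[OF chart(1)[OF c] _ w(2)]) (auto simp: chart(2)[OF c])
  qed
  define c where "c a = (\<lambda>p. Y p $ (if a = 1 then 1 else if a = 2 then 2 else (3::3)))" for a :: nat
  show thesis
  proof
    show "c a \<in> K" for a by (simp add: c_def YK)
    show "X = (\<Sum>a\<in>{1..3}. fscale (c a) (v a))"
    proof (intro ext)
      fix f p
      show "X f p = (\<Sum>a\<in>{1..3}. fscale (c a) (v a)) f p"
      proof (cases "f \<in> K")
        case True
        then show ?thesis by (simp add: Y c_def n_def sum_3 nat_1_3 fscale_def)
      next
        case False
        then show ?thesis using X by (simp add: vf_outside[OF X] vf_outside[OF v_VF] nat_1_3 fscale_def)
      qed
    qed
  qed
qed

text \<open>By the Leibniz rule the bracket of two fields is a combination of the frame fields and of their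
  brackets.\<close>

lemma lie_bracket_VF:
  assumes "\<And>a b. a \<in> {1..3} \<Longrightarrow> b \<in> {1..3} \<Longrightarrow> lie_bracket (v a) (v b) \<in> VF"
    and "X \<in> VF" "Y \<in> VF"
  shows "lie_bracket X Y \<in> VF"
proof -
  obtain c where c: "\<And>a. c a \<in> K" "X = (\<Sum>a\<in>{1..3}. fscale (c a) (v a))"
    by (rule frame_coeffs_exist[OF assms(2)]) auto
  obtain d where d: "\<And>a. d a \<in> K" "Y = (\<Sum>a\<in>{1..3}. fscale (d a) (v a))"
    by (rule frame_coeffs_exist[OF assms(3)]) auto
  have 1: "lie_bracket (v a) Y \<in> VF" if "a \<in> {1..3}" for a
    using assms(1)[OF that] that
    by (simp add: d nat_1_3 lie_bracket_add_right lie_bracket_fscale_right vf_K)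
  show ?thesis
    unfolding c(2) using 1 assms(3)
    by (simp add: c(1) nat_1_3 lie_bracket_add_left lie_bracket_fscale_left vf_K)
qed

lemma F1_eqI:
  assumes "\<xi> \<in> F1" "\<eta> \<in> F1" "\<And>a. a \<in> {1..3} \<Longrightarrow> \<xi> (v a) = \<eta> (v a)"
  shows "\<xi> = \<eta>"
proof
  fix X
  show "\<xi> X = \<eta> X"
  proof (cases "X \<in> VF")
    case True
    obtain c where c: "\<And>a. c a \<in> K" "X = (\<Sum>a\<in>{1..3}. fscale (c a) (v a))"
      by (rule frame_coeffs_exist[OF True]) auto
    show ?thesis unfolding c(2)
      by (simp add: nat_1_3 F1_add[OF assms(1)] F1_add[OF assms(2)] F1_fscale[OF assms(1)]
        F1_fscale[OF assms(2)] c(1) assms(3))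
  qed (simp add: F1_outside[OF assms(1)] F1_outside[OF assms(2)])
qed

end

section \<open>Traces on free modules\<close>

lemma module_basis_unique:
  assumes "module_basis K sm M I b" "(\<Sum>i\<in>I. sm (x i) (b i)) \<in> M"
    and "\<And>i. i \<in> I \<Longrightarrow> x i \<in> K" "\<And>i. i \<in> I \<Longrightarrow> y i \<in> K"
    and "(\<Sum>i\<in>I. sm (x i) (b i)) = (\<Sum>i\<in>I. sm (y i) (b i))" "i \<in> I"
  shows "x i = y i"
proof -
  let ?s = "\<Sum>i\<in>I. sm (x i) (b i)"
  let ?P = "\<lambda>c. (\<forall>i\<in>I. c i \<in> K) \<and> (\<forall>i. i \<notin> I \<longrightarrow> c i = 0) \<and> ?s = (\<Sum>i\<in>I. sm (c i) (b i))"
  let ?x = "\<lambda>i. if i \<in> I then x i else 0" and ?y = "\<lambda>i. if i \<in> I then y i else 0"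
  have "\<exists>!c. ?P c"
    using assms(1,2) unfolding module_basis_def by blast
  then obtain d where "\<forall>c. ?P c \<longrightarrow> c = d"
    unfolding Ex1_def by (elim exE conjE) (rule that)
  then have d: "c = d" if "?P c" for c using that by blast
  have x: "?x = d" using assms(3) by (intro d) (auto intro!: sum.cong)
  have y: "?y = d" using assms(4,5) by (intro d) (auto intro!: sum.cong)
  have "?x i = ?y i" by (rule fun_cong[OF trans[OF x y[symmetric]]])
  then show ?thesis using assms(6) by simp
qed

text \<open>The description of the trace does not specify the basis. Two bases have transition matrices
  \<open>P\<close> and \<open>Q\<close> inverse to each other, possibly between index sets of different size, and
  \<open>P c' = c P\<close> implies \<open>tr c = tr (c P Q) = tr (P c' Q) = tr (c' Q P) = tr c'\<close>.\<close>

lemma module_trace_eq: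
  fixes K :: "'r::comm_ring_1 set" and sm :: "'r \<Rightarrow> 'm \<Rightarrow> 'm::ab_group_add"
  assumes K: "0 \<in> K" "1 \<in> K" "\<And>x y. x \<in> K \<Longrightarrow> y \<in> K \<Longrightarrow> x + y \<in> K"
      "\<And>x y. x \<in> K \<Longrightarrow> y \<in> K \<Longrightarrow> x * y \<in> K"
    and sm: "\<And>x y m. sm (x + y) m = sm x m + sm y m" "\<And>x y m. sm (x * y) m = sm x (sm y m)"
      "\<And>x m m'. sm x (m + m') = sm x m + sm x m'" "\<And>m. sm 1 m = m"
    and M: "0 \<in> M" "\<And>m m'. m \<in> M \<Longrightarrow> m' \<in> M \<Longrightarrow> m + m' \<in> M" "\<And>x m. x \<in> K \<Longrightarrow> m \<in> M \<Longrightarrow> sm x m \<in> M"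
    and A: "\<And>m m'. m \<in> M \<Longrightarrow> m' \<in> M \<Longrightarrow> A (m + m') = A m + A m'"
      "\<And>x m. x \<in> K \<Longrightarrow> m \<in> M \<Longrightarrow> A (sm x m) = sm x (A m)"
    and b: "module_basis K sm M I b"
    and c: "\<And>i j. i \<in> I \<Longrightarrow> j \<in> I \<Longrightarrow> c i j \<in> K"
      "\<And>j. j \<in> I \<Longrightarrow> A (b j) = (\<Sum>i\<in>I. sm (c i j) (b i))"
  shows "module_trace K sm M A = (\<Sum>i\<in>I. c i i)"
  unfolding module_trace_def
proof (rule the_equality)
  show "\<exists>I' b' c'. module_basis K sm M I' b' \<and>
     (\<forall>j\<in>I'. (\<forall>i\<in>I'. c' i j \<in> K) \<and> A (b' j) = (\<Sum>i\<in>I'. sm (c' i j) (b' i))) \<and>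
     (\<Sum>i\<in>I. c i i) = (\<Sum>i\<in>I'. c' i i)"
    using b c by (intro exI[of _ I] exI[of _ b] exI[of _ c]) auto
next
  fix t
  assume "\<exists>I' b' c'. module_basis K sm M I' b' \<and>
     (\<forall>j\<in>I'. (\<forall>i\<in>I'. c' i j \<in> K) \<and> A (b' j) = (\<Sum>i\<in>I'. sm (c' i j) (b' i))) \<and>
     t = (\<Sum>i\<in>I'. c' i i)"
  then obtain I' b' c' where *: "module_basis K sm M I' b' \<and>
     (\<forall>j\<in>I'. (\<forall>i\<in>I'. c' i j \<in> K) \<and> A (b' j) = (\<Sum>i\<in>I'. sm (c' i j) (b' i))) \<and>
     t = (\<Sum>i\<in>I'. c' i i)"
    by (elim exE) (rule that)
  then have b': "module_basis K sm M I' b'" and t: "t = (\<Sum>i\<in>I'. c' i i)" by blast+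
  have c': "i \<in> I' \<Longrightarrow> j \<in> I' \<Longrightarrow> c' i j \<in> K"
    "j \<in> I' \<Longrightarrow> A (b' j) = (\<Sum>i\<in>I'. sm (c' i j) (b' i))" for i j
    using * by blast+
  have fin: "finite I" "finite I'" and in_M: "\<And>i. i \<in> I \<Longrightarrow> b i \<in> M" "\<And>i. i \<in> I' \<Longrightarrow> b' i \<in> M"
    using b b' unfolding module_basis_def by auto
  have sm0: "sm x 0 = 0" for x using sm(3)[of x 0 0] by simp
  have sm0': "sm 0 m = 0" for m using sm(1)[of 0 0 m] by simp
  have sm_sum: "sm x (sum f J) = (\<Sum>i\<in>J. sm x (f i))" for x J and f :: "nat \<Rightarrow> 'm"
    by (induction J rule: infinite_finite_induct) (auto simp: sm0 sm(3))
  have sum_sm: "sm (sum f J) m = (\<Sum>i\<in>J. sm (f i) m)" for m J and f :: "nat \<Rightarrow> 'r"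
    by (induction J rule: infinite_finite_induct) (auto simp: sm0' sm(1))
  have K_sum: "sum f J \<in> K" if "\<And>i. i \<in> J \<Longrightarrow> f i \<in> K" for J and f :: "nat \<Rightarrow> 'r"
    using that by (induction J rule: infinite_finite_induct) (auto simp: K)
  have M_sum: "sum f J \<in> M" if "\<And>i. i \<in> J \<Longrightarrow> f i \<in> M" for J and f :: "nat \<Rightarrow> 'm"
    using that by (induction J rule: infinite_finite_induct) (auto simp: M)
  have A0: "A 0 = 0" using A(1)[OF M(1,1)] by simp
  have A_sum: "A (sum f J) = (\<Sum>i\<in>J. A (f i))" if "\<And>i. i \<in> J \<Longrightarrow> f i \<in> M" for J and f :: "nat \<Rightarrow> 'm"
    using that by (induction J rule: infinite_finite_induct) (auto simp: A0 A M_sum)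
  have coords: "\<exists>P. (\<forall>j\<in>J'. (\<forall>i\<in>J. P i j \<in> K) \<and> d' j = (\<Sum>i\<in>J. sm (P i j) (d i)))"
    if "module_basis K sm M J d" "\<And>j. j \<in> J' \<Longrightarrow> d' j \<in> M" for J J' d and d' :: "nat \<Rightarrow> 'm"
  proof -
    have "\<exists>p. (\<forall>i\<in>J. p i \<in> K) \<and> d' j = (\<Sum>i\<in>J. sm (p i) (d i))" if "j \<in> J'" for j
      using that \<open>module_basis K sm M J d\<close> \<open>\<And>j. j \<in> J' \<Longrightarrow> d' j \<in> M\<close> unfolding module_basis_def by blast
    then have "\<exists>p. \<forall>j\<in>J'. (\<forall>i\<in>J. p j i \<in> K) \<and> d' j = (\<Sum>i\<in>J. sm (p j i) (d i))"
      by (intro bchoice ballI)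
    then obtain p where "\<forall>j\<in>J'. (\<forall>i\<in>J. p j i \<in> K) \<and> d' j = (\<Sum>i\<in>J. sm (p j i) (d i))" ..
    then show ?thesis by (intro exI[of _ "\<lambda>i j. p j i"])
  qed
  obtain P where P: "\<And>i j. i \<in> I \<Longrightarrow> j \<in> I' \<Longrightarrow> P i j \<in> K"
    "\<And>j. j \<in> I' \<Longrightarrow> b' j = (\<Sum>i\<in>I. sm (P i j) (b i))"
    using coords[OF b, of I' b'] in_M(2) by auto
  obtain Q where Q: "\<And>i j. i \<in> I' \<Longrightarrow> j \<in> I \<Longrightarrow> Q i j \<in> K"
    "\<And>j. j \<in> I \<Longrightarrow> b j = (\<Sum>i\<in>I'. sm (Q i j) (b' i))"
    using coords[OF b', of I b] in_M(1) by auto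
  have double: "(\<Sum>k\<in>J'. sm (x k) (\<Sum>i\<in>J. sm (y i k) (d i))) = (\<Sum>i\<in>J. sm (\<Sum>k\<in>J'. x k * y i k) (d i))"
    for J J' y and x :: "nat \<Rightarrow> 'r" and d :: "nat \<Rightarrow> 'm"
  proof -
    have "(\<Sum>k\<in>J'. sm (x k) (\<Sum>i\<in>J. sm (y i k) (d i))) = (\<Sum>k\<in>J'. \<Sum>i\<in>J. sm (x k * y i k) (d i))"
      by (simp add: sm_sum sm(2))
    also have "\<dots> = (\<Sum>i\<in>J. \<Sum>k\<in>J'. sm (x k * y i k) (d i))" by (rule sum.swap)
    finally show ?thesis by (simp only: sum_sm)
  qed
  have cP: "(\<Sum>k\<in>I'. c' k j * P i k) = (\<Sum>k\<in>I. P k j * c i k)" if "i \<in> I" "j \<in> I'" for i j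
  proof (rule module_basis_unique[OF b, of "\<lambda>i. \<Sum>k\<in>I'. c' k j * P i k" "\<lambda>i. \<Sum>k\<in>I. P k j * c i k"])
    have "A (b' j) = (\<Sum>k\<in>I'. sm (c' k j) (\<Sum>i\<in>I. sm (P i k) (b i)))"
      using c'(2)[OF that(2)] P(2) by simp
    moreover have "A (b' j) = (\<Sum>k\<in>I. sm (P k j) (\<Sum>i\<in>I. sm (c i k) (b i)))"
      using that by (simp add: P(2) A_sum M in_M P(1) A(2) c(2))
    ultimately show "(\<Sum>i\<in>I. sm (\<Sum>k\<in>I'. c' k j * P i k) (b i)) = (\<Sum>i\<in>I. sm (\<Sum>k\<in>I. P k j * c i k) (b i))"
      by (simp add: double)
    show "(\<Sum>i\<in>I. sm (\<Sum>k\<in>I'. c' k j * P i k) (b i)) \<in> M"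
      using that by (intro M_sum M K_sum K c' P in_M)
  qed (use that in \<open>auto intro!: K_sum K c c' P\<close>)
  have QP: "(\<Sum>l\<in>I. P l j * Q k l) = (if k = j then 1 else 0)" if "k \<in> I'" "j \<in> I'" for k j
  proof (rule module_basis_unique[OF b', of "\<lambda>k. \<Sum>l\<in>I. P l j * Q k l" "\<lambda>k. if k = j then 1 else 0"])
    have "(\<Sum>k\<in>I'. sm (\<Sum>l\<in>I. P l j * Q k l) (b' k)) = (\<Sum>l\<in>I. sm (P l j) (b l))"
      by (simp add: double[symmetric] Q(2)[symmetric])
    then show "(\<Sum>k\<in>I'. sm (\<Sum>l\<in>I. P l j * Q k l) (b' k)) = (\<Sum>k\<in>I'. sm (if k = j then 1 else 0) (b' k))"
      using that fin by (simp add: P(2)[symmetric] if_distrib[of "\<lambda>x. sm x _"] sm sm0' cong: if_cong)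
    show "(\<Sum>k\<in>I'. sm (\<Sum>l\<in>I. P l j * Q k l) (b' k)) \<in> M"
      using that by (intro M_sum M K_sum K P Q in_M)
  qed (use that in \<open>auto intro!: K_sum K P Q\<close>)
  have PQ: "(\<Sum>j\<in>I'. Q j i * P l j) = (if l = i then 1 else 0)" if "l \<in> I" "i \<in> I" for l i
  proof (rule module_basis_unique[OF b, of "\<lambda>l. \<Sum>j\<in>I'. Q j i * P l j" "\<lambda>l. if l = i then 1 else 0"])
    have "(\<Sum>l\<in>I. sm (\<Sum>j\<in>I'. Q j i * P l j) (b l)) = (\<Sum>j\<in>I'. sm (Q j i) (b' j))"
      by (simp add: double[symmetric] P(2)[symmetric])
    then show "(\<Sum>l\<in>I. sm (\<Sum>j\<in>I'. Q j i * P l j) (b l)) = (\<Sum>k\<in>I. sm (if k = i then 1 else 0) (b k))"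
      using that fin by (simp add: Q(2)[symmetric] if_distrib[of "\<lambda>x. sm x _"] sm sm0' cong: if_cong)
    show "(\<Sum>l\<in>I. sm (\<Sum>j\<in>I'. Q j i * P l j) (b l)) \<in> M"
      using that by (intro M_sum M K_sum K P Q in_M)
  qed (use that in \<open>auto intro!: K_sum K P Q\<close>)
  have "(\<Sum>i\<in>I. c i i) = (\<Sum>i\<in>I. \<Sum>l\<in>I. c i l * (if l = i then 1 else 0))"
    using fin by (simp add: if_distrib[of "(*) _"] cong: if_cong)
  also have "\<dots> = (\<Sum>i\<in>I. \<Sum>l\<in>I. c i l * (\<Sum>j\<in>I'. Q j i * P l j))"
    by (intro sum.cong refl) (simp add: PQ)
  also have "\<dots> = (\<Sum>i\<in>I. \<Sum>l\<in>I. \<Sum>j\<in>I'. c i l * (Q j i * P l j))"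
    by (simp add: sum_distrib_left)
  also have "\<dots> = (\<Sum>i\<in>I. \<Sum>j\<in>I'. \<Sum>l\<in>I. c i l * (Q j i * P l j))"
    by (intro sum.cong refl sum.swap)
  also have "\<dots> = (\<Sum>i\<in>I. \<Sum>j\<in>I'. Q j i * (\<Sum>l\<in>I. P l j * c i l))"
    by (simp add: sum_distrib_left mult_ac)
  also have "\<dots> = (\<Sum>i\<in>I. \<Sum>j\<in>I'. Q j i * (\<Sum>k\<in>I'. c' k j * P i k))"
    by (simp add: cP)
  also have "\<dots> = (\<Sum>j\<in>I'. \<Sum>i\<in>I. \<Sum>k\<in>I'. c' k j * (P i k * Q j i))"
    by (simp add: sum_distrib_left mult_ac) (rule sum.swap)
  also have "\<dots> = (\<Sum>j\<in>I'. \<Sum>k\<in>I'. \<Sum>i\<in>I. c' k j * (P i k * Q j i))"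
    by (intro sum.cong refl sum.swap)
  also have "\<dots> = (\<Sum>j\<in>I'. \<Sum>k\<in>I'. c' k j * (if j = k then 1 else 0))"
    by (simp add: sum_distrib_left[symmetric] QP)
  also have "\<dots> = t"
    using fin by (simp add: t if_distrib[of "(*) _"] cong: if_cong)
  finally show "t = (\<Sum>i\<in>I. c i i)" by simp
qed


section \<open>Sections of the Courant algebroid\<close>

lemma sscale_add_left: "sscale (f + f') u = sscale f u + sscale f' u"
  by (cases u) (simp add: fscale_add_left algebra_simps)

lemma sscale_diff_left: "sscale (f - f') u = sscale f u - sscale f' u"
  by (cases u) (simp add: fscale_diff_left algebra_simps)

lemma sscale_simps [simp]:
  "sscale f (u + w) = sscale f u + sscale f w"
  "sscale f (u - w) = sscale f u - sscale f w"
  "sscale f 0 = 0" "sscale 0 u = 0" "sscale 1 u = u"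
  "sscale (- f) u = - sscale f u"
  "sscale f (sscale f' u) = sscale (f * f') u"
  by (cases u; cases w; simp add: algebra_simps zero_prod_def)+

lemma fst_sscale [simp]: "fst (sscale f u) = fscale f (fst u)"
  by (cases u) simp

lemma pairing_commute: "pairing u w = pairing w u"
  by (cases u; cases w) (simp add: algebra_simps)

text \<open>The components of the frame fields: \<open>idx A\<close> is the index of the vector part of \<open>e\<^sub>A\<close>,
  \<open>sg A\<close> the sign of its covector part. The index \<open>0\<close> stands for the vector field \<open>0\<close>, so that
  \<open>e\<^sub>0\<close> needs no separate treatment.\<close>

definition idx :: "nat \<Rightarrow> nat" where "idx A = (if A \<le> 3 then A else A - 3)"
definition sg :: "nat \<Rightarrow> real" where "sg A = (if A \<le> 3 then 1 else -1)"
definition unit0 :: "nat \<Rightarrow> real" where "unit0 A = (if A = 0 then 1 else 0)"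

definition levi3 :: "nat \<Rightarrow> nat \<Rightarrow> nat \<Rightarrow> real" where
  "levi3 a b c = (if (a, b, c) \<in> {(1, 2, 3), (2, 3, 1), (3, 1, 2)} then 1
     else if (a, b, c) \<in> {(2, 1, 3), (1, 3, 2), (3, 2, 1)} then -1 else 0)"

locale courant_frame = lie_frame G v
  for G :: "'g::{t2_space,second_countable_topology} lie_structure" and v :: "nat \<Rightarrow> 'g field" +
  fixes g F :: "'g form2" and H :: "'g form3"
    and \<epsilon> :: "nat \<Rightarrow> real" and lam \<mu> \<nu> \<rho> h :: real and Fc :: "nat \<Rightarrow> nat \<Rightarrow> real"
  assumes g_tensor: "g \<in> tensors2 G"
    and g_sym: "\<And>X Y. X \<in> VF \<Longrightarrow> Y \<in> VF \<Longrightarrow> g X Y = g Y X"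
    and g_v: "\<And>a b. a \<in> {1..3} \<Longrightarrow> b \<in> {1..3} \<Longrightarrow> g (v a) (v b) = cst (if a = b then \<epsilon> a else 0)"
    and eps: "\<And>a. a \<in> {1..3} \<Longrightarrow> \<epsilon> a \<in> {-1, 1}"
    and br_13: "lie_bracket (v 1) (v 3) = 0"
    and br_21: "lie_bracket (v 2) (v 1) = rscale (\<epsilon> 1 * lam) (v 1) + rscale (\<epsilon> 3 * \<mu>) (v 3)"
    and br_23: "lie_bracket (v 2) (v 3) = rscale (\<epsilon> 1 * \<nu>) (v 1) + rscale (\<epsilon> 3 * \<rho>) (v 3)"
    and H_form: "H \<in> three_forms G" and H_v: "H (v 1) (v 2) (v 3) = cst h"
    and F_form: "F \<in> two_forms G"
    and F_v: "\<And>a b. a \<in> {1..3} \<Longrightarrow> b \<in> {1..3} \<Longrightarrow> F (v a) (v b) = cst (Fc a b)"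
begin

abbreviation S :: "'g sect set" where "S \<equiv> sections G"
abbreviation e :: "nat \<Rightarrow> 'g sect" where "e \<equiv> e_basis g v"
abbreviation dorf :: "'g sect \<Rightarrow> 'g sect \<Rightarrow> 'g sect" where "dorf \<equiv> dorfman G H F"

definition w :: "nat \<Rightarrow> 'g field" where "w a = (if a = 0 then 0 else v a)"
definition eta :: "nat \<Rightarrow> real" where
  "eta A = (if A = 0 then 1 else if A \<le> 3 then \<epsilon> A else - \<epsilon> (A - 3))"

text \<open>The function \<open>fr a b c\<close> is \<open>g([v\<^sub>a, v\<^sub>b], v\<^sub>c)\<close>, and \<open>Bc A B C\<close> is \<open>\<langle>[e\<^sub>A, e\<^sub>B], e\<^sub>C\<rangle>\<close>.\<close>

definition fr2 :: "nat \<Rightarrow> nat \<Rightarrow> real" where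
  "fr2 b c = (if b = 1 then (if c = 1 then lam else if c = 3 then \<mu> else 0)
     else if b = 3 then (if c = 1 then \<nu> else if c = 3 then \<rho> else 0) else 0)"
definition fr :: "nat \<Rightarrow> nat \<Rightarrow> nat \<Rightarrow> real" where
  "fr a b c = (if a = 2 then fr2 b c else if b = 2 then - fr2 a c else 0)"
definition fc :: "nat \<Rightarrow> nat \<Rightarrow> real" where
  "fc a b = (if a \<in> {1..3} \<and> b \<in> {1..3} then Fc a b else 0)"

definition Bc :: "nat \<Rightarrow> nat \<Rightarrow> nat \<Rightarrow> real" where
  "Bc A B C = (sg A * fr (idx B) (idx C) (idx A) - sg B * fr (idx A) (idx C) (idx B)
      + sg C * fr (idx A) (idx B) (idx C) + h * levi3 (idx B) (idx A) (idx C)) / 2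
    - unit0 B * fc (idx A) (idx C) + unit0 A * fc (idx B) (idx C) + unit0 C * fc (idx A) (idx B)"

lemma g_F1 [simp]: "X \<in> VF \<Longrightarrow> g X \<in> F1"
  and F_F1 [simp]: "X \<in> VF \<Longrightarrow> F X \<in> F1"
  and H_F1 [simp]: "X \<in> VF \<Longrightarrow> Y \<in> VF \<Longrightarrow> H X Y \<in> F1"
  using g_tensor F_form H_form by (auto simp: two_forms_def tensors2_def three_forms_def)

lemma g_F1_left: "Y \<in> VF \<Longrightarrow> (\<lambda>X. g X Y) \<in> F1"
  and F_F1_left: "Y \<in> VF \<Longrightarrow> (\<lambda>X. F X Y) \<in> F1"
  and H_F1_mid: "X \<in> VF \<Longrightarrow> Z \<in> VF \<Longrightarrow> (\<lambda>Y. H X Y Z) \<in> F1"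
  and H_F1_left: "Y \<in> VF \<Longrightarrow> Z \<in> VF \<Longrightarrow> (\<lambda>X. H X Y Z) \<in> F1"
  using g_tensor F_form H_form by (auto simp: two_forms_def tensors2_def three_forms_def)

text \<open>A tensor with two arguments is given as a map into one-forms, and linearity in its first
  argument is known only after evaluation at a vector field; elsewhere one-forms vanish.\<close>

lemma tensor_F1_add:
  assumes "\<And>Y. Y \<in> VF \<Longrightarrow> (\<lambda>X. B X Y) \<in> F1" "\<And>X. X \<in> VF \<Longrightarrow> B X \<in> F1" "X \<in> VF" "X' \<in> VF"
  shows "B (X + X') = B X + B X'"
proof
  fix Y
  show "B (X + X') Y = (B X + B X') Y"
  proof (cases "Y \<in> VF")
    case True
    then show ?thesis using F1_add[OF assms(1)[OF True] assms(3,4)] by simp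
  qed (simp add: F1_outside[OF assms(2)] assms(3,4))
qed

lemma tensor_F1_fscale:
  assumes "\<And>Y. Y \<in> VF \<Longrightarrow> (\<lambda>X. B X Y) \<in> F1" "\<And>X. X \<in> VF \<Longrightarrow> B X \<in> F1" "X \<in> VF" "f \<in> K"
  shows "B (fscale f X) = fscale f (B X)"
proof
  fix Y
  show "B (fscale f X) Y = fscale f (B X) Y"
  proof (cases "Y \<in> VF")
    case True
    then show ?thesis using F1_fscale[OF assms(1)[OF True] assms(3,4)] by (simp add: fscale_apply)
  qed (simp add: F1_outside[OF assms(2)] assms(3,4) fscale_apply)
qed

lemma F_add: "X \<in> VF \<Longrightarrow> X' \<in> VF \<Longrightarrow> F (X + X') = F X + F X'"
  by (rule tensor_F1_add; simp add: F_F1_left)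

lemma g_fscale: "X \<in> VF \<Longrightarrow> f \<in> K \<Longrightarrow> g (fscale f X) = fscale f (g X)"
  and F_fscale: "X \<in> VF \<Longrightarrow> f \<in> K \<Longrightarrow> F (fscale f X) = fscale f (F X)"
  by (rule tensor_F1_fscale; simp add: g_F1_left F_F1_left)+

lemma brackets_VF [simp]: "X \<in> VF \<Longrightarrow> Y \<in> VF \<Longrightarrow> lie_bracket X Y \<in> VF"
proof (rule lie_bracket_VF)
  have *: "lie_bracket X Y \<in> VF" if "lie_bracket Y X \<in> VF" for X Y
    unfolding lie_bracket_skew[of X] using that by simp
  have **: "lie_bracket (v 1) (v 3) \<in> VF" "lie_bracket (v 2) (v 1) \<in> VF" "lie_bracket (v 2) (v 3) \<in> VF"
    unfolding br_13 br_21 br_23 by simp_all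
  show "lie_bracket (v a) (v b) \<in> VF" if "a \<in> {1..3}" "b \<in> {1..3}" for a b
    using that ** **[THEN *] unfolding nat_1_3 by (auto simp del: One_nat_def)
qed

subsection \<open>The module of sections\<close>

lemma S_iff: "(X, \<xi>, l) \<in> S \<longleftrightarrow> X \<in> VF \<and> \<xi> \<in> F1 \<and> l \<in> K"
  by (simp add: sections_def)

lemma S_add [simp]: "u \<in> S \<Longrightarrow> u' \<in> S \<Longrightarrow> u + u' \<in> S"
  and S_diff [simp]: "u \<in> S \<Longrightarrow> u' \<in> S \<Longrightarrow> u - u' \<in> S"
  and S_sscale [simp]: "f \<in> K \<Longrightarrow> u \<in> S \<Longrightarrow> sscale f u \<in> S"
  and S_0 [simp]: "0 \<in> S"
  by (cases u; cases u'; simp add: S_iff zero_prod_def)+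

lemma S_sum [simp]: "(\<And>i. i \<in> I \<Longrightarrow> u i \<in> S) \<Longrightarrow> sum u I \<in> S"
  by (induction I rule: infinite_finite_induct) auto

lemma fst_VF [simp]: "u \<in> S \<Longrightarrow> fst u \<in> VF"
  by (cases u) (simp add: S_iff)

lemma fst_K [simp]: "u \<in> S \<Longrightarrow> fst u f \<in> K"
  by (simp add: vf_K)

lemma fst_derivation [simp]:
  assumes "u \<in> S"
  shows "fst u (cst c) = 0" "fst u 0 = 0"
    "f \<in> K \<Longrightarrow> f' \<in> K \<Longrightarrow> fst u (f + f') = fst u f + fst u f'"
    "f \<in> K \<Longrightarrow> f' \<in> K \<Longrightarrow> fst u (f - f') = fst u f - fst u f'"
    "f \<in> K \<Longrightarrow> f' \<in> K \<Longrightarrow> fst u (f * f') = f * fst u f' + fst u f * f'"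
  using vf_cst[OF fst_VF[OF assms]] vf_0[OF fst_VF[OF assms]] vf_add[OF fst_VF[OF assms]]
    vf_diff[OF fst_VF[OF assms]] vf_mult[OF fst_VF[OF assms]] by blast+

lemma fst_sum_K: "u \<in> S \<Longrightarrow> (\<And>i. i \<in> I \<Longrightarrow> f i \<in> K) \<Longrightarrow> fst u (sum f I) = (\<Sum>i\<in>I. fst u (f i))"
  by (simp add: vf_sum)

lemma pairing_K [simp]: "u \<in> S \<Longrightarrow> u' \<in> S \<Longrightarrow> pairing u u' \<in> K"
proof -
  assume *: "u \<in> S" "u' \<in> S"
  obtain X \<xi> l Y \<eta> m where [simp]: "u = (X, \<xi>, l)" "u' = (Y, \<eta>, m)"
    by (cases u; cases u')
  have "\<xi> Y \<in> K" "\<eta> X \<in> K" "l \<in> K" "m \<in> K" using * by (simp_all add: S_iff F1_K)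
  then show ?thesis by simp
qed

lemma pairing_add [simp]:
  assumes "u \<in> S" "u' \<in> S" "x \<in> S"
  shows "pairing (u + u') x = pairing u x + pairing u' x"
    "pairing x (u + u') = pairing x u + pairing x u'"
proof -
  obtain X \<xi> l Y \<eta> m Z \<zeta> n where [simp]: "u = (X, \<xi>, l)" "u' = (Y, \<eta>, m)" "x = (Z, \<zeta>, n)"
    by (cases u; cases u'; cases x)
  have "\<zeta> (X + Y) = \<zeta> X + \<zeta> Y" using assms by (intro F1_add) (auto simp: S_iff)
  then show "pairing (u + u') x = pairing u x + pairing u' x" by (simp add: algebra_simps)
  then show "pairing x (u + u') = pairing x u + pairing x u'" by (simp only: pairing_commute[of x])
qed

lemma pairing_sscale [simp]:
  assumes "u \<in> S" "x \<in> S" "f \<in> K"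
  shows "pairing (sscale f u) x = f * pairing u x" "pairing x (sscale f u) = f * pairing x u"
proof -
  obtain X \<xi> l Z \<zeta> n where [simp]: "u = (X, \<xi>, l)" "x = (Z, \<zeta>, n)"
    by (cases u; cases x)
  have "\<zeta> (fscale f X) = f * \<zeta> X" using assms by (intro F1_fscale) (auto simp: S_iff)
  then show "pairing (sscale f u) x = f * pairing u x" by (simp add: algebra_simps fscale_apply)
  then show "pairing x (sscale f u) = f * pairing x u" by (simp only: pairing_commute[of x])
qed

lemma pairing_0 [simp]: "x \<in> S \<Longrightarrow> pairing 0 x = 0" "x \<in> S \<Longrightarrow> pairing x 0 = 0"
  using pairing_sscale[of 0 x 0] by simp_all

lemma pairing_diff [simp]:
  assumes "u \<in> S" "u' \<in> S" "x \<in> S"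
  shows "pairing (u - u') x = pairing u x - pairing u' x"
    "pairing x (u - u') = pairing x u - pairing x u'"
  using pairing_add[of "u - u'" u' x] assms by simp_all

lemma pairing_sum:
  "(\<And>i. i \<in> I \<Longrightarrow> u i \<in> S) \<Longrightarrow> x \<in> S \<Longrightarrow> pairing (sum u I) x = (\<Sum>i\<in>I. pairing (u i) x)"
  by (induction I rule: infinite_finite_induct) auto

lemma pairing_sum_right:
  "(\<And>i. i \<in> I \<Longrightarrow> u i \<in> S) \<Longrightarrow> x \<in> S \<Longrightarrow> pairing x (sum u I) = (\<Sum>i\<in>I. pairing x (u i))"
  by (simp add: pairing_commute[of x] pairing_sum)

subsection \<open>The Dorfman bracket\<close>

lemma F1_I:
  assumes "\<And>X. X \<notin> VF \<Longrightarrow> \<xi> X = 0" "\<And>X. X \<in> VF \<Longrightarrow> \<xi> X \<in> K"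
    and "\<And>X Y. X \<in> VF \<Longrightarrow> Y \<in> VF \<Longrightarrow> \<xi> (X + Y) = \<xi> X + \<xi> Y"
    and "\<And>f X. f \<in> K \<Longrightarrow> X \<in> VF \<Longrightarrow> \<xi> (fscale f X) = f * \<xi> X"
  shows "\<xi> \<in> F1"
  using assms by (simp add: one_forms_def)

lemma lie_deriv_F1 [simp]:
  assumes "X \<in> VF" "\<eta> \<in> F1"
  shows "lie_deriv G X \<eta> \<in> F1"
proof (rule F1_I)
  fix Y Z assume Y: "Y \<in> VF" and Z: "Z \<in> VF"
  show "lie_deriv G X \<eta> (Y + Z) = lie_deriv G X \<eta> Y + lie_deriv G X \<eta> Z"
    using vf_add[OF assms(1) F1_K[OF assms(2)] F1_K[OF assms(2)], of Y Z]
    by (simp add: lie_deriv_def Y Z assms F1_add[OF assms(2)] lie_bracket_add_right)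
next
  fix f Y assume Y: "Y \<in> VF" and f: "f \<in> K"
  show "lie_deriv G X \<eta> (fscale f Y) = f * lie_deriv G X \<eta> Y"
    using vf_mult[OF assms(1) f F1_K[OF assms(2)], of Y] vf_K[OF assms(1), of f]
    by (simp add: lie_deriv_def Y f assms F1_fscale[OF assms(2)] F1_add[OF assms(2)]
        lie_bracket_fscale_right algebra_simps)
qed (simp_all add: lie_deriv_def F1_K[OF assms(2)] vf_K[OF assms(1)])

lemma ext_deriv1_F1 [simp]:
  assumes "Y \<in> VF" "\<xi> \<in> F1"
  shows "ext_deriv1 G \<xi> Y \<in> F1"
proof (rule F1_I)
  fix X Z assume X: "X \<in> VF" and Z: "Z \<in> VF"
  show "ext_deriv1 G \<xi> Y (X + Z) = ext_deriv1 G \<xi> Y X + ext_deriv1 G \<xi> Y Z"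
    using vf_add[OF assms(1) F1_K[OF assms(2)] F1_K[OF assms(2)], of X Z]
    by (simp add: ext_deriv1_def X Z assms F1_add[OF assms(2)] lie_bracket_add_right)
next
  fix f X assume X: "X \<in> VF" and f: "f \<in> K"
  show "ext_deriv1 G \<xi> Y (fscale f X) = f * ext_deriv1 G \<xi> Y X"
    using vf_mult[OF assms(1) f F1_K[OF assms(2)], of X] vf_K[OF assms(1), of f]
    by (simp add: ext_deriv1_def X f assms F1_fscale[OF assms(2)] F1_add[OF assms(2)]
        lie_bracket_fscale_right fscale_apply algebra_simps)
qed (simp_all add: ext_deriv1_def F1_K[OF assms(2)] vf_K[OF assms(1)] vf_K assms)

lemma ext_deriv0_F1 [simp]: "f \<in> K \<Longrightarrow> ext_deriv0 G f \<in> F1"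
  by (rule F1_I) (simp_all add: ext_deriv0_def vf_K fscale_apply)

lemma dorf_S [simp]:
  assumes "u \<in> S" "u' \<in> S"
  shows "dorf u u' \<in> S"
proof -
  obtain X \<xi> l Y \<eta> m where [simp]: "u = (X, \<xi>, l)" "u' = (Y, \<eta>, m)"
    by (cases u; cases u')
  have "X m \<in> K" "Y l \<in> K" "F X Y \<in> K" using assms by (auto simp: S_iff vf_K F1_K)
  then show ?thesis using assms by (auto simp: S_iff)
qed

lemma fst_dorf [simp]: "fst (dorf u u') = lie_bracket (fst u) (fst u')"
  by (cases u; cases u') simp

end

context courant_frame
begin

lemma ext_deriv0_apply: "Z \<in> VF \<Longrightarrow> ext_deriv0 G f Z = Z f"
  and lie_deriv_apply: "Z \<in> VF \<Longrightarrow> lie_deriv G X \<eta> Z = X (\<eta> Z) - \<eta> (lie_bracket X Z)"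
  and ext_deriv1_apply: "Y \<in> VF \<Longrightarrow> Z \<in> VF \<Longrightarrow>
    ext_deriv1 G \<xi> Y Z = Y (\<xi> Z) - Z (\<xi> Y) - \<xi> (lie_bracket Y Z)"
  by (simp_all add: ext_deriv0_def lie_deriv_def ext_deriv1_def)

lemma F1_ext:
  assumes "\<xi> \<in> F1" "\<eta> \<in> F1" "\<And>Z. Z \<in> VF \<Longrightarrow> \<xi> Z = \<eta> Z"
  shows "\<xi> = \<eta>"
  by (rule F1_eqI[OF assms(1,2)]) (simp add: assms(3))

lemma ext_deriv0_add [simp]:
  assumes "f \<in> K" "f' \<in> K"
  shows "ext_deriv0 G (f + f') = ext_deriv0 G f + ext_deriv0 G f'"
proof (rule F1_ext)
  fix Z assume "Z \<in> VF"
  from this vf_add[OF this assms] show "ext_deriv0 G (f + f') Z = (ext_deriv0 G f + ext_deriv0 G f') Z"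
    by (simp add: ext_deriv0_apply fun_eq_iff)
qed (use assms in simp_all)

lemma ext_deriv0_mult [simp]:
  assumes "f \<in> K" "f' \<in> K"
  shows "ext_deriv0 G (f * f') = fscale f (ext_deriv0 G f') + fscale f' (ext_deriv0 G f)"
proof (rule F1_ext)
  fix Z assume "Z \<in> VF"
  from this vf_mult[OF this assms]
  show "ext_deriv0 G (f * f') Z = (fscale f (ext_deriv0 G f') + fscale f' (ext_deriv0 G f)) Z"
    by (simp add: ext_deriv0_apply fscale_apply fun_eq_iff algebra_simps)
qed (use assms in simp_all)

lemma ext_deriv0_cst [simp]: "ext_deriv0 G (cst c) = 0"
proof (rule F1_ext)
  fix Z assume "Z \<in> VF"
  from this vf_cst[OF this, of c] show "ext_deriv0 G (cst c) Z = 0 Z" by (simp add: ext_deriv0_apply fun_eq_iff)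
qed simp_all

lemma lie_deriv_add:
  assumes "X \<in> VF" "X' \<in> VF" "\<eta> \<in> F1" "\<eta>' \<in> F1"
  shows "lie_deriv G (X + X') \<eta> = lie_deriv G X \<eta> + lie_deriv G X' \<eta>"
    "lie_deriv G X (\<eta> + \<eta>') = lie_deriv G X \<eta> + lie_deriv G X \<eta>'"
proof -
  show "lie_deriv G (X + X') \<eta> = lie_deriv G X \<eta> + lie_deriv G X' \<eta>"
    using assms by (intro F1_ext) (simp_all add: lie_deriv_apply lie_bracket_add_left F1_add[OF assms(3)])
  show "lie_deriv G X (\<eta> + \<eta>') = lie_deriv G X \<eta> + lie_deriv G X \<eta>'"
  proof (rule F1_ext)
    fix Z assume Z: "Z \<in> VF"
    show "lie_deriv G X (\<eta> + \<eta>') Z = (lie_deriv G X \<eta> + lie_deriv G X \<eta>') Z"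
      using vf_add[OF assms(1) F1_K[OF assms(3)] F1_K[OF assms(4)], of Z Z]
      by (simp add: lie_deriv_apply Z)
  qed (use assms in simp_all)
qed

lemma lie_deriv_fscale:
  assumes "X \<in> VF" "\<eta> \<in> F1" "f \<in> K"
  shows "lie_deriv G (fscale f X) \<eta> = fscale f (lie_deriv G X \<eta>) + fscale (\<eta> X) (ext_deriv0 G f)"
    "lie_deriv G X (fscale f \<eta>) = fscale f (lie_deriv G X \<eta>) + fscale (X f) \<eta>"
proof -
  show "lie_deriv G (fscale f X) \<eta> = fscale f (lie_deriv G X \<eta>) + fscale (\<eta> X) (ext_deriv0 G f)"
  proof (rule F1_ext)
    fix Z assume Z: "Z \<in> VF"
    have "Z f \<in> K" using Z by (rule vf_K)
    then show "lie_deriv G (fscale f X) \<eta> Z = (fscale f (lie_deriv G X \<eta>) + fscale (\<eta> X) (ext_deriv0 G f)) Z"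
      using assms Z by (simp add: lie_deriv_apply ext_deriv0_apply lie_bracket_fscale_left
          F1_diff[OF assms(2)] F1_fscale[OF assms(2)] fscale_apply algebra_simps)
  qed (use assms F1_K[OF assms(2), of X] in simp_all)
  show "lie_deriv G X (fscale f \<eta>) = fscale f (lie_deriv G X \<eta>) + fscale (X f) \<eta>"
  proof (rule F1_ext)
    fix Z assume Z: "Z \<in> VF"
    show "lie_deriv G X (fscale f \<eta>) Z = (fscale f (lie_deriv G X \<eta>) + fscale (X f) \<eta>) Z"
      using vf_mult[OF assms(1,3) F1_K[OF assms(2)], of Z]
      by (simp add: lie_deriv_apply Z fscale_apply algebra_simps)
  qed (use assms vf_K[OF assms(1), of f] in simp_all)
qed

lemma ext_deriv1_add:
  assumes "Y \<in> VF" "Y' \<in> VF" "\<xi> \<in> F1" "\<xi>' \<in> F1"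
  shows "ext_deriv1 G \<xi> (Y + Y') = ext_deriv1 G \<xi> Y + ext_deriv1 G \<xi> Y'"
    "ext_deriv1 G (\<xi> + \<xi>') Y = ext_deriv1 G \<xi> Y + ext_deriv1 G \<xi>' Y"
proof -
  show "ext_deriv1 G \<xi> (Y + Y') = ext_deriv1 G \<xi> Y + ext_deriv1 G \<xi> Y'"
  proof (rule F1_ext)
    fix Z assume Z: "Z \<in> VF"
    show "ext_deriv1 G \<xi> (Y + Y') Z = (ext_deriv1 G \<xi> Y + ext_deriv1 G \<xi> Y') Z"
      using vf_add[OF Z F1_K[OF assms(3)] F1_K[OF assms(3)], of Y Y'] assms Z
      by (simp add: ext_deriv1_apply lie_bracket_add_left F1_add[OF assms(3)])
  qed (use assms in simp_all)
  show "ext_deriv1 G (\<xi> + \<xi>') Y = ext_deriv1 G \<xi> Y + ext_deriv1 G \<xi>' Y"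
  proof (rule F1_ext)
    fix Z assume Z: "Z \<in> VF"
    show "ext_deriv1 G (\<xi> + \<xi>') Y Z = (ext_deriv1 G \<xi> Y + ext_deriv1 G \<xi>' Y) Z"
      using vf_add[OF Z F1_K[OF assms(3)] F1_K[OF assms(4)], of Y Y]
        vf_add[OF assms(1) F1_K[OF assms(3)] F1_K[OF assms(4)], of Z Z] assms Z
      by (simp add: ext_deriv1_apply)
  qed (use assms in simp_all)
qed

lemma ext_deriv1_fscale:
  assumes "Y \<in> VF" "\<xi> \<in> F1" "f \<in> K"
  shows "ext_deriv1 G \<xi> (fscale f Y) = fscale f (ext_deriv1 G \<xi> Y)"
    "ext_deriv1 G (fscale f \<xi>) Y
      = fscale f (ext_deriv1 G \<xi> Y) + fscale (Y f) \<xi> - fscale (\<xi> Y) (ext_deriv0 G f)"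
proof -
  show "ext_deriv1 G \<xi> (fscale f Y) = fscale f (ext_deriv1 G \<xi> Y)"
  proof (rule F1_ext)
    fix Z assume Z: "Z \<in> VF"
    have "Z f \<in> K" using Z by (rule vf_K)
    then show "ext_deriv1 G \<xi> (fscale f Y) Z = fscale f (ext_deriv1 G \<xi> Y) Z"
      using vf_mult[OF Z assms(3) F1_K[OF assms(2)], of Y] assms Z
      by (simp add: ext_deriv1_apply lie_bracket_fscale_left F1_fscale[OF assms(2)]
          F1_diff[OF assms(2)] fscale_apply algebra_simps)
  qed (use assms in simp_all)
  show "ext_deriv1 G (fscale f \<xi>) Y
      = fscale f (ext_deriv1 G \<xi> Y) + fscale (Y f) \<xi> - fscale (\<xi> Y) (ext_deriv0 G f)"
  proof (rule F1_ext)
    fix Z assume Z: "Z \<in> VF"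
    show "ext_deriv1 G (fscale f \<xi>) Y Z
        = (fscale f (ext_deriv1 G \<xi> Y) + fscale (Y f) \<xi> - fscale (\<xi> Y) (ext_deriv0 G f)) Z"
      using vf_mult[OF Z assms(3) F1_K[OF assms(2)], of Y]
        vf_mult[OF assms(1) assms(3) F1_K[OF assms(2)], of Z] assms Z
      by (simp add: ext_deriv1_apply ext_deriv0_apply fscale_apply algebra_simps)
  qed (use assms vf_K[OF assms(1), of f] F1_K[OF assms(2), of Y] in simp_all)
qed

lemma H_add:
  assumes "X \<in> VF" "X' \<in> VF" "Y \<in> VF"
  shows "H Y (X + X') = H Y X + H Y X'" "H (X + X') Y = H X Y + H X' Y"
proof -
  show "H Y (X + X') = H Y X + H Y X'"
    by (rule tensor_F1_add) (use assms in \<open>simp_all add: H_F1_mid\<close>)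
  show "H (X + X') Y = H X Y + H X' Y"
  proof (rule F1_ext)
    fix Z assume "Z \<in> VF"
    from F1_add[OF H_F1_left[OF assms(3) this] assms(1,2)]
    show "H (X + X') Y Z = (H X Y + H X' Y) Z" by simp
  qed (use assms in simp_all)
qed

lemma H_fscale:
  assumes "X \<in> VF" "Y \<in> VF" "f \<in> K"
  shows "H Y (fscale f X) = fscale f (H Y X)" "H (fscale f X) Y = fscale f (H X Y)"
proof -
  show "H Y (fscale f X) = fscale f (H Y X)"
    by (rule tensor_F1_fscale) (use assms in \<open>simp_all add: H_F1_mid\<close>)
  show "H (fscale f X) Y = fscale f (H X Y)"
  proof (rule F1_ext)
    fix Z assume "Z \<in> VF"
    from F1_fscale[OF H_F1_left[OF assms(2) this] assms(1,3)]
    show "H (fscale f X) Y Z = fscale f (H X Y) Z" by (simp add: fscale_apply)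
  qed (use assms in simp_all)
qed

lemma dorf_add [simp]:
  assumes "u \<in> S" "u' \<in> S" "x \<in> S"
  shows "dorf (u + u') x = dorf u x + dorf u' x" "dorf x (u + u') = dorf x u + dorf x u'"
proof -
  obtain X \<xi> l Y \<eta> m Z \<zeta> n where [simp]: "u = (X, \<xi>, l)" "u' = (Y, \<eta>, m)" "x = (Z, \<zeta>, n)"
    by (cases u; cases u'; cases x)
  have [simp]: "X \<in> VF" "Y \<in> VF" "Z \<in> VF" "\<xi> \<in> F1" "\<eta> \<in> F1" "\<zeta> \<in> F1" "l \<in> K" "m \<in> K" "n \<in> K"
    using assms by (simp_all add: S_iff)
  have [simp]: "Z (l + m) = Z l + Z m" by (simp add: vf_add[of Z l m])
  have [simp]: "F Z (X + Y) = F Z X + F Z Y" by (rule F1_add) simp_all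
  show "dorf (u + u') x = dorf u x + dorf u' x"
    by (simp add: lie_bracket_add_left lie_deriv_add(1)[OF _ _ _ zero_F1] ext_deriv1_add(2)[OF _ VF_0] H_add F_add
        fscale_add_left algebra_simps)
  show "dorf x (u + u') = dorf x u + dorf x u'"
    by (simp add: lie_bracket_add_right lie_deriv_add(2)[OF _ VF_0] ext_deriv1_add(1)[OF _ _ _ zero_F1] H_add F_add
        fscale_add_left algebra_simps)
qed

lemma dorf_sscale_right [simp]:
  assumes "u \<in> S" "x \<in> S" "f \<in> K"
  shows "dorf x (sscale f u) = sscale f (dorf x u) + sscale (fst x f) u"
proof -
  obtain X \<xi> l Z \<zeta> n where [simp]: "u = (X, \<xi>, l)" "x = (Z, \<zeta>, n)"
    by (cases u; cases x)
  have [simp]: "X \<in> VF" "Z \<in> VF" "\<xi> \<in> F1" "\<zeta> \<in> F1" "l \<in> K" "n \<in> K"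
    using assms by (simp_all add: S_iff)
  have [simp]: "Z (f * l) = f * Z l + Z f * l" by (simp add: vf_mult[of Z f l] assms)
  have [simp]: "F Z (fscale f X) = f * F Z X" by (rule F1_fscale) (simp_all add: assms)
  show ?thesis
    using assms(3) by (simp add: lie_bracket_fscale_right lie_deriv_fscale(2) ext_deriv1_fscale(1) H_fscale F_fscale
        fscale_apply algebra_simps)
qed

text \<open>The Lie derivative, the exterior derivative and the term \<open>2 n d l\<close> contribute \<open>\<zeta>(X) df\<close>, \<open>\<xi>(Z) df\<close>
  and \<open>2 l n df\<close>; together they are twice the pairing of the two sections times \<open>df\<close>.\<close>

lemma dorf_sscale_left:
  assumes "u \<in> S" "x \<in> S" "f \<in> K"
  shows "dorf (sscale f u) x = sscale f (dorf u x) - sscale (fst x f) u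
    + (0, fscale (cst 2 * pairing u x) (ext_deriv0 G f), 0)"
proof -
  obtain X \<xi> l Z \<zeta> n where [simp]: "u = (X, \<xi>, l)" "x = (Z, \<zeta>, n)"
    by (cases u; cases x)
  have [simp]: "X \<in> VF" "Z \<in> VF" "\<xi> \<in> F1" "\<zeta> \<in> F1" "l \<in> K" "n \<in> K"
    using assms by (simp_all add: S_iff)
  have [simp]: "Z (f * l) = f * Z l + Z f * l" by (simp add: vf_mult[of Z f l] assms)
  have half: "cst 2 * (cst (1/2) * k) = k" for k by (simp add: fun_eq_iff)
  have "fscale (cst 2 * pairing u x) (ext_deriv0 G f)
      = fscale (\<xi> Z) (ext_deriv0 G f) + fscale (\<zeta> X) (ext_deriv0 G f)
        + fscale (cst 2 * (l * n)) (ext_deriv0 G f)"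
    by (simp add: distrib_left half fscale_add_left)
  then show ?thesis
    using assms(3) by (simp add: lie_bracket_fscale_left lie_deriv_fscale(1) ext_deriv1_fscale(2) H_fscale F_fscale
        fscale_apply fscale_add_left algebra_simps)
qed

lemma dorf_sscale_left_orthogonal:
  "u \<in> S \<Longrightarrow> x \<in> S \<Longrightarrow> f \<in> K \<Longrightarrow> pairing u x = 0 \<Longrightarrow>
    dorf (sscale f u) x = sscale f (dorf u x) - sscale (fst x f) u"
  by (simp add: dorf_sscale_left flip: zero_prod_def)

end

section \<open>The orthonormal frame of sections\<close>

lemma nat_0_6: "{0..6::nat} = {0, 1, 2, 3, 4, 5, 6}" and nat_0_3: "{0..3::nat} = {0, 1, 2, 3}"
  and nat_4_6: "{4..6::nat} = {4, 5, 6}"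
  by auto

context courant_frame
begin

lemma eps_square [simp]: "a \<in> {1..3} \<Longrightarrow> \<epsilon> a * \<epsilon> a = 1"
  using eps by fastforce

lemma w_VF [simp]: "a \<le> 3 \<Longrightarrow> w a \<in> VF"
  by (cases "a = 0") (simp_all add: w_def)

lemma idx_le: "A \<le> 6 \<Longrightarrow> idx A \<le> 3"
  by (simp add: idx_def) arith

lemma e_eq: "A \<le> 6 \<Longrightarrow> e A = (w (idx A), fscale (cst (sg A)) (g (w (idx A))), cst (unit0 A))"
proof -
  have "fscale (cst 1) x = x" for x :: "'g form1" by (simp add: fscale_def fun_eq_iff)
  moreover have "fscale (cst (- 1)) x = - x" for x :: "'g form1" by (simp add: fscale_def fun_eq_iff)
  moreover have "g 0 = 0" using g_fscale[of 0 0] by simp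
  ultimately show "A \<le> 6 \<Longrightarrow> ?thesis"
    by (auto simp: e_basis_def w_def idx_def sg_def unit0_def zero_fun_def one_fun_def)
qed

lemma e_S [simp]: "A \<le> 6 \<Longrightarrow> e A \<in> S"
  by (simp add: e_eq S_iff idx_le)

lemma g_w: "a \<le> 3 \<Longrightarrow> b \<le> 3 \<Longrightarrow> g (w a) (w b) = cst (if a = b \<and> a \<noteq> 0 then \<epsilon> a else 0)"
proof -
  assume "a \<le> 3" "b \<le> 3"
  moreover have "g 0 = 0" using g_fscale[of 0 0] by simp
  moreover have "g (v a) 0 = 0" if "a \<in> {1..3}" for a
    using that by (intro F1_0 g_F1) simp
  ultimately show ?thesis
    using g_v[of a b] by (cases "a = 0"; cases "b = 0") (auto simp: w_def fun_eq_iff)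
qed

lemma F_w: "a \<le> 3 \<Longrightarrow> b \<le> 3 \<Longrightarrow> F (w a) (w b) = cst (fc a b)"
proof -
  assume "a \<le> 3" "b \<le> 3"
  moreover have "F 0 = 0" using F_fscale[of 0 0] by simp
  moreover have "F (v a) 0 = 0" if "a \<in> {1..3}" for a
    using that by (intro F1_0 F_F1) simp
  ultimately show ?thesis
    using F_v[of a b] by (cases "a = 0"; cases "b = 0") (auto simp: w_def fc_def fun_eq_iff)
qed

lemma F_skew: "X \<in> VF \<Longrightarrow> Y \<in> VF \<Longrightarrow> F X Y = - F Y X"
proof -
  assume X: "X \<in> VF" and Y: "Y \<in> VF"
  have alt: "F Z Z = 0" if "Z \<in> VF" for Z using F_form that by (simp add: two_forms_def)
  have "F (X + Y) (X + Y) = F X X + F X Y + (F Y X + F Y Y)"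
    using F1_add[OF F_F1[OF X] X Y] F1_add[OF F_F1[OF Y] X Y] F_add[OF X Y] by simp
  then show ?thesis using alt X Y by (simp add: eq_neg_iff_add_eq_0)
qed

lemma Fc_skew: "a \<in> {1..3} \<Longrightarrow> b \<in> {1..3} \<Longrightarrow> Fc a b = - Fc b a"
  using F_skew[of "v a" "v b"] F_v[of a b] F_v[of b a] by (simp add: fun_eq_iff)

lemma fc_skew: "fc a b = - fc b a"
  using Fc_skew[of a b] by (auto simp: fc_def)

lemma H_skew:
  assumes "X \<in> VF" "Y \<in> VF" "Z \<in> VF"
  shows "H X Y Z = - H Y X Z" "H X Y Z = - H X Z Y"
proof -
  have alt: "H Z Z Y = 0" if "Z \<in> VF" "Y \<in> VF" for Y Z using H_form that by (simp add: three_forms_def)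
  have alt': "H X Z Z = 0" if "Z \<in> VF" "X \<in> VF" for X Z
    using H_form that by (simp add: three_forms_def two_forms_def)
  have "H (X + Y) (X + Y) Z = H X X Z + H X Y Z + (H Y X Z + H Y Y Z)"
    using assms by (simp add: H_add)
  then show "H X Y Z = - H Y X Z" using alt assms by (simp add: eq_neg_iff_add_eq_0)
  have "H X (Y + Z) (Y + Z) = H X Y Y + H X Y Z + (H X Z Y + H X Z Z)"
    using F1_add[OF H_F1[OF assms(1,2)] assms(2,3)] F1_add[OF H_F1[OF assms(1,3)] assms(2,3)] assms
    by (simp add: H_add)
  then show "H X Y Z = - H X Z Y" using alt' assms by (simp add: eq_neg_iff_add_eq_0)
qed

lemma H_w: "a \<le> 3 \<Longrightarrow> b \<le> 3 \<Longrightarrow> c \<le> 3 \<Longrightarrow> H (w a) (w b) (w c) = cst (h * levi3 a b c)"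
proof -
  have zero: "H 0 Y Z = 0" "H Y 0 Z = 0" "H Y Z 0 = 0" if "Y \<in> VF" "Z \<in> VF" for Y Z
    using H_fscale[of 0 Y 0] F1_0[OF H_F1[OF that]] that by simp_all
  have alt: "H Z Z Y = 0" "H Y Z Z = 0" "H Z Y Z = 0" if "Z \<in> VF" "Y \<in> VF" for Y Z
  proof -
    show *: "H Z Z Y = 0" "H Y Z Z = 0"
      using H_form that by (simp_all add: three_forms_def two_forms_def)
    show "H Z Y Z = 0" using H_skew(2)[of Z Y Z] * that by simp
  qed
  have v: "v 1 \<in> VF" "v 2 \<in> VF" "v 3 \<in> VF" by simp_all
  have 1: "H (v 2) (v 1) (v 3) = cst (- h)" "H (v 1) (v 3) (v 2) = cst (- h)"
    using H_skew(1)[OF v(2) v(1) v(3)] H_skew(2)[OF v(1) v(3) v(2)] H_v by (simp_all add: fun_eq_iff)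
  have 2: "H (v 2) (v 3) (v 1) = cst h" "H (v 3) (v 1) (v 2) = cst h"
    using H_skew(2)[OF v(2) v(3) v(1)] H_skew(1)[OF v(3) v(1) v(2)] 1 by (simp_all add: fun_eq_iff)
  have 3: "H (v 3) (v 2) (v 1) = cst (- h)"
    using H_skew(1)[OF v(3) v(2) v(1)] 2 by (simp add: fun_eq_iff)
  have cases: "a = 0 \<or> a = 1 \<or> a = 2 \<or> a = 3" if "a \<le> 3" for a :: nat using that by auto
  assume a: "a \<le> 3" and b: "b \<le> 3" and c: "c \<le> 3"
  note z = zero_fun_def[symmetric]
  show ?thesis
    using cases[OF a] cases[OF b] cases[OF c] v
    by (elim disjE; simp del: One_nat_def add: w_def levi3_def zero alt 1 2 3 H_v z)
qed

text \<open>As \<open>[v\<^sub>1, v\<^sub>3] = 0\<close>, the function \<open>fr\<close> only involves brackets with \<open>v\<^sub>2\<close>.\<close>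

lemma bracket_w:
  assumes "a \<le> 3" "b \<le> 3"
  shows "lie_bracket (w a) (w b) = rscale (\<epsilon> 1 * fr a b 1) (v 1) + rscale (\<epsilon> 3 * fr a b 3) (v 3)"
proof -
  have v: "v 1 \<in> VF" "v 2 \<in> VF" "v 3 \<in> VF" by simp_all
  have z: "rscale 0 X = 0" for X by (simp flip: zero_fun_def)
  have zero: "lie_bracket 0 X = 0" "lie_bracket X 0 = 0" if "X \<in> VF" for X
    using lie_bracket_fscale_left[of 0 X 0] lie_bracket_fscale_right[of X 0 0] that
      vf_0[of X] by simp_all
  have r: "lie_bracket (v 3) (v 1) = 0"
    "lie_bracket (v 1) (v 2) = rscale (- (\<epsilon> 1 * lam)) (v 1) + rscale (- (\<epsilon> 3 * \<mu>)) (v 3)"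
    "lie_bracket (v 3) (v 2) = rscale (- (\<epsilon> 1 * \<nu>)) (v 1) + rscale (- (\<epsilon> 3 * \<rho>)) (v 3)"
    using lie_bracket_skew[of "v 3" "v 1"] lie_bracket_skew[of "v 1" "v 2"] lie_bracket_skew[of "v 3" "v 2"]
      br_13 br_21 br_23 by (simp_all add: fscale_def fun_eq_iff)
  have cases: "a = 0 \<or> a = 1 \<or> a = 2 \<or> a = 3" if "a \<le> 3" for a :: nat using that by auto
  show ?thesis
    using cases[OF assms(1)] cases[OF assms(2)] v
    by (elim disjE; simp del: One_nat_def add: w_def fr_def fr2_def z zero r br_13 br_21 br_23)
qed

lemma g_bracket_w:
  assumes "a \<le> 3" "b \<le> 3" "c \<le> 3"
  shows "g (w c) (lie_bracket (w a) (w b)) = cst (fr a b c)"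
proof -
  have *: "g (w c) (lie_bracket (w a) (w b))
      = cst (\<epsilon> 1 * fr a b 1) * g (w c) (w 1) + cst (\<epsilon> 3 * fr a b 3) * g (w c) (w 3)"
    unfolding bracket_w[OF assms(1,2)]
    using F1_add[OF g_F1[OF w_VF[OF assms(3)]], of "rscale (\<epsilon> 1 * fr a b 1) (v 1)" "rscale (\<epsilon> 3 * fr a b 3) (v 3)"]
      F1_fscale[OF g_F1[OF w_VF[OF assms(3)]]]
    by (simp add: w_def)
  have cases: "c = 0 \<or> c = 1 \<or> c = 2 \<or> c = 3" using assms(3) by auto
  have 0: "fr a b 0 = 0" "fr a b 2 = 0" by (simp_all add: fr_def fr2_def)
  have "\<epsilon> 1 * (\<epsilon> 1 * x) = x" "\<epsilon> 3 * (\<epsilon> 3 * x) = x" for x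
    using eps_square[of 1] eps_square[of 3] by (simp_all flip: mult.assoc)
  then show ?thesis
    using cases unfolding * by (elim disjE; simp del: One_nat_def add: g_w 0 fun_eq_iff mult_ac)
qed

lemma dorf_e_form:
  assumes "A \<le> 6" "B \<le> 6" "c \<le> 3"
  shows "fst (snd (dorf (e A) (e B))) (w c) = cst (sg A * fr (idx B) c (idx A) - sg B * fr (idx A) c (idx B)
      + h * levi3 (idx B) (idx A) c - 2 * (unit0 B * fc (idx A) c - unit0 A * fc (idx B) c))"
proof -
  define a b where ab: "a = idx A" "b = idx B"
  have le: "a \<le> 3" "b \<le> 3" using assms idx_le ab by auto
  have c: "cst x * cst y = cst (x * y)" for x y by (simp add: fun_eq_iff)
  have d: "w a (cst x) = 0" if "a \<le> 3" for a x using that by (intro vf_cst[of "w a" x]) simp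
  show ?thesis
    unfolding e_eq[OF assms(1)] e_eq[OF assms(2)] ab[symmetric]
    using le assms(3)
    by (simp add: lie_deriv_apply ext_deriv1_apply fscale_apply g_w g_bracket_w F_w H_w c d)
      (simp add: fun_eq_iff algebra_simps)
qed

lemma pairing_e: "A \<le> 6 \<Longrightarrow> B \<le> 6 \<Longrightarrow> pairing (e A) (e B) = cst (if A = B then eta A else 0)"
proof -
  assume A: "A \<le> 6" and B: "B \<le> 6"
  have cases: "A = 0 \<or> A = 1 \<or> A = 2 \<or> A = 3 \<or> A = 4 \<or> A = 5 \<or> A = 6" if "A \<le> 6" for A :: nat
    using that by auto
  have "pairing (e A) (e B) = cst ((sg A + sg B) / 2 * (if idx A = idx B \<and> idx A \<noteq> 0 then \<epsilon> (idx A) else 0)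
      + unit0 A * unit0 B)"
    by (simp add: e_eq A B fscale_apply g_w idx_le fun_eq_iff field_simps)
  also have "(sg A + sg B) / 2 * (if idx A = idx B \<and> idx A \<noteq> 0 then \<epsilon> (idx A) else 0)
      + unit0 A * unit0 B = (if A = B then eta A else 0)"
    using cases[OF A] cases[OF B]
    by (elim disjE; simp add: idx_def sg_def unit0_def eta_def)
  finally show ?thesis .
qed

lemma dorf_e: "A \<le> 6 \<Longrightarrow> B \<le> 6 \<Longrightarrow> C \<le> 6 \<Longrightarrow> pairing (dorf (e A) (e B)) (e C) = cst (Bc A B C)"
proof -
  assume A: "A \<le> 6" and B: "B \<le> 6" and C: "C \<le> 6"
  obtain X \<xi> l where u: "dorf (e A) (e B) = (X, \<xi>, l)" by (cases "dorf (e A) (e B)")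
  have l: "l = cst (fc (idx A) (idx B))"
    using u A B F_w[of "idx A" "idx B"] vf_cst[OF w_VF[OF idx_le[OF A]]] vf_cst[OF w_VF[OF idx_le[OF B]]]
    by (simp add: e_eq idx_le)
  have X: "X = lie_bracket (w (idx A)) (w (idx B))"
    using u A B by (simp add: e_eq)
  have \<xi>: "\<xi> (w (idx C)) = cst (sg A * fr (idx B) (idx C) (idx A) - sg B * fr (idx A) (idx C) (idx B)
      + h * levi3 (idx B) (idx A) (idx C)
      - 2 * (unit0 B * fc (idx A) (idx C) - unit0 A * fc (idx B) (idx C)))"
    using dorf_e_form[OF A B idx_le[OF C]] u by simp
  show ?thesis
    unfolding u using A B C
    by (simp add: e_eq[OF C] l X \<xi> fscale_apply g_bracket_w idx_le) (simp add: fun_eq_iff Bc_def field_simps)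
qed

lemma Bc_skew: "Bc A B C = - Bc B A C" "Bc A B C = - Bc A C B"
proof -
  have fr: "fr a b c = - fr b a c" for a b c by (simp add: fr_def fr2_def)
  have levi: "levi3 a b c = - levi3 b a c" "levi3 a b c = - levi3 c b a" for a b c
    by (auto simp: levi3_def)
  show "Bc A B C = - Bc B A C"
    unfolding Bc_def fr[of "idx A" "idx B" "idx C"] levi(1)[of "idx A" "idx B" "idx C"]
      fc_skew[of "idx A" "idx B"] by (simp add: field_simps)
  show "Bc A B C = - Bc A C B"
    unfolding Bc_def fr[of "idx B" "idx C" "idx A"] levi(2)[of "idx B" "idx A" "idx C"]
      fc_skew[of "idx B" "idx C"] by (simp add: field_simps)
qed

subsection \<open>Coordinates of sections\<close>

text \<open>The sections \<open>e\<^sub>a\<close> and \<open>e\<^sub>a\<^sub>+\<^sub>3\<close> together test the covector part at \<open>v\<^sub>a\<close> and the product of the vector part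
  with \<open>v\<^sub>a\<close>, and \<open>e\<^sub>0\<close> tests the function.\<close>

lemma S_zeroI:
  assumes "u \<in> S" "\<And>A. A \<in> {0..6} \<Longrightarrow> pairing u (e A) = 0"
  shows "u = 0"
proof -
  obtain X \<xi> l where u: "u = (X, \<xi>, l)" by (cases u)
  have S: "X \<in> VF" "\<xi> \<in> F1" "l \<in> K" using assms(1) by (simp_all add: S_iff u)
  have e: "e 0 = (0, 0, 1)" "\<And>a. a \<in> {1..3} \<Longrightarrow> e a = (v a, g (v a), 0)"
    "\<And>a. a \<in> {1..3} \<Longrightarrow> e (a + 3) = (v a, - g (v a), 0)"
    by (auto simp: e_basis_def)
  have "l = 0" using assms(2)[of 0] F1_0[OF S(2)] by (simp add: u e)
  have 1: "\<xi> (v a) + g (v a) X = 0" "\<xi> (v a) - g (v a) X = 0" if "a \<in> {1..3}" for a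
    using assms(2)[of a] assms(2)[of "a + 3"] that
    by (simp_all add: u e fun_eq_iff)
  have "\<xi> (v a) p = 0" "g (v a) X p = 0" if "a \<in> {1..3}" for a p
    using fun_cong[OF 1(1)[OF that], of p] fun_cong[OF 1(2)[OF that], of p] by simp_all
  then have 2: "\<xi> (v a) = 0" "g (v a) X = 0" if "a \<in> {1..3}" for a
    using that by (auto simp: fun_eq_iff)
  have "\<xi> = 0" by (rule F1_eqI[OF S(2) zero_F1]) (simp add: 2)
  obtain c where c: "\<And>a. c a \<in> K" "X = (\<Sum>a\<in>{1..3}. fscale (c a) (v a))"
    by (rule frame_coeffs_exist[OF S(1)]) auto
  have "c a = 0" if a: "a \<in> {1..3}" for a
  proof -
    have g: "g (v a) \<in> F1" using a by simp
    have "g (v a) X = (\<Sum>b\<in>{1..3}. g (v a) (fscale (c b) (v b)))"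
      unfolding c(2) by (rule F1_sum[OF g]) (simp add: c(1))
    then have "0 = (\<Sum>b\<in>{1..3}. c b * g (v a) (v b))"
      using 2(2)[OF a] by (simp add: F1_fscale[OF g] c(1))
    also have "\<dots> = (\<Sum>b\<in>{1..3}. c b * cst (if a = b then \<epsilon> a else 0))"
      using a by (intro sum.cong) (simp_all add: g_v)
    also have "\<dots> = c a * cst (\<epsilon> a)"
      using a unfolding nat_1_3 by (auto simp flip: zero_fun_def)
    finally have "c a p * \<epsilon> a = 0" for p by (metis times_fun_apply zero_fun_apply)
    then show ?thesis using eps[OF a] by (auto simp: fun_eq_iff)
  qed
  then have "X = 0" unfolding c(2) by simp
  then show ?thesis using \<open>\<xi> = 0\<close> \<open>l = 0\<close> u by (simp add: zero_prod_def)
qed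

lemma S_eqI:
  assumes "u \<in> S" "x \<in> S" "\<And>A. A \<in> {0..6} \<Longrightarrow> pairing u (e A) = pairing x (e A)"
  shows "u = x"
  using S_zeroI[of "u - x"] assms by simp

text \<open>For a set \<open>I\<close> of indices, \<open>Sp I\<close> is the submodule spanned by the \<open>e\<^sub>A\<close> with \<open>A \<in> I\<close>.\<close>

definition Sp :: "nat set \<Rightarrow> 'g sect set" where
  "Sp I = {u \<in> S. \<forall>A\<in>{0..6} - I. pairing u (e A) = 0}"

lemma eta_square [simp]: "A \<le> 6 \<Longrightarrow> eta A * eta A = 1"
proof -
  have "A - 3 \<in> {1..3}" if "\<not> A \<le> 3" "A \<le> 6" using that by auto
  then show "A \<le> 6 \<Longrightarrow> ?thesis" using eps_square[of A] eps_square[of "A - 3"] by (auto simp: eta_def)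
qed

lemma Sp_S [simp]: "u \<in> Sp I \<Longrightarrow> u \<in> S"
  by (simp add: Sp_def)

lemma Sp_full: "Sp {0..6} = S"
  by (simp add: Sp_def del: Sp_S)

lemma Sp_closed [simp]:
  "0 \<in> Sp I" "u \<in> Sp I \<Longrightarrow> u' \<in> Sp I \<Longrightarrow> u + u' \<in> Sp I" "u \<in> Sp I \<Longrightarrow> u' \<in> Sp I \<Longrightarrow> u - u' \<in> Sp I"
  "f \<in> K \<Longrightarrow> u \<in> Sp I \<Longrightarrow> sscale f u \<in> Sp I"
  by (auto simp: Sp_def simp del: Sp_S)

lemma Sp_sum [simp]: "(\<And>i. i \<in> J \<Longrightarrow> u i \<in> Sp I) \<Longrightarrow> sum u J \<in> Sp I"
  by (induction J rule: infinite_finite_induct) auto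

lemma e_Sp [simp]: "A \<in> I \<Longrightarrow> A \<le> 6 \<Longrightarrow> e A \<in> Sp I"
  by (auto simp: Sp_def pairing_e fun_eq_iff simp del: Sp_S)

lemma pairing_comb:
  assumes "I \<subseteq> {0..6}" "A \<in> {0..6}" "\<And>i. i \<in> I \<Longrightarrow> c i \<in> K"
  shows "pairing (\<Sum>i\<in>I. sscale (c i) (e i)) (e A) = (if A \<in> I then cst (eta A) * c A else 0)"
proof -
  have fin: "finite I" using assms(1) finite_subset by blast
  have "pairing (\<Sum>i\<in>I. sscale (c i) (e i)) (e A) = (\<Sum>i\<in>I. pairing (sscale (c i) (e i)) (e A))"
    using assms by (intro pairing_sum) auto
  also have "\<dots> = (\<Sum>i\<in>I. if i = A then cst (eta A) * c A else 0)"
    using assms by (intro sum.cong) (auto simp: pairing_e fun_eq_iff subset_iff)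
  finally show ?thesis using fin by simp
qed

lemma expansion:
  assumes "I \<subseteq> {0..6}" "u \<in> Sp I"
  shows "u = (\<Sum>i\<in>I. sscale (cst (eta i) * pairing u (e i)) (e i))"
proof (rule S_eqI)
  show "(\<Sum>i\<in>I. sscale (cst (eta i) * pairing u (e i)) (e i)) \<in> S"
    using assms by (intro S_sum S_sscale K_mult K_cst pairing_K) (auto simp: subset_iff)
  fix A :: nat assume A: "A \<in> {0..6}"
  have "cst (eta A) * (cst (eta A) * x) = x" for x
    using eta_square[of A] A by (simp add: fun_eq_iff flip: mult.assoc)
  then show "pairing u (e A) = pairing (\<Sum>i\<in>I. sscale (cst (eta i) * pairing u (e i)) (e i)) (e A)"
    using assms A by (subst pairing_comb) (auto simp: Sp_def subset_iff simp del: Sp_S)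
qed (use assms in simp)

lemma pairing_expansion:
  assumes "u \<in> S" "x \<in> S"
  shows "pairing u x = (\<Sum>i\<in>{0..6}. cst (eta i) * (pairing u (e i) * pairing x (e i)))"
proof -
  have "pairing u x = pairing (\<Sum>i\<in>{0..6}. sscale (cst (eta i) * pairing u (e i)) (e i)) x"
    using expansion[of "{0..6}" u] assms by (simp add: Sp_full)
  also have "\<dots> = (\<Sum>i\<in>{0..6}. pairing (sscale (cst (eta i) * pairing u (e i)) (e i)) x)"
    using assms by (intro pairing_sum) simp_all
  also have "\<dots> = (\<Sum>i\<in>{0..6}. cst (eta i) * (pairing u (e i) * pairing x (e i)))"
    using assms by (intro sum.cong) (simp_all add: pairing_commute[of x] mult_ac)
  finally show ?thesis .
qed

lemma Sp_basis:
  assumes "I \<subseteq> {0..6}"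
  shows "module_basis K sscale (Sp I) I e"
  unfolding module_basis_def
proof (intro conjI ballI)
  show "finite I" using assms finite_subset by blast
  show "e ` I \<subseteq> Sp I" using assms by auto
  fix u assume u: "u \<in> Sp I"
  show "\<exists>!c. (\<forall>i\<in>I. c i \<in> K) \<and> (\<forall>i. i \<notin> I \<longrightarrow> c i = 0) \<and> u = (\<Sum>i\<in>I. sscale (c i) (e i))"
  proof (rule ex1I[of _ "\<lambda>i. if i \<in> I then cst (eta i) * pairing u (e i) else 0"])
    show "(\<forall>i\<in>I. (if i \<in> I then cst (eta i) * pairing u (e i) else 0) \<in> K) \<and>
        (\<forall>i. i \<notin> I \<longrightarrow> (if i \<in> I then cst (eta i) * pairing u (e i) else 0) = 0) \<and>
        u = (\<Sum>i\<in>I. sscale (if i \<in> I then cst (eta i) * pairing u (e i) else 0) (e i))"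
      using expansion[OF assms u] assms u by (auto intro!: K_mult pairing_K)
    fix c assume c: "(\<forall>i\<in>I. c i \<in> K) \<and> (\<forall>i. i \<notin> I \<longrightarrow> c i = 0) \<and> u = (\<Sum>i\<in>I. sscale (c i) (e i))"
    show "c = (\<lambda>i. if i \<in> I then cst (eta i) * pairing u (e i) else 0)"
    proof
      fix i
      show "c i = (if i \<in> I then cst (eta i) * pairing u (e i) else 0)"
      proof (cases "i \<in> I")
        case True
        then have i: "i \<le> 6" using assms by auto
        have "pairing u (e i) = cst (eta i) * c i"
          using c pairing_comb[OF assms, of i c] True i by simp
        then have "cst (eta i) * pairing u (e i) = c i"
          using eta_square[OF i] by (simp add: fun_eq_iff flip: mult.assoc)
        then show ?thesis using True by simp
      qed (use c in simp)
    qed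
  qed
qed

lemma trace_Sp:
  assumes "I \<subseteq> {0..6}" "\<And>u. u \<in> Sp I \<Longrightarrow> A u \<in> Sp I"
    and "\<And>u u'. u \<in> Sp I \<Longrightarrow> u' \<in> Sp I \<Longrightarrow> A (u + u') = A u + A u'"
    and "\<And>f u. f \<in> K \<Longrightarrow> u \<in> Sp I \<Longrightarrow> A (sscale f u) = sscale f (A u)"
  shows "module_trace K sscale (Sp I) A = (\<Sum>i\<in>I. cst (eta i) * pairing (A (e i)) (e i))"
proof (rule module_trace_eq[where b = e and c = "\<lambda>i j. cst (eta i) * pairing (A (e j)) (e i)"])
  have "e i \<in> Sp I" "i \<le> 6" if "i \<in> I" for i using that assms(1) by auto
  then show "cst (eta i) * pairing (A (e j)) (e i) \<in> K" if "i \<in> I" "j \<in> I" for i j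
    using that assms(2)[of "e j"] by (intro K_mult K_cst pairing_K) (auto intro: Sp_S)
  show "A (e j) = (\<Sum>i\<in>I. sscale (cst (eta i) * pairing (A (e j)) (e i)) (e i))" if "j \<in> I" for j
    using that assms(1) by (intro expansion assms(2) e_Sp) auto
qed (use assms Sp_basis in \<open>simp_all add: sscale_add_left\<close>)

text \<open>The form in which tensoriality is used.\<close>

lemma linear_zero:
  assumes "I \<subseteq> {0..6}" "u \<in> Sp I"
    and "\<And>u u'. u \<in> Sp I \<Longrightarrow> u' \<in> Sp I \<Longrightarrow> T (u + u') = T u + (T u' :: 'g \<Rightarrow> real)"
    and "\<And>f u. f \<in> K \<Longrightarrow> u \<in> Sp I \<Longrightarrow> T (sscale f u) = f * T u"
    and "\<And>i. i \<in> I \<Longrightarrow> T (e i) = 0"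
  shows "T u = 0"
proof -
  have T0: "T 0 = 0" using assms(4)[of 0 0] by simp
  have I: "i \<le> 6" if "i \<in> I" for i using assms(1) that by auto
  have "T (\<Sum>i\<in>J. sscale (c i) (e i)) = 0" if "\<And>i. c i \<in> K" "J \<subseteq> I" for J c
    using that(2)
  proof (induction J rule: infinite_finite_induct)
    case (insert i J)
    then have "T (sscale (c i) (e i) + (\<Sum>i\<in>J. sscale (c i) (e i)))
        = T (sscale (c i) (e i)) + T (\<Sum>i\<in>J. sscale (c i) (e i))"
      using that(1) I by (intro assms(3) Sp_closed(4) Sp_sum e_Sp) auto
    then show ?case using insert that(1) I assms(4)[of "c i" "e i"] assms(5)[of i] by simp
  qed (use T0 in simp_all)
  from this[of "\<lambda>i. if i \<in> I then cst (eta i) * pairing u (e i) else 0" I]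
  have "T (\<Sum>i\<in>I. sscale (if i \<in> I then cst (eta i) * pairing u (e i) else 0) (e i)) = 0"
    using assms(2) I by (auto intro!: K_mult pairing_K)
  then show ?thesis using expansion[OF assms(1,2)] by simp
qed

lemma E_minus_Sp: "E_minus G g = Sp {4..6}"
proof (intro equalityI subsetI)
  fix u assume "u \<in> E_minus G g"
  then obtain X where u: "u = (X, - g X, 0)" and X: "X \<in> VF" by (auto simp: E_minus_def)
  have "pairing u (e A) = 0" if "A \<in> {0..6} - {4..6}" for A
  proof (cases "A = 0")
    case True
    have "- g X \<in> F1" using X by simp
    from F1_0[OF this] show ?thesis using True by (simp add: u e_basis_def)
  next
    case False
    then have A: "A \<in> {1..3}" using that by auto
    then show ?thesis using False g_sym[OF X v_VF[OF A]] by (simp add: u e_basis_def)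
  qed
  then show "u \<in> Sp {4..6}" using X unfolding Sp_def by (auto simp: u S_iff)
next
  fix u assume *: "u \<in> Sp {4..6}"
  obtain X \<xi> l where u: "u = (X, \<xi>, l)" by (cases u)
  have S: "X \<in> VF" "\<xi> \<in> F1" "l \<in> K" using Sp_S[OF *] by (simp_all add: S_iff u)
  have 0: "pairing u (e A) = 0" if "A \<le> 3" for A using * that by (simp add: Sp_def del: Sp_S)
  have "l = 0" using 0[of 0] F1_0[OF S(2)] by (simp add: u e_basis_def)
  moreover have "\<xi> = - g X"
  proof (rule F1_eqI[OF S(2)])
    fix a :: nat assume a: "a \<in> {1..3}"
    have "cst (1/2) * (\<xi> (v a) + g (v a) X) = 0"
      using 0[of a] a by (simp add: u e_basis_def)
    then show "\<xi> (v a) = (- g X) (v a)"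
      using g_sym[OF S(1) v_VF[OF a]] by (simp add: fun_eq_iff eq_neg_iff_add_eq_0)
  qed (use S in simp)
  ultimately show "u \<in> E_minus G g" using S u by (auto simp: E_minus_def)
qed

lemma orth_compl_Sp: "orth_compl G (E_minus G g) = Sp {0..3}"
proof (intro equalityI subsetI)
  fix u assume "u \<in> orth_compl G (E_minus G g)"
  then show "u \<in> Sp {0..3}" by (auto simp: orth_compl_def E_minus_Sp Sp_def[of "{0..3}"] simp del: Sp_S)
next
  fix u assume u: "u \<in> Sp {0..3}"
  have "pairing u x = 0" if x: "x \<in> Sp {4..6}" for x
  proof -
    have "pairing u (e i) * pairing x (e i) = 0" if "i \<in> {0..6}" for i
      using u x that by (cases "i \<le> 3") (auto simp: Sp_def simp del: Sp_S)
    then show ?thesis using pairing_expansion[of u x] u x by simp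
  qed
  then show "u \<in> orth_compl G (E_minus G g)" using u by (simp add: orth_compl_def E_minus_Sp)
qed

end

lemma sum_cst: "(\<Sum>k\<in>J. cst (c k)) = cst (\<Sum>k\<in>J. c k)"
  by (induction J rule: infinite_finite_induct) (auto simp: fun_eq_iff)

section \<open>The Ricci curvature of a Levi-Civita generalized connection\<close>

locale courant_connection = courant_frame G v g F H \<epsilon> lam \<mu> \<nu> \<rho> h Fc
  for G :: "'g::{t2_space,second_countable_topology} lie_structure" and v g F H \<epsilon> lam \<mu> \<nu> \<rho> h Fc +
  fixes D :: "'g sect \<Rightarrow> 'g sect \<Rightarrow> 'g sect"
  assumes connection: "gen_connection G D"
begin

lemma D_S [simp]: "u \<in> S \<Longrightarrow> x \<in> S \<Longrightarrow> D u x \<in> S"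
  and D_add_left [simp]: "u \<in> S \<Longrightarrow> u' \<in> S \<Longrightarrow> x \<in> S \<Longrightarrow> D (u + u') x = D u x + D u' x"
  and D_sscale_left [simp]: "f \<in> K \<Longrightarrow> u \<in> S \<Longrightarrow> x \<in> S \<Longrightarrow> D (sscale f u) x = sscale f (D u x)"
  and D_add_right [simp]: "u \<in> S \<Longrightarrow> x \<in> S \<Longrightarrow> x' \<in> S \<Longrightarrow> D u (x + x') = D u x + D u x'"
  and D_sscale_right [simp]: "f \<in> K \<Longrightarrow> u \<in> S \<Longrightarrow> x \<in> S \<Longrightarrow>
    D u (sscale f x) = sscale (fst u f) x + sscale f (D u x)"
  using connection by (simp_all add: gen_connection_def)

lemma D_metric: "u \<in> S \<Longrightarrow> x \<in> S \<Longrightarrow> y \<in> S \<Longrightarrow> fst u (pairing x y) = pairing (D u x) y + pairing x (D u y)"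
  using connection unfolding gen_connection_def by blast

lemma D_0 [simp]: "x \<in> S \<Longrightarrow> D 0 x = 0" "x \<in> S \<Longrightarrow> D x 0 = 0"
  using D_sscale_left[of 0 0 x] D_add_right[of x 0 0] by simp_all

lemma D_diff_left [simp]: "u \<in> S \<Longrightarrow> u' \<in> S \<Longrightarrow> x \<in> S \<Longrightarrow> D (u - u') x = D u x - D u' x"
  using D_add_left[of "u - u'" u' x] by simp

lemma D_sum_left: "(\<And>i. i \<in> I \<Longrightarrow> u i \<in> S) \<Longrightarrow> x \<in> S \<Longrightarrow> D (sum u I) x = (\<Sum>i\<in>I. D (u i) x)"
  by (induction I rule: infinite_finite_induct) auto

lemma D_sum_right: "(\<And>i. i \<in> I \<Longrightarrow> u i \<in> S) \<Longrightarrow> x \<in> S \<Longrightarrow> D x (sum u I) = (\<Sum>i\<in>I. D x (u i))"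
  by (induction I rule: infinite_finite_induct) auto

abbreviation R :: "'g sect \<Rightarrow> 'g sect \<Rightarrow> 'g sect \<Rightarrow> 'g sect" where "R \<equiv> gen_curvature G H F D"

lemma R_S [simp]: "x \<in> S \<Longrightarrow> u \<in> S \<Longrightarrow> y \<in> S \<Longrightarrow> R x u y \<in> S"
  by (simp add: gen_curvature_def)

text \<open>The curvature \<open>R(x, u)y\<close> is tensorial in \<open>u\<close> and \<open>y\<close>, but tensorial in \<open>x\<close> only when
  \<open>x\<close> is orthogonal to \<open>u\<close>: the Dorfman bracket has an anomalous term in its first argument.\<close>

lemma R_add:
  "x \<in> S \<Longrightarrow> x' \<in> S \<Longrightarrow> u \<in> S \<Longrightarrow> y \<in> S \<Longrightarrow> R (x + x') u y = R x u y + R x' u y"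
  "x \<in> S \<Longrightarrow> u \<in> S \<Longrightarrow> u' \<in> S \<Longrightarrow> y \<in> S \<Longrightarrow> R x (u + u') y = R x u y + R x u' y"
  "x \<in> S \<Longrightarrow> u \<in> S \<Longrightarrow> y \<in> S \<Longrightarrow> y' \<in> S \<Longrightarrow> R x u (y + y') = R x u y + R x u y'"
  by (simp_all add: gen_curvature_def)

lemma R_sscale:
  assumes "f \<in> K" "x \<in> S" "u \<in> S" "y \<in> S"
  shows "pairing x u = 0 \<Longrightarrow> R (sscale f x) u y = sscale f (R x u y)"
    "R x (sscale f u) y = sscale f (R x u y)"
    "R x u (sscale f y) = sscale f (R x u y)"
  using assms
  by (simp_all add: gen_curvature_def dorf_sscale_left_orthogonal lie_bracket_apply sscale_diff_left algebra_simps)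

lemma torsion_tensorial:
  assumes "u \<in> S" "u' \<in> S" "x \<in> S" "y \<in> S" "f \<in> K"
  shows "torsion G H F D (u + u') x y = torsion G H F D u x y + torsion G H F D u' x y"
    "torsion G H F D x (u + u') y = torsion G H F D x u y + torsion G H F D x u' y"
    "torsion G H F D x y (u + u') = torsion G H F D x y u + torsion G H F D x y u'"
    "torsion G H F D (sscale f u) x y = f * torsion G H F D u x y"
    "torsion G H F D x (sscale f u) y = f * torsion G H F D x u y"
    "torsion G H F D x y (sscale f u) = f * torsion G H F D x y u"
proof -
  show "torsion G H F D (u + u') x y = torsion G H F D u x y + torsion G H F D u' x y"
    "torsion G H F D x (u + u') y = torsion G H F D x u y + torsion G H F D x u' y"
    "torsion G H F D x y (u + u') = torsion G H F D x y u + torsion G H F D x y u'"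
    "torsion G H F D x (sscale f u) y = f * torsion G H F D x u y"
    "torsion G H F D x y (sscale f u) = f * torsion G H F D x y u"
    using assms by (simp_all add: torsion_def algebra_simps)
  \<comment> \<open>The anomalous term of the bracket cancels the derivative of \<open>f\<close> along \<open>y\<close>.\<close>
  have df: "(0, fscale (cst 2 * pairing u x) (ext_deriv0 G f), 0) \<in> S"
    using assms by (simp add: S_iff)
  have "pairing (0, fscale (cst 2 * pairing u x) (ext_deriv0 G f), 0) y = pairing x u * fst y f"
  proof -
    obtain Y \<eta> m where y: "y = (Y, \<eta>, m)" by (cases y)
    have "Y \<in> VF" "\<eta> \<in> F1" using assms(4) by (simp_all add: y S_iff)
    then show ?thesis
      by (simp add: y fscale_apply ext_deriv0_apply F1_0 pairing_commute[of x]) (simp add: fun_eq_iff)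
  qed
  then show "torsion G H F D (sscale f u) x y = f * torsion G H F D u x y"
    using assms df by (simp add: torsion_def dorf_sscale_left algebra_simps)
qed

end

context courant_frame
begin

lemma Sp_orthogonal:
  assumes "x \<in> Sp I" "y \<in> Sp J" "I \<inter> J = {}"
  shows "pairing x y = 0"
proof -
  have "pairing x (e i) * pairing y (e i) = 0" if "i \<in> {0..6}" for i
  proof (cases "i \<in> I")
    case True
    then have "i \<in> {0..6} - J" using that assms(3) by blast
    then show ?thesis using assms(2) by (simp add: Sp_def del: Sp_S)
  qed (use that assms(1) in \<open>simp add: Sp_def del: Sp_S\<close>)
  then show ?thesis using pairing_expansion[of x y] Sp_S[OF assms(1)] Sp_S[OF assms(2)] by simp
qed

text \<open>The components of the Ricci tensor \<open>Ric(e\<^sub>p, e\<^sub>j)\<close>, \<open>p \<in> N\<close> and \<open>j \<in> P\<close>, where \<open>P\<close> and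
  \<open>N\<close> are the index sets of the two orthogonal subbundles.\<close>

definition ric_comp :: "nat set \<Rightarrow> nat set \<Rightarrow> (nat \<Rightarrow> real) \<Rightarrow> nat \<Rightarrow> nat \<Rightarrow> real" where
  "ric_comp P N d p j = (\<Sum>k\<in>P. eta k * Bc p j k * d k)
     - (\<Sum>i\<in>P. \<Sum>q\<in>N. eta i * eta q * Bc i p q * Bc q j i)"
abbreviation Ric_plus :: "(nat \<Rightarrow> real) \<Rightarrow> nat \<Rightarrow> nat \<Rightarrow> real" where
  "Ric_plus \<equiv> ric_comp {0..3} {4..6}"

abbreviation Ric_minus :: "(nat \<Rightarrow> real) \<Rightarrow> nat \<Rightarrow> nat \<Rightarrow> real" where
  "Ric_minus \<equiv> ric_comp {4..6} {0..3}"

end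

locale split_connection = courant_connection G v g F H \<epsilon> lam \<mu> \<nu> \<rho> h Fc D
  for G :: "'g::{t2_space,second_countable_topology} lie_structure" and v g F H \<epsilon> lam \<mu> \<nu> \<rho> h Fc D +
  fixes P N :: "nat set"
  assumes P_N: "P \<union> N = {0..6}" "P \<inter> N = {}"
    and torsion_free: "\<And>u x y. u \<in> S \<Longrightarrow> x \<in> S \<Longrightarrow> y \<in> S \<Longrightarrow> torsion G H F D u x y = 0"
    and D_P [simp]: "\<And>u x. u \<in> S \<Longrightarrow> x \<in> Sp P \<Longrightarrow> D u x \<in> Sp P"
    and D_N [simp]: "\<And>u x. u \<in> S \<Longrightarrow> x \<in> Sp N \<Longrightarrow> D u x \<in> Sp N"
begin

lemma P_le: "i \<in> P \<Longrightarrow> i \<le> 6" and N_le: "i \<in> N \<Longrightarrow> i \<le> 6"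
  and P_sub: "P \<subseteq> {0..6}" and N_sub: "N \<subseteq> {0..6}" and fin: "finite P" "finite N"
  using P_N(1) finite_subset[of P "{0..6}"] finite_subset[of N "{0..6}"] by auto

lemma pairing_P_N: "x \<in> Sp P \<Longrightarrow> y \<in> Sp N \<Longrightarrow> pairing x y = 0"
  using Sp_orthogonal P_N(2) by blast

abbreviation \<Gamma> :: "nat \<Rightarrow> nat \<Rightarrow> nat \<Rightarrow> 'g \<Rightarrow> real" where
  "\<Gamma> A B C \<equiv> pairing (D (e A) (e B)) (e C)"

text \<open>The mixed coefficients of the connection are determined by the torsion alone.\<close>

lemma \<Gamma>_mixed:
  assumes "p \<in> N" "j \<in> P" "k \<in> P"
  shows "\<Gamma> p j k = cst (Bc p j k)"
proof -
  have le: "p \<le> 6" "j \<le> 6" "k \<le> 6" using assms P_le N_le by auto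
  have "pairing (D (e j) (e p)) (e k) = 0" "pairing (e j) (D (e k) (e p)) = 0"
    using pairing_P_N[of "e k" "D (e j) (e p)"] pairing_P_N[of "e j" "D (e k) (e p)"] assms le
    by (simp_all add: pairing_commute[of "D (e j) (e p)"])
  then show ?thesis
    using torsion_free[of "e p" "e j" "e k"] le by (simp add: torsion_def dorf_e)
qed

lemma D_e_mixed:
  assumes "p \<in> N" "j \<in> P"
  shows "D (e p) (e j) = (\<Sum>k\<in>P. sscale (cst (eta k * Bc p j k)) (e k))"
proof -
  have "D (e p) (e j) = (\<Sum>k\<in>P. sscale (cst (eta k) * \<Gamma> p j k) (e k))"
    using assms P_le N_le by (intro expansion[OF P_sub] D_P) auto
  also have "\<dots> = (\<Sum>k\<in>P. sscale (cst (eta k * Bc p j k)) (e k))"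
    using assms by (intro sum.cong refl) (simp add: \<Gamma>_mixed cst_simps)
  finally show ?thesis .
qed

lemma dorf_e_expansion:
  assumes "A \<le> 6" "B \<le> 6"
  shows "dorf (e A) (e B) = (\<Sum>C\<in>{0..6}. sscale (cst (eta C * Bc A B C)) (e C))"
proof -
  have "dorf (e A) (e B) = (\<Sum>C\<in>{0..6}. sscale (cst (eta C) * pairing (dorf (e A) (e B)) (e C)) (e C))"
    using assms by (intro expansion) (auto simp: Sp_full)
  also have "\<dots> = (\<Sum>C\<in>{0..6}. sscale (cst (eta C * Bc A B C)) (e C))"
    using assms by (intro sum.cong refl) (simp add: dorf_e cst_simps)
  finally show ?thesis .
qed

lemma divergence_P:
  assumes "j \<in> P"
  shows "connection_divergence G D (e j) = (\<Sum>i\<in>P. cst (eta i) * \<Gamma> i j i)"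
proof -
  have j: "j \<le> 6" using assms P_le by blast
  have "connection_divergence G D (e j) = (\<Sum>A\<in>{0..6}. cst (eta A) * \<Gamma> A j A)"
    unfolding connection_divergence_def Sp_full[symmetric]
    by (rule trace_Sp) (use j in \<open>auto simp: Sp_full\<close>)
  also have "\<dots> = (\<Sum>A\<in>P. cst (eta A) * \<Gamma> A j A) + (\<Sum>A\<in>N. cst (eta A) * \<Gamma> A j A)"
    unfolding P_N(1)[symmetric] using fin P_N(2) by (rule sum.union_disjoint)
  also have "(\<Sum>A\<in>N. cst (eta A) * \<Gamma> A j A) = 0"
    using pairing_P_N assms j N_le by (intro sum.neutral ballI) simp
  finally show ?thesis by (simp only: add_0_right)
qed

text \<open>The mixed derivative \<open>D\<^sub>p e\<^sub>j\<close> has constant coefficients, so differentiating it once more costs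
  nothing. In the other second derivative \<open>D\<^sub>p\<close> is moved to \<open>e\<^sub>i\<close> by the metric property, which leaves
  only a derivative of \<open>\<Gamma> i j i\<close>, a term of a trace.\<close>

lemma curvature_e:
  assumes "i \<in> P" "p \<in> N" "j \<in> P"
  shows "pairing (R (e i) (e p) (e j)) (e i)
    = (\<Sum>k\<in>P. cst (eta k * Bc p j k) * \<Gamma> i k i) - fst (e p) (\<Gamma> i j i)
      + (\<Sum>k\<in>P. cst (eta k * Bc p i k) * \<Gamma> i j k) - (\<Sum>k\<in>P. cst (eta k * Bc i p k) * \<Gamma> k j i)
      - cst (\<Sum>q\<in>N. eta q * Bc i p q * Bc q j i)"
proof -
  have le: "i \<le> 6" "p \<le> 6" "j \<le> 6" using assms P_le N_le by auto
  note S = e_S[OF le(1)] e_S[OF le(2)] e_S[OF le(3)]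
  have 1: "pairing (D (e i) (D (e p) (e j))) (e i) = (\<Sum>k\<in>P. cst (eta k * Bc p j k) * \<Gamma> i k i)"
  proof -
    have "D (e i) (D (e p) (e j)) = (\<Sum>k\<in>P. D (e i) (sscale (cst (eta k * Bc p j k)) (e k)))"
      unfolding D_e_mixed[OF assms(2,3)] using S P_le by (intro D_sum_right) auto
    also have "\<dots> = (\<Sum>k\<in>P. sscale (cst (eta k * Bc p j k)) (D (e i) (e k)))"
      using S P_le by (intro sum.cong refl) simp
    finally have "pairing (D (e i) (D (e p) (e j))) (e i)
        = (\<Sum>k\<in>P. pairing (sscale (cst (eta k * Bc p j k)) (D (e i) (e k))) (e i))"
      using S P_le pairing_sum[of P "\<lambda>k. sscale (cst (eta k * Bc p j k)) (D (e i) (e k))" "e i"] by simp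
    also have "\<dots> = (\<Sum>k\<in>P. cst (eta k * Bc p j k) * \<Gamma> i k i)"
      using S P_le by (intro sum.cong refl) simp
    finally show ?thesis .
  qed
  have 2: "pairing (D (e p) (D (e i) (e j))) (e i)
      = fst (e p) (\<Gamma> i j i) - (\<Sum>k\<in>P. cst (eta k * Bc p i k) * \<Gamma> i j k)"
  proof -
    have "pairing (D (e i) (e j)) (D (e p) (e i))
        = (\<Sum>k\<in>P. pairing (D (e i) (e j)) (sscale (cst (eta k * Bc p i k)) (e k)))"
      unfolding D_e_mixed[OF assms(2,1)] using S P_le by (intro pairing_sum_right) auto
    also have "\<dots> = (\<Sum>k\<in>P. cst (eta k * Bc p i k) * \<Gamma> i j k)"
      using S P_le by (intro sum.cong refl) simp
    finally show ?thesis using D_metric[of "e p" "D (e i) (e j)" "e i"] S by simp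
  qed
  have 3: "pairing (D (dorf (e i) (e p)) (e j)) (e i)
      = (\<Sum>k\<in>P. cst (eta k * Bc i p k) * \<Gamma> k j i) + cst (\<Sum>q\<in>N. eta q * Bc i p q * Bc q j i)"
  proof -
    have "D (dorf (e i) (e p)) (e j) = (\<Sum>C\<in>{0..6}. D (sscale (cst (eta C * Bc i p C)) (e C)) (e j))"
      unfolding dorf_e_expansion[OF le(1,2)] using S by (intro D_sum_left) auto
    then have "pairing (D (dorf (e i) (e p)) (e j)) (e i)
        = (\<Sum>C\<in>{0..6}. pairing (D (sscale (cst (eta C * Bc i p C)) (e C)) (e j)) (e i))"
      using S pairing_sum[of "{0..6}" "\<lambda>C. D (sscale (cst (eta C * Bc i p C)) (e C)) (e j)" "e i"] by simp
    also have "\<dots> = (\<Sum>C\<in>{0..6}. cst (eta C * Bc i p C) * \<Gamma> C j i)"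
      using S by (intro sum.cong refl) simp
    finally have main: "pairing (D (dorf (e i) (e p)) (e j)) (e i)
        = (\<Sum>C\<in>{0..6}. cst (eta C * Bc i p C) * \<Gamma> C j i)" .
    have union: "(\<Sum>C\<in>{0..6}. cst (eta C * Bc i p C) * \<Gamma> C j i)
        = (\<Sum>C\<in>P. cst (eta C * Bc i p C) * \<Gamma> C j i) + (\<Sum>C\<in>N. cst (eta C * Bc i p C) * \<Gamma> C j i)"
      unfolding P_N(1)[symmetric] using fin P_N(2) by (rule sum.union_disjoint)
    have "(\<Sum>C\<in>N. cst (eta C * Bc i p C) * \<Gamma> C j i) = (\<Sum>C\<in>N. cst (eta C * Bc i p C * Bc C j i))"
      using assms by (intro sum.cong refl) (simp add: \<Gamma>_mixed cst_simps)
    then show ?thesis unfolding main union by (simp only: sum_cst)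
  qed
  show ?thesis
    using 1 2 3 S by (simp add: gen_curvature_def algebra_simps)
qed

text \<open>Summing over \<open>i\<close>, the two sums with \<open>\<Gamma> i j k\<close> and \<open>\<Gamma> k j i\<close> cancel because the structure
  constants are skew, and the unknown coefficients of the connection survive only in the traces
  \<open>\<Sum>\<^sub>i \<eta>\<^sub>i \<Gamma> i k i\<close>, which are the components of the divergence.\<close>

lemma ricci_e:
  assumes div: "\<And>j. j \<in> P \<Longrightarrow> connection_divergence G D (e j) = cst (d j)"
    and "p \<in> N" "j \<in> P"
  shows "ricci_on G H F D (Sp P) (e p) (e j) = cst (ric_comp P N d p j)"
proof -
  have le: "p \<le> 6" "j \<le> 6" using assms P_le N_le by auto
  have tr: "(\<Sum>i\<in>P. cst (eta i) * \<Gamma> i k i) = cst (d k)" if "k \<in> P" for k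
    using div[OF that] divergence_P[OF that] by simp
  have S: "e i \<in> S" if "i \<in> P" for i using that P_le by simp
  have \<Gamma>K: "\<Gamma> a b c \<in> K" if "a \<in> P" "b \<in> P" "c \<in> P" for a b c using that S by simp
  have "ricci_on G H F D (Sp P) (e p) (e j) = (\<Sum>i\<in>P. cst (eta i) * pairing (R (e i) (e p) (e j)) (e i))"
    unfolding ricci_on_def
  proof (rule trace_Sp[OF P_sub])
    have p: "e p \<in> Sp N" and j: "e j \<in> Sp P" using assms le by simp_all
    fix u u' assume u: "u \<in> Sp P" and u': "u' \<in> Sp P"
    show "R u (e p) (e j) \<in> Sp P"
      using u p j by (simp add: gen_curvature_def)
    show "R (u + u') (e p) (e j) = R u (e p) (e j) + R u' (e p) (e j)"
      using u u' p j by (intro R_add) auto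
    fix f assume "f \<in> K"
    then show "R (sscale f u) (e p) (e j) = sscale f (R u (e p) (e j))"
      using u p j pairing_P_N[OF u p] by (intro R_sscale) auto
  qed
  also have "\<dots> = (\<Sum>i\<in>P. cst (eta i) * ((\<Sum>k\<in>P. cst (eta k * Bc p j k) * \<Gamma> i k i) - fst (e p) (\<Gamma> i j i)
      + (\<Sum>k\<in>P. cst (eta k * Bc p i k) * \<Gamma> i j k) - (\<Sum>k\<in>P. cst (eta k * Bc i p k) * \<Gamma> k j i)
      - cst (\<Sum>q\<in>N. eta q * Bc i p q * Bc q j i)))"
    by (intro sum.cong refl) (simp only: curvature_e assms(2,3))
  also have "\<dots> = (\<Sum>i\<in>P. cst (eta i) * (\<Sum>k\<in>P. cst (eta k * Bc p j k) * \<Gamma> i k i))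
      - (\<Sum>i\<in>P. cst (eta i) * fst (e p) (\<Gamma> i j i))
      + (\<Sum>i\<in>P. cst (eta i) * (\<Sum>k\<in>P. cst (eta k * Bc p i k) * \<Gamma> i j k))
      - (\<Sum>i\<in>P. cst (eta i) * (\<Sum>k\<in>P. cst (eta k * Bc i p k) * \<Gamma> k j i))
      - (\<Sum>i\<in>P. cst (eta i) * cst (\<Sum>q\<in>N. eta q * Bc i p q * Bc q j i))"
    by (simp only: distrib_left right_diff_distrib sum.distrib sum_subtractf)
  finally have main: "ricci_on G H F D (Sp P) (e p) (e j) = \<dots>" .
  have "(\<Sum>i\<in>P. cst (eta i) * (\<Sum>k\<in>P. cst (eta k * Bc p j k) * \<Gamma> i k i))
      = (\<Sum>k\<in>P. cst (eta k * Bc p j k) * (\<Sum>i\<in>P. cst (eta i) * \<Gamma> i k i))"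
    unfolding sum_distrib_left by (subst sum.swap) (simp only: mult.left_commute)
  then have t1: "(\<Sum>i\<in>P. cst (eta i) * (\<Sum>k\<in>P. cst (eta k * Bc p j k) * \<Gamma> i k i))
      = (\<Sum>k\<in>P. cst (eta k * Bc p j k * d k))"
    by (simp add: tr cst_simps)
  have "fst (e p) (\<Sum>i\<in>P. cst (eta i) * \<Gamma> i j i) = (\<Sum>i\<in>P. fst (e p) (cst (eta i) * \<Gamma> i j i))"
    using le \<Gamma>K assms(3) by (intro fst_sum_K K_mult K_cst) auto
  moreover have "\<dots> = (\<Sum>i\<in>P. cst (eta i) * fst (e p) (\<Gamma> i j i))"
    using le \<Gamma>K assms(3) by (intro sum.cong refl) simp
  moreover have "fst (e p) (\<Sum>i\<in>P. cst (eta i) * \<Gamma> i j i) = 0"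
    using tr[OF assms(3)] le by simp
  ultimately have t2: "(\<Sum>i\<in>P. cst (eta i) * fst (e p) (\<Gamma> i j i)) = 0" by (simp only:)
  have "(\<Sum>i\<in>P. cst (eta i) * (\<Sum>k\<in>P. cst (eta k * Bc i p k) * \<Gamma> k j i))
      = (\<Sum>i\<in>P. \<Sum>k\<in>P. cst (eta k) * (cst (eta i * Bc k p i) * \<Gamma> i j k))"
    unfolding sum_distrib_left by (rule sum.swap)
  moreover have "\<dots> = (\<Sum>i\<in>P. \<Sum>k\<in>P. cst (eta i) * (cst (eta k * Bc p i k) * \<Gamma> i j k))"
  proof (intro sum.cong refl)
    fix i k
    have "Bc k p i = Bc p i k" using Bc_skew(1)[of k p i] Bc_skew(2)[of p k i] by simp
    then show "cst (eta k) * (cst (eta i * Bc k p i) * \<Gamma> i j k) = cst (eta i) * (cst (eta k * Bc p i k) * \<Gamma> i j k)"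
      by (simp add: fun_eq_iff)
  qed
  ultimately have t3: "(\<Sum>i\<in>P. cst (eta i) * (\<Sum>k\<in>P. cst (eta k * Bc i p k) * \<Gamma> k j i))
      = (\<Sum>i\<in>P. cst (eta i) * (\<Sum>k\<in>P. cst (eta k * Bc p i k) * \<Gamma> i j k))"
    by (simp only: sum_distrib_left)
  have *: "ricci_on G H F D (Sp P) (e p) (e j) = (\<Sum>k\<in>P. cst (eta k * Bc p j k * d k))
      - (\<Sum>i\<in>P. cst (eta i) * cst (\<Sum>q\<in>N. eta q * Bc i p q * Bc q j i))"
    unfolding main t1 t2 t3 by simp
  show ?thesis
    unfolding * ric_comp_def by (simp add: cst_simps sum_cst sum_distrib_left mult.assoc)
qed

text \<open>The curvature is tensorial in all three arguments here, because \<open>u\<close> and the argument over which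
  the trace is taken lie in orthogonal subbundles.\<close>

lemma ricci_zero:
  assumes "\<And>p j. p \<in> N \<Longrightarrow> j \<in> P \<Longrightarrow> ricci_on G H F D (Sp P) (e p) (e j) = 0"
    and u: "u \<in> Sp N" and y: "y \<in> Sp P"
  shows "ricci_on G H F D (Sp P) u y = 0"
proof -
  have formula: "ricci_on G H F D (Sp P) u y = (\<Sum>i\<in>P. cst (eta i) * pairing (R (e i) u y) (e i))"
    if u: "u \<in> Sp N" and y: "y \<in> Sp P" for u y
    unfolding ricci_on_def
  proof (rule trace_Sp[OF P_sub])
    fix x x' assume x: "x \<in> Sp P" and x': "x' \<in> Sp P"
    show "R x u y \<in> Sp P" using x u y by (simp add: gen_curvature_def)
    show "R (x + x') u y = R x u y + R x' u y"
      using x x' u y by (intro R_add) auto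
    fix f assume "f \<in> K"
    then show "R (sscale f x) u y = sscale f (R x u y)"
      using u x y pairing_P_N[OF x u] by (intro R_sscale) auto
  qed
  have S: "e i \<in> S" if "i \<in> P" for i using that P_le by simp
  have 1: "ricci_on G H F D (Sp P) u (e j) = 0" if j: "j \<in> P" for j
  proof (rule linear_zero[OF N_sub u, where T = "\<lambda>u. ricci_on G H F D (Sp P) u (e j)"])
    have ej: "e j \<in> Sp P" using j P_le by simp
    fix x x' assume x: "x \<in> Sp N" and x': "x' \<in> Sp N"
    show "ricci_on G H F D (Sp P) (x + x') (e j) = ricci_on G H F D (Sp P) x (e j) + ricci_on G H F D (Sp P) x' (e j)"
      using x x' ej S
      by (simp add: formula R_add(2)[OF _ _ _ S[OF j]] Sp_S[OF x] Sp_S[OF x'] distrib_left sum.distrib)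
    fix f assume "f \<in> K"
    then show "ricci_on G H F D (Sp P) (sscale f x) (e j) = f * ricci_on G H F D (Sp P) x (e j)"
      using x ej S
      by (simp add: formula R_sscale(2) Sp_S[OF x] sum_distrib_left mult.left_commute)
  qed (use assms(1) j in simp)
  show ?thesis
  proof (rule linear_zero[OF P_sub y])
    fix x x' assume x: "x \<in> Sp P" and x': "x' \<in> Sp P"
    show "ricci_on G H F D (Sp P) u (x + x') = ricci_on G H F D (Sp P) u x + ricci_on G H F D (Sp P) u x'"
      using x x' u S
      by (simp add: formula R_add(3)[OF _ Sp_S[OF u]] Sp_S[OF x] Sp_S[OF x'] distrib_left sum.distrib)
    fix f assume "f \<in> K"
    then show "ricci_on G H F D (Sp P) u (sscale f x) = f * ricci_on G H F D (Sp P) u x"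
      using x u S
      by (simp add: formula R_sscale(3) Sp_S[OF x] Sp_S[OF u] sum_distrib_left mult.left_commute)
  qed (rule 1)
qed

end

section \<open>Existence of a Levi-Civita connection with prescribed divergence\<close>

lemma sum_swap_outer_inner:
  "(\<Sum>c\<in>I. \<Sum>a\<in>J. \<Sum>b\<in>I. g c a b) = (\<Sum>c\<in>I. \<Sum>a\<in>J. \<Sum>b\<in>I. g b a c)"
proof -
  have "(\<Sum>c\<in>I. \<Sum>a\<in>J. \<Sum>b\<in>I. g c a b) = (\<Sum>a\<in>J. \<Sum>c\<in>I. \<Sum>b\<in>I. g c a b)"
    by (rule sum.swap)
  also have "\<dots> = (\<Sum>a\<in>J. \<Sum>c\<in>I. \<Sum>b\<in>I. g b a c)"
    by (intro sum.cong refl sum.swap)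
  also have "\<dots> = (\<Sum>c\<in>I. \<Sum>a\<in>J. \<Sum>b\<in>I. g b a c)"
    by (rule sum.swap)
  finally show ?thesis .
qed

context courant_frame
begin

definition met :: "nat \<Rightarrow> nat \<Rightarrow> real" where "met A B = (if A = B then eta A else 0)"

text \<open>The mixed components are forced. A third of the structure constants solves the torsion
  equation on each of the two subbundles; the remaining term, whose cyclic sum vanishes, adjusts the
  trace to \<open>d\<close>. The denominators \<open>3\<close> and \<open>2\<close> are the ranks of the subbundles minus one.\<close>

definition gam :: "(nat \<Rightarrow> real) \<Rightarrow> nat \<Rightarrow> nat \<Rightarrow> nat \<Rightarrow> real" where
  "gam d A B C = (if (A \<le> 3) = (B \<le> 3) \<and> (B \<le> 3) = (C \<le> 3)
     then Bc A B C / 3 + (d B * met A C - d C * met A B) / (if A \<le> 3 then 3 else 2)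
     else if (B \<le> 3) = (C \<le> 3) then Bc A B C else 0)"

text \<open>The zeroth order part of the connection, as a component in direction \<open>e\<^sub>C\<close>; the first order part of
  \<open>conn\<close> differentiates coordinates.\<close>

definition conn_form :: "(nat \<Rightarrow> real) \<Rightarrow> 'g sect \<Rightarrow> 'g sect \<Rightarrow> nat \<Rightarrow> 'g \<Rightarrow> real" where
  "conn_form d u x C = (\<Sum>A\<in>{0..6}. \<Sum>B\<in>{0..6}.
     cst (eta A * eta B * gam d A B C) * (pairing u (e A) * pairing x (e B)))"

definition conn :: "(nat \<Rightarrow> real) \<Rightarrow> 'g sect \<Rightarrow> 'g sect \<Rightarrow> 'g sect" where
  "conn d u x = (\<Sum>C\<in>{0..6}.
     sscale (cst (eta C) * (fst u (pairing x (e C)) + conn_form d u x C)) (e C))"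

lemma gam_skew: "gam d A B C = - gam d A C B"
  using Bc_skew(2)[of A B C] by (auto simp: gam_def field_simps)

lemma gam_torsion: "gam d A B C - gam d B A C - Bc A B C + gam d C A B = 0"
proof -
  have B: "Bc B A C = - Bc A B C" "Bc C A B = Bc A B C"
    using Bc_skew(1)[of B A C] Bc_skew(1)[of C A B] Bc_skew(2)[of A C B] by simp_all
  have m: "met B A = met A B" "met C A = met A C" "met C B = met B C"
    by (simp_all add: met_def)
  show ?thesis
    by (cases "A \<le> 3"; cases "B \<le> 3"; cases "C \<le> 3") (simp_all add: gam_def B m field_simps)
qed

lemma gam_trace:
  assumes "j \<le> 6"
  shows "(\<Sum>A\<in>{0..6}. eta A * gam d A j A) = d j"
proof -
  have B: "Bc A k A = 0" for A k using Bc_skew(1)[of A k A] Bc_skew(2)[of k A A] by simp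
  have e: "eta A * (eta A * x) = x" if "A \<le> 6" for A x
    using eta_square[OF that] by (simp flip: mult.assoc)
  have cases: "j = 0 \<or> j = 1 \<or> j = 2 \<or> j = 3 \<or> j = 4 \<or> j = 5 \<or> j = 6" using assms by auto
  show ?thesis
    using cases unfolding nat_0_6
    by (elim disjE) (simp_all add: gam_def B met_def field_simps e)
qed

lemma conn_form_K [simp]: "u \<in> S \<Longrightarrow> x \<in> S \<Longrightarrow> conn_form d u x C \<in> K"
  unfolding conn_form_def by (intro K_sum K_mult K_cst pairing_K) simp_all

lemma conn_S [simp]: "u \<in> S \<Longrightarrow> x \<in> S \<Longrightarrow> conn d u x \<in> S"
  unfolding conn_def by (intro S_sum S_sscale K_mult K_add K_cst fst_K conn_form_K) simp_all

lemma pairing_conn: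
  assumes "u \<in> S" "x \<in> S" "C \<le> 6"
  shows "pairing (conn d u x) (e C) = fst u (pairing x (e C)) + conn_form d u x C"
proof -
  have "pairing (conn d u x) (e C)
      = cst (eta C) * (cst (eta C) * (fst u (pairing x (e C)) + conn_form d u x C))"
    unfolding conn_def using assms
    by (subst pairing_comb) (auto intro!: K_mult K_add fst_K)
  then show ?thesis
    using eta_square[OF assms(3)] by (simp add: fun_eq_iff flip: mult.assoc)
qed

lemma conn_form_linear:
  "u \<in> S \<Longrightarrow> u' \<in> S \<Longrightarrow> conn_form d (u + u') x C = conn_form d u x C + conn_form d u' x C"
  "u \<in> S \<Longrightarrow> u' \<in> S \<Longrightarrow> conn_form d x (u + u') C = conn_form d x u C + conn_form d x u' C"
  "u \<in> S \<Longrightarrow> f \<in> K \<Longrightarrow> conn_form d (sscale f u) x C = f * conn_form d u x C"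
  "u \<in> S \<Longrightarrow> f \<in> K \<Longrightarrow> conn_form d x (sscale f u) C = f * conn_form d x u C"
  unfolding conn_form_def
  by (simp_all add: distrib_left distrib_right sum.distrib sum_distrib_left mult_ac)

lemma conn_form_skew:
  assumes "u \<in> S" "x \<in> S" "y \<in> S"
  shows "(\<Sum>C\<in>{0..6}. cst (eta C) * (conn_form d u x C * pairing y (e C)))
    + (\<Sum>C\<in>{0..6}. cst (eta C) * (conn_form d u y C * pairing x (e C))) = 0"
proof -
  let ?g = "\<lambda>x y C A B. cst (eta C) * (cst (eta A * eta B * gam d A B C) *
    (pairing u (e A) * pairing x (e B)) * pairing y (e C))"
  have 1: "(\<Sum>C\<in>{0..6}. cst (eta C) * (conn_form d u x C * pairing y (e C)))
      = (\<Sum>C\<in>{0..6}. \<Sum>A\<in>{0..6}. \<Sum>B\<in>{0..6}. ?g x y C A B)" for x y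
    unfolding conn_form_def by (simp only: sum_distrib_left sum_distrib_right)
  have 2: "(\<Sum>C\<in>{0..6}. \<Sum>A\<in>{0..6}. \<Sum>B\<in>{0..6}. ?g y x C A B)
      = (\<Sum>C\<in>{0..6}. \<Sum>A\<in>{0..6}. \<Sum>B\<in>{0..6}. ?g y x B A C)"
    by (rule sum_swap_outer_inner)
  have 3: "?g x y C A B + ?g y x B A C = 0" for A B C
    using gam_skew[of d A B C] by (simp add: fun_eq_iff)
  show ?thesis
    unfolding 1 2 by (simp only: sum.distrib[symmetric] 3 sum.neutral_const)
qed

lemma fst_sum_apply: "fst (sum u I) f = (\<Sum>i\<in>I. fst (u i) f)" for u :: "nat \<Rightarrow> 'g sect"
  by (induction I rule: infinite_finite_induct) auto

lemma fst_expansion: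
  assumes "u \<in> S"
  shows "fst u f = (\<Sum>i\<in>{0..6}. cst (eta i) * pairing u (e i) * fst (e i) f)"
proof -
  have "fst u f = fst (\<Sum>i\<in>{0..6}. sscale (cst (eta i) * pairing u (e i)) (e i)) f"
    using expansion[of "{0..6}" u] assms by (simp add: Sp_full)
  also have "\<dots> = (\<Sum>i\<in>{0..6}. fst (sscale (cst (eta i) * pairing u (e i)) (e i)) f)"
    by (rule fst_sum_apply)
  also have "\<dots> = (\<Sum>i\<in>{0..6}. cst (eta i) * pairing u (e i) * fst (e i) f)"
    by (simp only: fst_sscale fscale_apply)
  finally show ?thesis .
qed

lemma conn_metric:
  assumes "u \<in> S" "x \<in> S" "y \<in> S"
  shows "fst u (pairing x y) = pairing (conn d u x) y + pairing x (conn d u y)"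
proof -
  have 1: "pairing (conn d u x) y = (\<Sum>C\<in>{0..6}. cst (eta C) * (fst u (pairing x (e C)) * pairing y (e C)))
      + (\<Sum>C\<in>{0..6}. cst (eta C) * (conn_form d u x C * pairing y (e C)))"
    if "x \<in> S" "y \<in> S" for x y
  proof -
    have "pairing (conn d u x) y = (\<Sum>C\<in>{0..6}. cst (eta C) * (pairing (conn d u x) (e C) * pairing y (e C)))"
      using assms that by (intro pairing_expansion) simp_all
    also have "\<dots> = (\<Sum>C\<in>{0..6}. cst (eta C) * (fst u (pairing x (e C)) * pairing y (e C))
        + cst (eta C) * (conn_form d u x C * pairing y (e C)))"
      using assms that by (intro sum.cong refl) (simp add: pairing_conn distrib_left distrib_right)
    finally show ?thesis by (simp only: sum.distrib)
  qed
  have "fst u (pairing x y) = (\<Sum>C\<in>{0..6}. fst u (cst (eta C) * (pairing x (e C) * pairing y (e C))))"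
    unfolding pairing_expansion[OF assms(2,3)]
    using assms by (intro fst_sum_K K_mult K_cst pairing_K) auto
  also have "\<dots> = (\<Sum>C\<in>{0..6}. cst (eta C) * (fst u (pairing x (e C)) * pairing y (e C))
      + cst (eta C) * (fst u (pairing y (e C)) * pairing x (e C)))"
    using assms by (intro sum.cong refl) (simp add: algebra_simps)
  finally have "fst u (pairing x y)
      = (\<Sum>C\<in>{0..6}. cst (eta C) * (fst u (pairing x (e C)) * pairing y (e C)))
      + (\<Sum>C\<in>{0..6}. cst (eta C) * (fst u (pairing y (e C)) * pairing x (e C)))"
    by (simp only: sum.distrib)
  then show ?thesis
    using conn_form_skew[OF assms, of d] 1[OF assms(2,3)] 1[OF assms(3,2)]
    by (simp only: pairing_commute[of x "conn d u y"]) (simp add: algebra_simps)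
qed

lemma conn_connection: "gen_connection G (conn d)"
proof -
  have 1: "conn d (u + u') x = conn d u x + conn d u' x" if "u \<in> S" "u' \<in> S" "x \<in> S" for u u' x
    using that by (intro S_eqI) (simp_all add: pairing_conn conn_form_linear algebra_simps)
  have 2: "conn d (sscale f u) x = sscale f (conn d u x)" if "f \<in> K" "u \<in> S" "x \<in> S" for f u x
    using that by (intro S_eqI) (simp_all add: pairing_conn conn_form_linear fscale_apply algebra_simps)
  have 3: "conn d u (x + x') = conn d u x + conn d u x'" if "u \<in> S" "x \<in> S" "x' \<in> S" for u x x'
    using that by (intro S_eqI) (simp_all add: pairing_conn conn_form_linear algebra_simps)
  have 4: "conn d u (sscale f x) = sscale (fst u f) x + sscale f (conn d u x)"
    if "f \<in> K" "u \<in> S" "x \<in> S" for f u x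
    using that by (intro S_eqI) (simp_all add: pairing_conn conn_form_linear algebra_simps)
  show ?thesis
    unfolding gen_connection_def
    by (intro conjI ballI; (rule conn_S 1 2 3 4 conn_metric; assumption))
qed

lemma conn_e:
  assumes "A \<le> 6" "B \<le> 6" "C \<le> 6"
  shows "pairing (conn d (e A) (e B)) (e C) = cst (gam d A B C)"
proof -
  have "conn_form d (e A) (e B) C = (\<Sum>A'\<in>{0..6}. \<Sum>B'\<in>{0..6}.
      cst (if A' = A then if B' = B then gam d A B C else 0 else 0))"
    unfolding conn_form_def
  proof (intro sum.cong refl)
    fix A' B' :: nat assume "A' \<in> {0..6}" "B' \<in> {0..6}"
    moreover have "eta A * eta B * gam d A B C * (eta A * eta B) = gam d A B C"
      using eta_square[OF assms(1)] eta_square[OF assms(2)] by algebra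
    ultimately show "cst (eta A' * eta B' * gam d A' B' C) * (pairing (e A) (e A') * pairing (e B) (e B'))
        = cst (if A' = A then if B' = B then gam d A B C else 0 else 0)"
      using assms by (auto simp: pairing_e cst_simps)
  qed
  then have "conn_form d (e A) (e B) C = cst (\<Sum>A'\<in>{0..6}. \<Sum>B'\<in>{0..6}.
      if A' = A then if B' = B then gam d A B C else 0 else 0)"
    by (simp only: sum_cst)
  moreover have "(\<Sum>A'\<in>{0..6}. \<Sum>B'\<in>{0..6}. if A' = A then if B' = B then gam d A B C else 0 else 0)
      = (\<Sum>A'\<in>{0..6}. if A' = A then \<Sum>B'\<in>{0..6}. if B' = B then gam d A B C else 0 else 0)"
    by (intro sum.cong refl) simp
  moreover have "\<dots> = gam d A B C" using assms by simp
  ultimately have "conn_form d (e A) (e B) C = cst (gam d A B C)" by (simp only:)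
  then show ?thesis
    using assms by (simp add: pairing_conn pairing_e)
qed

lemma conn_preserves:
  assumes "I = {0..3} \<or> I = {4..6}" "u \<in> S" "x \<in> Sp I"
  shows "conn d u x \<in> Sp I"
proof -
  have "pairing (conn d u x) (e C) = 0" if C: "C \<in> {0..6} - I" for C
  proof -
    have zero: "pairing x (e B) = 0" if "B \<in> {0..6} - I" for B
      using assms(3) that by (simp add: Sp_def del: Sp_S)
    have "gam d A B C = 0" if "B \<in> I" for A B
      using that C assms(1) by (auto simp: gam_def)
    then have "cst (eta A * eta B * gam d A B C) * (pairing u (e A) * pairing x (e B)) = 0"
      if "B \<in> {0..6}" for A B
      using zero[of B] that by (cases "B \<in> I") (auto simp: fun_eq_iff)
    then have "conn_form d u x C = 0"
      unfolding conn_form_def by (intro sum.neutral ballI) blast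
    then show ?thesis
      using C zero[OF C] assms(2) Sp_S[OF assms(3)] by (simp add: pairing_conn)
  qed
  then show ?thesis using assms(2) Sp_S[OF assms(3)] by (simp add: Sp_def del: Sp_S)
qed

text \<open>The torsion of every generalized connection is tensorial, so it is enough to look at the frame.\<close>

lemma conn_torsion:
  assumes "u \<in> S" "x \<in> S" "y \<in> S"
  shows "torsion G H F (conn d) u x y = 0"
proof -
  interpret courant_connection G v g F H \<epsilon> lam \<mu> \<nu> \<rho> h Fc "conn d"
    by unfold_locales (rule conn_connection)
  have full: "{0..6} \<subseteq> {0..6::nat}" by simp
  note T = torsion_tensorial
  have 0: "torsion G H F (conn d) (e A) (e B) (e C) = 0" if "A \<le> 6" "B \<le> 6" "C \<le> 6" for A B C
    using that gam_torsion[of d A B C]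
    by (simp add: torsion_def conn_e dorf_e pairing_commute[of "e B"] cst_simps zero_fun_def)
  have 1: "torsion G H F (conn d) (e A) (e B) y = 0" if "A \<le> 6" "B \<le> 6" "y \<in> S" for A B y
    by (rule linear_zero[OF full, where T = "\<lambda>y. torsion G H F (conn d) (e A) (e B) y"])
      (use that 0 in \<open>simp_all add: Sp_full T(3)[where f = 0] T(6)[where u' = 0]\<close>)
  have 2: "torsion G H F (conn d) (e A) x y = 0" if "A \<le> 6" "x \<in> S" "y \<in> S" for A x y
    by (rule linear_zero[OF full, where T = "\<lambda>x. torsion G H F (conn d) (e A) x y"])
      (use that 1 in \<open>simp_all add: Sp_full T(2)[where f = 0] T(5)[where u' = 0]\<close>)
  show ?thesis
    by (rule linear_zero[OF full, where T = "\<lambda>u. torsion G H F (conn d) u x y"])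
      (use assms 2 in \<open>simp_all add: Sp_full T(1)[where f = 0] T(4)[where u' = 0]\<close>)
qed

text \<open>Both sides satisfy the same Leibniz rule, so their difference is linear over the smooth
  functions and can be computed in the frame.\<close>

lemma conn_divergence:
  assumes "divergence_operator G \<delta>" "\<And>A. A \<le> 6 \<Longrightarrow> \<delta> (e A) = cst (d A)" "u \<in> S"
  shows "connection_divergence G (conn d) u = \<delta> u"
proof -
  interpret courant_connection G v g F H \<epsilon> lam \<mu> \<nu> \<rho> h Fc "conn d"
    by unfold_locales (rule conn_connection)
  have tr: "connection_divergence G (conn d) u = (\<Sum>i\<in>{0..6}. cst (eta i) * pairing (conn d (e i) u) (e i))"
    if "u \<in> S" for u
    unfolding connection_divergence_def Sp_full[symmetric]
    by (rule trace_Sp) (use that in \<open>simp_all add: Sp_full\<close>)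
  have "connection_divergence G (conn d) u - \<delta> u = 0"
  proof (rule linear_zero[where I = "{0..6}" and T = "\<lambda>u. connection_divergence G (conn d) u - \<delta> u"])
    fix x x' f assume x: "x \<in> Sp {0..6}" and x': "x' \<in> Sp {0..6}" and f: "f \<in> K"
    have S: "x \<in> S" "x' \<in> S" using x x' by (simp_all add: Sp_full)
    have "\<delta> (x + x') = \<delta> x + \<delta> x'" "\<delta> (sscale f x) = fst x f + f * \<delta> x"
      using assms(1) S f by (simp_all add: divergence_operator_def)
    moreover have "connection_divergence G (conn d) (sscale f x)
        = fst x f + f * connection_divergence G (conn d) x"
    proof -
      have "connection_divergence G (conn d) (sscale f x)
          = (\<Sum>i\<in>{0..6}. cst (eta i) * pairing x (e i) * fst (e i) f
            + f * (cst (eta i) * pairing (conn d (e i) x) (e i)))"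
        using S f by (simp add: tr) (intro sum.cong refl, simp add: algebra_simps)
      also have "\<dots> = fst x f + f * connection_divergence G (conn d) x"
        by (simp only: sum.distrib sum_distrib_left[symmetric] fst_expansion[OF S(1), of f] tr[OF S(1)])
      finally show ?thesis .
    qed
    ultimately show "connection_divergence G (conn d) (sscale f x) - \<delta> (sscale f x)
        = f * (connection_divergence G (conn d) x - \<delta> x)"
      by (simp add: algebra_simps)
  next
    fix x x' assume x: "x \<in> Sp {0..6}" and x': "x' \<in> Sp {0..6}"
    have S: "x \<in> S" "x' \<in> S" using x x' by (simp_all add: Sp_full)
    have "\<delta> (x + x') = \<delta> x + \<delta> x'"
      using assms(1) S by (simp add: divergence_operator_def)
    then show "connection_divergence G (conn d) (x + x') - \<delta> (x + x')
        = connection_divergence G (conn d) x - \<delta> x + (connection_divergence G (conn d) x' - \<delta> x')"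
      using S by (simp add: tr distrib_left sum.distrib)
  next
    fix i :: nat assume "i \<in> {0..6}"
    then show "connection_divergence G (conn d) (e i) - \<delta> (e i) = 0"
      using gam_trace[of i d] by (simp add: tr conn_e assms(2) cst_simps sum_cst)
  qed (use assms(3) in \<open>simp_all add: Sp_full\<close>)
  then show ?thesis by simp
qed

section \<open>The Einstein equations in components\<close>

text \<open>A metric connection that preserves a subbundle preserves its orthogonal complement.\<close>

lemma levi_civita_split:
  assumes "levi_civita G H F (E_minus G g) D"
  shows "split_connection G v g F H \<epsilon> lam \<mu> \<nu> \<rho> h Fc D {0..3} {4..6}"
    and "split_connection G v g F H \<epsilon> lam \<mu> \<nu> \<rho> h Fc D {4..6} {0..3}"
proof -
  interpret courant_connection G v g F H \<epsilon> lam \<mu> \<nu> \<rho> h Fc D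
    using assms by unfold_locales (simp add: levi_civita_def)
  have N: "D u x \<in> Sp {4..6}" if "u \<in> S" "x \<in> Sp {4..6}" for u x
    using assms that by (simp add: levi_civita_def E_minus_Sp)
  have P: "D u x \<in> Sp {0..3}" if u: "u \<in> S" and x: "x \<in> Sp {0..3}" for u x
  proof -
    have "pairing (D u x) (e A) = 0" if A: "A \<in> {0..6} - {0..3}" for A
    proof -
      have eA: "e A \<in> Sp {4..6}" using A by simp
      have "pairing x (e A) = 0" "pairing x (D u (e A)) = 0"
        using Sp_orthogonal[OF x eA] Sp_orthogonal[OF x N[OF u eA]] by simp_all
      then show ?thesis using D_metric[OF u Sp_S[OF x] Sp_S[OF eA]] u by simp
    qed
    then show ?thesis using u Sp_S[OF x] by (simp add: Sp_def del: Sp_S)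
  qed
  have T: "torsion G H F D u x y = 0" if "u \<in> S" "x \<in> S" "y \<in> S" for u x y
    using assms that by (simp add: levi_civita_def)
  have sets: "{0..3} \<union> {4..6} = {0..6::nat}" "{0..3} \<inter> {4..6} = ({} :: nat set)" by auto
  show "split_connection G v g F H \<epsilon> lam \<mu> \<nu> \<rho> h Fc D {0..3} {4..6}"
    "split_connection G v g F H \<epsilon> lam \<mu> \<nu> \<rho> h Fc D {4..6} {0..3}"
    using N P T sets by (unfold_locales; simp add: Un_commute Int_commute)+
qed

theorem generalized_einstein_iff:
  assumes "divergence_operator G \<delta>" "\<And>A. A \<le> 6 \<Longrightarrow> \<delta> (e A) = cst (d A)"
  shows "generalized_einstein G H F (E_minus G g) \<delta> \<longleftrightarrow>
    (\<forall>p\<in>{4..6}. \<forall>j\<in>{0..3}. Ric_plus d p j = 0 \<and> Ric_minus d j p = 0)"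
proof
  assume "generalized_einstein G H F (E_minus G g) \<delta>"
  then have "\<exists>D. levi_civita G H F (E_minus G g) D \<and> (\<forall>u\<in>S. connection_divergence G D u = \<delta> u) \<and>
      (\<forall>u\<in>Sp {4..6}. \<forall>y\<in>Sp {0..3}. ricci_on G H F D (Sp {0..3}) u y = 0) \<and>
      (\<forall>u\<in>Sp {0..3}. \<forall>y\<in>Sp {4..6}. ricci_on G H F D (Sp {4..6}) u y = 0)"
    unfolding generalized_einstein_def orth_compl_Sp E_minus_Sp[symmetric] .
  then obtain D where D: "levi_civita G H F (E_minus G g) D"
    "\<forall>u\<in>S. connection_divergence G D u = \<delta> u"
    "\<forall>u\<in>Sp {4..6}. \<forall>y\<in>Sp {0..3}. ricci_on G H F D (Sp {0..3}) u y = 0"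
    "\<forall>u\<in>Sp {0..3}. \<forall>y\<in>Sp {4..6}. ricci_on G H F D (Sp {4..6}) u y = 0"
    by (elim exE conjE) (rule that)
  interpret plus: split_connection G v g F H \<epsilon> lam \<mu> \<nu> \<rho> h Fc D "{0..3}" "{4..6}"
    by (rule levi_civita_split(1)[OF D(1)])
  interpret minus: split_connection G v g F H \<epsilon> lam \<mu> \<nu> \<rho> h Fc D "{4..6}" "{0..3}"
    by (rule levi_civita_split(2)[OF D(1)])
  have div: "connection_divergence G D (e j) = cst (d j)" if "j \<le> 6" for j
    using D(2) assms(2) that by simp
  show "\<forall>p\<in>{4..6}. \<forall>j\<in>{0..3}. Ric_plus d p j = 0 \<and> Ric_minus d j p = 0"
  proof (intro ballI)
    fix p j :: nat assume p: "p \<in> {4..6}" and j: "j \<in> {0..3}"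
    have e: "e p \<in> Sp {4..6}" "e j \<in> Sp {0..3}" using p j by simp_all
    have "cst (Ric_plus d p j) = (0 :: 'g \<Rightarrow> real)"
      using plus.ricci_e[of d p j] D(3) div p j e by simp
    moreover have "cst (Ric_minus d j p) = (0 :: 'g \<Rightarrow> real)"
      using minus.ricci_e[of d j p] D(4) div p j e by simp
    ultimately show "Ric_plus d p j = 0 \<and> Ric_minus d j p = 0"
      by (simp add: fun_eq_iff)
  qed
next
  assume ric: "\<forall>p\<in>{4..6}. \<forall>j\<in>{0..3}. Ric_plus d p j = 0 \<and> Ric_minus d j p = 0"
  have lc: "levi_civita G H F (E_minus G g) (conn d)"
    unfolding levi_civita_def E_minus_Sp
    using conn_connection conn_torsion conn_preserves by blast
  have div: "connection_divergence G (conn d) u = \<delta> u" if "u \<in> S" for u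
    using conn_divergence[OF assms that] .
  interpret plus: split_connection G v g F H \<epsilon> lam \<mu> \<nu> \<rho> h Fc "conn d" "{0..3}" "{4..6}"
    by (rule levi_civita_split(1)[OF lc])
  interpret minus: split_connection G v g F H \<epsilon> lam \<mu> \<nu> \<rho> h Fc "conn d" "{4..6}" "{0..3}"
    by (rule levi_civita_split(2)[OF lc])
  have dive: "connection_divergence G (conn d) (e j) = cst (d j)" if "j \<le> 6" for j
    using div[of "e j"] assms(2) that by simp
  have plus: "ricci_on G H F (conn d) (Sp {0..3}) u y = 0" if "u \<in> Sp {4..6}" "y \<in> Sp {0..3}" for u y
  proof (rule plus.ricci_zero[OF _ that])
    fix p j :: nat assume "p \<in> {4..6}" "j \<in> {0..3}"
    then show "ricci_on G H F (conn d) (Sp {0..3}) (e p) (e j) = 0"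
      using plus.ricci_e[of d p j] dive ric by (simp add: fun_eq_iff)
  qed
  have minus: "ricci_on G H F (conn d) (Sp {4..6}) u y = 0" if "u \<in> Sp {0..3}" "y \<in> Sp {4..6}" for u y
  proof (rule minus.ricci_zero[OF _ that])
    fix p j :: nat assume "p \<in> {0..3}" "j \<in> {4..6}"
    then show "ricci_on G H F (conn d) (Sp {4..6}) (e p) (e j) = 0"
      using minus.ricci_e[of d p j] dive ric by (simp add: fun_eq_iff)
  qed
  show "generalized_einstein G H F (E_minus G g) \<delta>"
    unfolding generalized_einstein_def orth_compl_Sp
  proof (intro exI conjI ballI)
    show "levi_civita G H F (E_minus G g) (conn d)" by (rule lc)
  qed (unfold E_minus_Sp, (rule div plus minus; assumption)+)
qed

end

section \<open>The algebraic classification\<close>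

text \<open>The arguments are the structure constants, the signs \<open>\<epsilon>\<^sub>1\<close> and \<open>\<epsilon>\<^sub>3\<close>, and \<open>h\<close>, \<open>a = F\<^sub>1\<^sub>2\<close>, \<open>b = F\<^sub>2\<^sub>3\<close> and \<open>\<delta>\<close>.
  The equations are the vanishing of the components of the Ricci tensors, after dropping the factor
  \<open>\<epsilon>\<^sub>2\<close>, using \<open>\<delta>\<^sub>5 = \<delta>\<^sub>2\<close> and forming combinations that make the symmetry under the interchange of
  \<open>v\<^sub>1\<close> and \<open>v\<^sub>3\<close> visible.\<close>

definition einstein_system ::
    "real \<Rightarrow> real \<Rightarrow> real \<Rightarrow> real \<Rightarrow> real \<Rightarrow> real \<Rightarrow> real \<Rightarrow> real \<Rightarrow> real \<Rightarrow> (nat \<Rightarrow> real) \<Rightarrow> bool" where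
  "einstein_system l m n r e1 e3 h a b d \<longleftrightarrow>
     d 5 = d 2 \<and>
     a * (d 2 + e1 * l) = e3 * (n + h) * b \<and>
     b * (d 2 + e3 * r) = e1 * (m - h) * a \<and>
     2 * a\<^sup>2 = 2 * l * d 2 + e3 * (n\<^sup>2 - m\<^sup>2 - h\<^sup>2) \<and>
     2 * b\<^sup>2 = 2 * r * d 2 + e1 * (m\<^sup>2 - n\<^sup>2 - h\<^sup>2) \<and>
     2 * (l\<^sup>2 + r\<^sup>2) + e1 * e3 * ((m + n)\<^sup>2 + h\<^sup>2) + 2 * (e1 * a\<^sup>2 + e3 * b\<^sup>2) = 0 \<and>
     h * (e1 * l + e3 * r + d 2) = 0 \<and>
     2 * a * b = e1 * l * (n - m) + e3 * r * (m - n) - d 2 * (m + n) \<and>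
     e1 * l * d 1 + e3 * n * d 3 = 0 \<and> e1 * m * d 1 + e3 * r * d 3 = 0 \<and>
     e1 * a * d 1 = e3 * b * d 3 \<and>
     2 * a * d 0 = e3 * (m - n + h) * d 3 \<and> 2 * b * d 0 = e1 * (m - n + h) * d 1 \<and>
     (m - n - h) * d 4 = 0 \<and> (m - n - h) * d 6 = 0 \<and>
     e1 * l * d 4 + e3 * n * d 6 = 0 \<and> e1 * m * d 4 + e3 * r * d 6 = 0 \<and>
     e1 * a * d 4 = e3 * b * d 6"

lemma einstein_systemD:
  assumes "einstein_system l m n r e1 e3 h a b d"
  shows
    "d 5 = d 2"
    "a * (d 2 + e1 * l) = e3 * (n + h) * b"
    "b * (d 2 + e3 * r) = e1 * (m - h) * a"
    "2 * a\<^sup>2 = 2 * l * d 2 + e3 * (n\<^sup>2 - m\<^sup>2 - h\<^sup>2)"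
    "2 * b\<^sup>2 = 2 * r * d 2 + e1 * (m\<^sup>2 - n\<^sup>2 - h\<^sup>2)"
    "2 * (l\<^sup>2 + r\<^sup>2) + e1 * e3 * ((m + n)\<^sup>2 + h\<^sup>2) + 2 * (e1 * a\<^sup>2 + e3 * b\<^sup>2) = 0"
    "h * (e1 * l + e3 * r + d 2) = 0"
    "2 * a * b = e1 * l * (n - m) + e3 * r * (m - n) - d 2 * (m + n)"
    "e1 * l * d 1 + e3 * n * d 3 = 0" "e1 * m * d 1 + e3 * r * d 3 = 0"
    "e1 * a * d 1 = e3 * b * d 3"
    "2 * a * d 0 = e3 * (m - n + h) * d 3" "2 * b * d 0 = e1 * (m - n + h) * d 1"
    "(m - n - h) * d 4 = 0" "(m - n - h) * d 6 = 0"
    "e1 * l * d 4 + e3 * n * d 6 = 0" "e1 * m * d 4 + e3 * r * d 6 = 0"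
    "e1 * a * d 4 = e3 * b * d 6"
  using assms unfolding einstein_system_def by blast+

lemma swap13_simps [simp]:
  "swap13 (Suc 0) = 3" "swap13 2 = 2" "swap13 3 = 1"
  by (simp_all add: Transposition.transpose_def)

lemma swap13_46_simps:
  "swap13_46 0 = 0" "swap13_46 1 = 3" "swap13_46 2 = 2" "swap13_46 3 = 1"
  "swap13_46 4 = 6" "swap13_46 5 = 5" "swap13_46 6 = 4"
  by (simp_all add: Transposition.transpose_def)

lemma einstein_system_swap:
  assumes "einstein_system l m n r e1 e3 h a b d"
  shows "einstein_system r n m l e3 e1 (- h) (- b) (- a) (d \<circ> swap13_46)"
proof -
  let ?d = "d \<circ> swap13_46"
  have d: "?d 0 = d 0" "?d 1 = d 3" "?d 2 = d 2" "?d 3 = d 1" "?d 4 = d 6" "?d 5 = d 5" "?d 6 = d 4"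
    by (simp_all only: o_apply[of d] swap13_46_simps)
  note D = einstein_systemD[OF assms]
  show ?thesis
    unfolding einstein_system_def d
  proof (intro conjI, goal_cases)
    case 1 show ?case by (rule D(1))
  next
    case 2 show ?case using D(3) by algebra
  next
    case 3 show ?case using D(2) by algebra
  next
    case 4 show ?case using D(5) by algebra
  next
    case 5 show ?case using D(4) by algebra
  next
    case 6 show ?case using D(6) by algebra
  next
    case 7 show ?case using D(7) by algebra
  next
    case 8 show ?case using D(8) by algebra
  next
    case 9 show ?case using D(10) by algebra
  next
    case 10 show ?case using D(9) by algebra
  next
    case 11 show ?case using D(11) by algebra
  next
    case 12 show ?case using D(13) by algebra
  next
    case 13 show ?case using D(12) by algebra
  next
    case 14 show ?case using D(15) by algebra
  next
    case 15 show ?case using D(14) by algebra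
  next
    case 16 show ?case using D(17) by algebra
  next
    case 17 show ?case using D(16) by algebra
  next
    case 18 show ?case using D(18) by algebra
  qed
qed

text \<open>The solutions to be classified. By \<open>swapped\<close> below, the interchange of \<open>v\<^sub>1\<close> and \<open>v\<^sub>3\<close> gives another
  solution, so each lemma about this locale also settles the interchanged case.\<close>

locale einstein_algebra =
  fixes l m n r h :: real and \<epsilon> :: "nat \<Rightarrow> real" and F :: "nat \<Rightarrow> nat \<Rightarrow> real" and d :: "nat \<Rightarrow> real"
  assumes sys: "einstein_system l m n r (\<epsilon> 1) (\<epsilon> 3) h (F 1 2) (F 2 3) d"
    and F13: "F 1 3 = 0" and F_skew: "F 2 1 = - F 1 2" "F 3 2 = - F 2 3" "F 3 1 = 0"
    and eps: "\<epsilon> 1 \<in> {-1, 1}" "\<epsilon> 3 \<in> {-1, 1}"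
    and trace: "\<epsilon> 1 * l + \<epsilon> 3 * r \<noteq> 0"
    and F_nonzero: "F 1 2 \<noteq> 0 \<or> F 2 3 \<noteq> 0"
begin

abbreviation e1 where "e1 \<equiv> \<epsilon> 1"
abbreviation e3 where "e3 \<equiv> \<epsilon> 3"
abbreviation a where "a \<equiv> F 1 2"
abbreviation b where "b \<equiv> F 2 3"

lemma sq: "e1 * e1 = 1" "e3 * e3 = 1"
  using eps by auto

lemmas E = einstein_systemD(1-8)[OF sys] and L = einstein_systemD(9-18)[OF sys]

lemma swapped: "einstein_algebra r n m l (- h) (\<epsilon> \<circ> swap13) (\<lambda>i j. F (swap13 i) (swap13 j)) (d \<circ> swap13_46)"
proof
  show "einstein_system r n m l ((\<epsilon> \<circ> swap13) 1) ((\<epsilon> \<circ> swap13) 3) (- h)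
      (F (swap13 1) (swap13 2)) (F (swap13 2) (swap13 3)) (d \<circ> swap13_46)"
    using einstein_system_swap[OF sys] F_skew by simp
qed (use F13 F_skew eps trace F_nonzero in auto)

lemma eps_nz: "e1 \<noteq> 0" "e3 \<noteq> 0"
  using eps by auto

text \<open>The pairs \<open>(\<epsilon>\<^sub>1 \<delta>\<^sub>1, \<epsilon>\<^sub>3 \<delta>\<^sub>3)\<close> and \<open>(\<epsilon>\<^sub>1 \<delta>\<^sub>4, \<epsilon>\<^sub>3 \<delta>\<^sub>6)\<close> lie in the kernel of a \<open>2 \<times> 2\<close> matrix of
  determinant \<open>\<lambda> \<rho> - \<mu> \<nu>\<close>; then \<open>\<delta>\<^sub>0 F = 0\<close> with \<open>F \<noteq> 0\<close>.\<close>

lemma delta_zero: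
  assumes "l * r \<noteq> m * n"
  shows "d 0 = 0" "d 1 = 0" "d 3 = 0" "d 4 = 0" "d 6 = 0"
proof -
  have *: "x = 0 \<and> y = 0" if "e1 * l * x + e3 * n * y = 0" "e1 * m * x + e3 * r * y = 0" for x y
  proof -
    have "(l * r - m * n) * (e1 * x) = 0" "(l * r - m * n) * (e3 * y) = 0" using that by algebra+
    then show ?thesis using assms eps_nz by simp
  qed
  show "d 1 = 0" "d 3 = 0" "d 4 = 0" "d 6 = 0"
    using *[OF L(1,2)] *[OF L(8,9)] by simp_all
  then show "d 0 = 0" using L(4,5) F_nonzero by auto
qed

text \<open>After eliminating \<open>\<delta>\<^sub>2\<close>, the two equations linear in \<open>a\<close> and \<open>b\<close> have a nonzero solution, so their
  determinant vanishes. This turns the quadratic equations into values of \<open>a\<^sup>2\<close> and \<open>b\<^sup>2\<close>, and the trace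
  equation into a product.\<close>

lemma parallel_squares:
  assumes d2: "d 2 = - (e1 * l + e3 * r)"
  shows "r * a + (n + h) * b = 0" "l * b + (m - h) * a = 0" "l * r = (n + h) * (m - h)"
    "2 * a\<^sup>2 = - 2 * e1 * l\<^sup>2 - 2 * e3 * m\<^sup>2 + e3 * (n - m + h)\<^sup>2"
    "2 * b\<^sup>2 = - 2 * e3 * r\<^sup>2 - 2 * e1 * n\<^sup>2 + e1 * (n - m + h)\<^sup>2"
    "(n - m + h) * (3 * (n - m + h) + 2 * (m - n)) = 0"
proof -
  show 1: "r * a + (n + h) * b = 0" using E(2) d2 sq by algebra
  show 2: "l * b + (m - h) * a = 0" using E(3) d2 sq by algebra
  have "(l * r - (n + h) * (m - h)) * a = 0" "(l * r - (n + h) * (m - h)) * b = 0"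
    using 1 2 by algebra+
  then show 3: "l * r = (n + h) * (m - h)" using F_nonzero by auto
  show 4: "2 * a\<^sup>2 = - 2 * e1 * l\<^sup>2 - 2 * e3 * m\<^sup>2 + e3 * (n - m + h)\<^sup>2"
    using E(4) 3 d2 by algebra
  show 5: "2 * b\<^sup>2 = - 2 * e3 * r\<^sup>2 - 2 * e1 * n\<^sup>2 + e1 * (n - m + h)\<^sup>2"
    using E(5) 3 d2 by algebra
  have "e1 * e3 * ((n - m + h) * (3 * (n - m + h) + 2 * (m - n))) = 0"
    using E(6) 4 5 sq by algebra
  then show "(n - m + h) * (3 * (n - m + h) + 2 * (m - n)) = 0" using eps_nz by simp
qed

lemma class7I:
  assumes "h = 0" "m \<noteq> 0" "n \<noteq> 0" "a \<noteq> 0" "b \<noteq> 0"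
    and "d 0 = 0" "d 1 = 0" "d 3 = 0" "d 4 = 0" "d 6 = 0"
  shows "class7 l m n r \<epsilon> h F d"
proof -
  have "a * e3 * (d 2 + e1 * l) = b * n" "a * m = b * e1 * (e3 * r + d 2)"
    using E(2,3) assms(1) sq by algebra+
  moreover have "a\<^sup>2 = e3 / 2 * (n\<^sup>2 - m\<^sup>2) + d 2 * l" "b\<^sup>2 = e1 / 2 * (m\<^sup>2 - n\<^sup>2) + d 2 * r"
    using E(4,5) assms(1) by (simp_all add: field_simps)
  moreover have "a * b = e1 / 2 * l * (n - m) + e3 / 2 * r * (m - n) - d 2 / 2 * (m + n)"
    using E(8) by (simp add: field_simps)
  moreover have "2 * (d 2 * (e1 * l + e3 * r)) = 2 * (- l\<^sup>2 - r\<^sup>2) - e1 * e3 * (m + n)\<^sup>2"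
    using E(4,5,6) assms(1) sq by algebra
  then have "d 2 * (e1 * l + e3 * r) = - l\<^sup>2 - e1 * e3 / 2 * (m + n)\<^sup>2 - r\<^sup>2"
    by (simp add: field_simps)
  ultimately show ?thesis
    unfolding class7_def using assms E(1) F13 trace by auto
qed

text \<open>Here \<open>\<lambda> \<rho> = \<mu> \<nu>\<close> and \<open>b\<close> is a multiple of \<open>a\<close>. Class 3 leaves out the case in which \<open>\<delta>\<^sub>1 = \<delta>\<^sub>4 = 0\<close>, \<open>\<mu> = \<nu>\<close>
  and \<open>\<rho> \<noteq> 0\<close>, and this case belongs to class 7.\<close>

lemma class3_or_7I:
  assumes d2: "d 2 = - (e1 * l + e3 * r)" and h: "h = m - n" and l: "l \<noteq> 0" and n: "n \<noteq> 0"
  shows "class3 l m n r \<epsilon> h F d \<or> class7 l m n r \<epsilon> h F d"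
proof -
  have 1: "r * a + m * b = 0" "l * b + n * a = 0" and lr: "l * r = m * n"
    and a2: "a\<^sup>2 = - (e1 * l\<^sup>2 + e3 * m\<^sup>2)"
    using parallel_squares(1-4)[OF d2] h by (simp_all add: algebra_simps)
  have a: "a \<noteq> 0"
  proof
    assume "a = 0"
    then have "b = 0" using 1 l by simp
    then show False using \<open>a = 0\<close> F_nonzero by simp
  qed
  have b: "b = - (n / l) * a" using 1 l by (simp add: field_simps eq_neg_iff_add_eq_0)
  have neg: "e1 * l\<^sup>2 + e3 * m\<^sup>2 < 0" using a2 a by (metis neg_0_less_iff_less zero_less_power2)
  have "n * d 3 = - e1 * e3 * l * d 1" "n * d 6 = - e1 * e3 * l * d 4"
    using L(1,8) sq by algebra+
  then have d36: "d 3 = - e1 * e3 * (l / n) * d 1" "d 6 = - e1 * e3 * (l / n) * d 4"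
    using n by (simp_all add: field_simps)
  have "n * (d 0 * a) = e1 * l * d 1 * (n - m)"
    using L(1,4) h sq by algebra
  then have d0: "d 0 * a = e1 * (l / n) * d 1 * (n - m)"
    using n by (simp add: field_simps)
  show ?thesis
  proof (cases "d 1 = 0 \<and> d 4 = 0 \<and> (m - n) * r = 0 \<and> r \<noteq> 0")
    case True
    then have z: "d 0 = 0" "d 1 = 0" "d 3 = 0" "d 4 = 0" "d 6 = 0" using d36 d0 a by auto
    have "m = n" using True by auto
    then have "class7 l m n r \<epsilon> h F d" using z h n a b l by (intro class7I) auto
    then show ?thesis ..
  next
    case False
    have "m = 0 \<and> e1 = -1" if "r = 0"
    proof -
      have "m = 0" using lr that n by simp
      then have "e1 * l\<^sup>2 < 0" using neg by simp
      then show ?thesis using \<open>m = 0\<close> eps by (auto simp: not_less)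
    qed
    then have "class3 l m n r \<epsilon> h F d"
      unfolding class3_def using False l n trace neg lr h b a2 F13 d0 d2 E(1) d36 a
      by (cases "d 1 = d 4"; cases "d 1 = 0") auto
    then show ?thesis ..
  qed
qed

lemma class1I:
  assumes d2: "d 2 = - (e1 * l + e3 * r)" and h: "h = m - n" and "r = 0" "n = 0"
  shows "class1 l m n r \<epsilon> h F d"
proof -
  have l: "l \<noteq> 0" using trace assms(3) by simp
  have "l * b = 0" and a2: "a\<^sup>2 = - (e1 * l\<^sup>2 + e3 * m\<^sup>2)"
    using parallel_squares(2,4)[OF d2] assms by (simp_all add: algebra_simps)
  then have b: "b = 0" using l by simp
  then have "0 < a\<^sup>2" using F_nonzero by simp
  then have "- (e1 * l\<^sup>2 + e3 * m\<^sup>2) > 0" using a2 by linarith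
  moreover have "d 0 * a = e3 * m * d 3" using L(4) assms(4) h by (simp add: algebra_simps)
  moreover have "d 1 = 0" "d 4 = 0" using L(1,8) assms(4) l eps_nz by simp_all
  ultimately show ?thesis
    unfolding class1_def using l b a2 assms F13 E(1) by simp
qed

lemma classes_parallel:
  assumes d2: "d 2 = - (e1 * l + e3 * r)" and h: "h = m - n" and n: "l * n \<noteq> 0 \<or> r = 0 \<and> n = 0"
  shows "in_classes l m n r \<epsilon> h F d"
  using class3_or_7I[OF d2 h] class1I[OF d2 h] n unfolding in_classes_def by auto

text \<open>In terms of \<open>p = \<mu> - h\<close> and \<open>q = \<nu> + h\<close> the equations imply
  \<open>\<lambda> \<rho> = p q\<close> and \<open>(p\<^sup>2 - q\<^sup>2) (\<epsilon>\<^sub>1 \<lambda>\<^sup>2 + \<epsilon>\<^sub>3 p\<^sup>2) = 0\<close>. Class 2 arises if \<open>p = 0\<close>,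
  and class 5 otherwise.\<close>

lemma classes_third:
  assumes d2: "d 2 = - (e1 * l + e3 * r)" and h: "3 * h = m - n" "h \<noteq> 0" and q: "m + 2 * n \<noteq> 0"
  shows "in_classes l m n r \<epsilon> h F d"
proof -
  define p q where "p = m - h" and "q = n + h"
  have m: "m = 2 * p - q" and n': "n = 2 * q - p" and hpq: "h = p - q"
    using h by (simp_all add: p_def q_def)
  have pq: "p \<noteq> q" "q \<noteq> 0" using h(2) q by (auto simp: hpq m n')
  note par = parallel_squares[OF d2, unfolded m n' hpq]
  have 1: "r * a + q * b = 0" "l * b + p * a = 0" and lr: "l * r = p * q"
    and a2: "a\<^sup>2 = - e1 * l\<^sup>2 + e3 * (q\<^sup>2 - 2 * p\<^sup>2)" and b2: "b\<^sup>2 = - e3 * r\<^sup>2 + e1 * (p\<^sup>2 - 2 * q\<^sup>2)"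
    using par(1-5) by algebra+
  have "l * r \<noteq> m * n"
  proof
    assume "l * r = m * n"
    then have "(p - q)\<^sup>2 = 0" using lr m n' by algebra
    then show False using pq by simp
  qed
  note d0 = delta_zero[OF this]
  show ?thesis
  proof (cases "p = 0")
    case True
    have l0: "l = 0"
    proof (rule ccontr)
      assume "l \<noteq> 0"
      then have "b = 0" "r = 0" using 1 lr True by simp_all
      then have "e1 * (2 * q\<^sup>2) = 0" using b2 True by simp
      then show False using pq eps_nz by simp
    qed
    then have r: "r \<noteq> 0" using trace by simp
    have a2': "a\<^sup>2 = e3 * q\<^sup>2" using a2 True l0 by simp
    have a: "a \<noteq> 0" using 1(1) F_nonzero pq by auto
    then have "0 < e3 * q\<^sup>2" using a2' by (metis zero_less_power2)
    then have e3: "e3 = 1" using eps pq by (auto simp: not_less)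
    have "q\<^sup>2 * (b\<^sup>2 - r\<^sup>2) = 0" using 1(1) a2' e3 by algebra
    then have "b\<^sup>2 = r\<^sup>2" using pq by simp
    then have r2: "r\<^sup>2 = - e1 * q\<^sup>2" using b2 True e3 by (simp add: algebra_simps)
    have "e1 = -1"
    proof (rule ccontr)
      assume "e1 \<noteq> -1"
      then have "r\<^sup>2 = - (q\<^sup>2)" using r2 eps by auto
      then show False using r by (smt (verit) zero_le_power2 zero_eq_power2)
    qed
    have mq: "m = - q" "n = 2 * q" "h = - q" using True m n' hpq by simp_all
    have "r = m \<or> r = - m" using r2 \<open>e1 = -1\<close> mq by (simp add: power2_eq_iff) argo
    then obtain t where t: "t \<in> {-1, 1}" "r = t * m" by force
    have "a = m \<or> a = - m" using a2' e3 mq by (simp add: power2_eq_iff) argo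
    then obtain s where s: "s \<in> {-1, 1}" "a = s * m" by force
    have "q * (b - s * r) = 0" using 1(1) s(2) mq by algebra
    then have "b = s * r" using pq by simp
    then have "class2 l m n r \<epsilon> h F d"
      unfolding class2_def using s t l0 mq pq e3 \<open>e1 = -1\<close> F13 d0 d2 E(1) by auto
    then show ?thesis by (simp add: in_classes_def)
  next
    case p: False
    have l: "l \<noteq> 0" "r \<noteq> 0" using lr p pq by auto
    have a: "a \<noteq> 0"
    proof
      assume "a = 0"
      then show False using 1(2) l F_nonzero by simp
    qed
    have "(p\<^sup>2 - q\<^sup>2) * (e1 * l\<^sup>2 + e3 * p\<^sup>2) = 0"
      using 1(2) lr a2 b2 by algebra
    moreover have "p \<noteq> - q"
    proof
      assume pq': "p = - q"
      have "p * (4 * a\<^sup>2) = 0"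
        using E(8) d2 1(2) a2 m n' lr sq pq' by algebra
      then show False using p a by simp
    qed
    then have "p\<^sup>2 - q\<^sup>2 \<noteq> 0" using pq by (simp add: power2_eq_iff)
    ultimately have lp: "e1 * l\<^sup>2 + e3 * p\<^sup>2 = 0" by simp
    have e3: "e3 = - e1"
    proof (rule ccontr)
      assume "e3 \<noteq> - e1"
      then have "e1 * e3 = 1" using eps by auto
      then have "l\<^sup>2 + p\<^sup>2 = 0" using lp sq by algebra
      then show False using l by (simp add: sum_power2_eq_zero_iff)
    qed
    then have "l\<^sup>2 = p\<^sup>2" using lp eps_nz by simp
    then have "l = p \<or> l = - p" by (simp add: power2_eq_iff)
    then obtain s where s: "s \<in> {-1, 1}" "l = s * p" by force
    have ss: "s * s = 1" using s by auto
    have "p * (r - s * q) = 0" "p * (b + s * a) = 0" using lr 1(2) s(2) ss by algebra+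
    then have r: "r = s * q" "b = - s * a" using p by (simp_all add: eq_neg_iff_add_eq_0)
    have "3 * a\<^sup>2 = e1 * (m\<^sup>2 - n\<^sup>2)"
      using a2 s(2) e3 m n' ss by algebra
    moreover have "0 < a\<^sup>2" using a by simp
    ultimately have a3: "a\<^sup>2 = e1 / 3 * (m\<^sup>2 - n\<^sup>2)" "e1 * (m\<^sup>2 - n\<^sup>2) > 0"
      by linarith+
    have "d 2 = s * e1 / 3 * (n - m)"
      unfolding d2 e3 r(1) s(2) m n' by (simp add: field_simps)
    moreover have "l = s / 3 * (2 * m + n)" "r = s / 3 * (2 * n + m)" "h = 1 / 3 * (m - n)"
      using s(2) r(1) m n' hpq by simp_all
    moreover have "m + 2 * n \<noteq> 0" "n + 2 * m \<noteq> 0" using p pq m n' by simp_all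
    ultimately have "class5 l m n r \<epsilon> h F d"
      unfolding class5_def using s(1) a3 e3 r(2) d0 E(1) F13 by (intro bexI[of _ s]) auto
    then show ?thesis by (simp add: in_classes_def)
  qed
qed

text \<open>The equations give \<open>\<mu> = 0\<close> and \<open>\<nu>\<^sup>2 = - 2 \<lambda> \<rho>\<close>. Class 1a arises if \<open>\<nu> = 0\<close>, and class 1b otherwise.\<close>

lemma classes_h0_b0:
  assumes h: "h = 0" and b: "b = 0"
  shows "in_classes l m n r \<epsilon> h F d"
proof -
  have a: "a \<noteq> 0" using F_nonzero b by simp
  have d2: "d 2 = - e1 * l" using E(2) a b by (simp add: eq_neg_iff_add_eq_0)
  have m: "m = 0" using E(3) a b h eps_nz by simp
  have n2: "n\<^sup>2 = - 2 * l * r" using E(5) b d2 h m sq by algebra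
  show ?thesis
  proof (cases "n = 0")
    case True
    have "r\<^sup>2 = 0" using E(4,6) b d2 h m sq True by algebra
    then have "class1 l m n r \<epsilon> h F d" using d2 h m True by (intro class1I) simp_all
    then show ?thesis by (simp add: in_classes_def)
  next
    case n: False
    have "n * (2 * e1 * l - e3 * r) = 0" using E(8) b d2 m by algebra
    then have "e3 * r = 2 * e1 * l" using n by simp
    then have r: "r = 2 * e1 * e3 * l" using sq by algebra
    have n2': "n\<^sup>2 = - 4 * e1 * e3 * l\<^sup>2" using n2 r by algebra
    have e: "e3 = - e1"
    proof (rule ccontr)
      assume "e3 \<noteq> - e1"
      then have "e1 * e3 = 1" using eps by auto
      then have "n\<^sup>2 = - 4 * l\<^sup>2" using n2' by algebra
      then show False using n by (smt (verit) zero_le_power2 zero_eq_power2)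
    qed
    have a2: "a\<^sup>2 = 3 * e3 * l\<^sup>2" using E(4) d2 h m n2' e sq by algebra
    have "e3 = 1"
    proof (rule ccontr)
      assume "e3 \<noteq> 1"
      then have "a\<^sup>2 = - 3 * l\<^sup>2" using a2 eps by auto
      then show False using a by (smt (verit) zero_le_power2 zero_eq_power2)
    qed
    then have e1: "e1 = -1" using e by simp
    have r': "r = - 2 * l" using r \<open>e3 = 1\<close> e1 by simp
    have "n\<^sup>2 = (2 * l)\<^sup>2" using n2' \<open>e3 = 1\<close> e1 by (simp add: power_mult_distrib)
    then have "n = 2 * l \<or> n = - (2 * l)" by (simp only: power2_eq_iff)
    then obtain s where s: "s \<in> {-1, 1}" "n = 2 * s * l" by force
    have "a\<^sup>2 = (l * sqrt 3)\<^sup>2" using a2 \<open>e3 = 1\<close> by (simp add: power_mult_distrib)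
    then have "a = l * sqrt 3 \<or> a = - (l * sqrt 3)" by (simp only: power2_eq_iff)
    then obtain t where t: "t \<in> {-1, 1}" "a = t * l * sqrt 3" by force
    have z: "d 1 = 0" "d 4 = 0" using L(3,10) a b eps_nz by simp_all
    then have z': "d 3 = 0" "d 6 = 0" using L(1,8) n eps_nz by simp_all
    then have "d 0 = 0" using L(4) a by simp
    then have "class1 l m n r \<epsilon> h F d"
      unfolding class1_def using a t s r' m h b z z' e1 \<open>e3 = 1\<close> d2 E(1) F13
      by auto
    then show ?thesis by (simp add: in_classes_def)
  qed
qed

text \<open>The product of the equations for \<open>a\<^sup>2\<close> and \<open>b\<^sup>2\<close> is compared with the square of the equation for \<open>a b\<close>;
  this forces \<open>\<epsilon>\<^sub>3 = - \<epsilon>\<^sub>1\<close> and \<open>\<mu>\<^sup>2 = 4 \<lambda>\<^sup>2\<close>.\<close>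

lemma classes_h0_n0:
  assumes h: "h = 0" and n: "n = 0" and a: "a \<noteq> 0" and b: "b \<noteq> 0"
  shows "in_classes l m n r \<epsilon> h F d"
proof -
  have d2: "d 2 = - e1 * l" using E(2) a n h by (simp add: eq_neg_iff_add_eq_0)
  have ab: "2 * a * b = e3 * r * m" using E(8) d2 n by algebra
  then have rm: "r \<noteq> 0" "m \<noteq> 0" using a b by auto
  have a2: "2 * a\<^sup>2 = - 2 * e1 * l\<^sup>2 - e3 * m\<^sup>2" and b2: "2 * b\<^sup>2 = - 2 * e1 * l * r + e1 * m\<^sup>2"
    using E(4,5) d2 n h by algebra+
  have q: "2 * r\<^sup>2 - 2 * e1 * e3 * l * r + e1 * e3 * m\<^sup>2 = 0"
    using E(6) a2 b2 n h sq by algebra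
  have "r\<^sup>2 * (4 * e1 * e3 * l\<^sup>2 + m\<^sup>2) = 0"
    using ab a2 b2 q sq by algebra
  then have m2: "m\<^sup>2 = - 4 * e1 * e3 * l\<^sup>2" using rm by simp
  have e: "e3 = - e1"
  proof (rule ccontr)
    assume "e3 \<noteq> - e1"
    then have "e1 * e3 = 1" using eps by auto
    then have "m\<^sup>2 = - 4 * l\<^sup>2" using m2 by algebra
    then show False using rm by (smt (verit) zero_le_power2 zero_eq_power2)
  qed
  have "(r - l) * (r + 2 * l) = 0" using q m2 e sq by algebra
  moreover have "r \<noteq> l" using trace e by (auto simp: algebra_simps)
  ultimately have r: "r = - 2 * l" by simp
  have "b\<^sup>2 = 4 * e1 * l\<^sup>2" using b2 r m2 e sq by algebra
  have e1: "e1 = 1"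
  proof (rule ccontr)
    assume "e1 \<noteq> 1"
    then have "b\<^sup>2 = - 4 * l\<^sup>2" using \<open>b\<^sup>2 = 4 * e1 * l\<^sup>2\<close> eps by auto
    then show False using b by (smt (verit) zero_le_power2 zero_eq_power2)
  qed
  have "m\<^sup>2 = (2 * l)\<^sup>2" using m2 e e1 by (simp add: power_mult_distrib)
  then have "m = 2 * l \<or> m = - (2 * l)" by (simp only: power2_eq_iff)
  then obtain s where s: "s \<in> {-1, 1}" "m = 2 * s * l" by force
  have ss: "s * s = 1" using s by auto
  have "a\<^sup>2 = l\<^sup>2" using a2 m2 e e1 by (simp add: algebra_simps)
  then have "a = l \<or> a = - l" by (simp only: power2_eq_iff)
  then obtain t where t: "t \<in> {-1, 1}" "a = t * l" by force
  have tt: "t * t = 1" using t by auto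
  have "l * (b - 2 * s * t * l) = 0" using ab t(2) s(2) r e e1 tt by algebra
  moreover have "l \<noteq> 0" using rm r by simp
  ultimately have b': "b = 2 * s * t * l" by simp
  have "l * r \<noteq> m * n" using n rm r by simp
  note z = delta_zero[OF this]
  have "class6 l m n r \<epsilon> h F d"
    unfolding class6_def using s t b' r rm n e e1 h F13 z d2 E(1) by auto
  then show ?thesis by (simp add: in_classes_def)
qed

text \<open>If one of \<open>\<delta>\<^sub>1, \<delta>\<^sub>3, \<delta>\<^sub>4, \<delta>\<^sub>6\<close> is nonzero, then \<open>\<lambda> \<rho> = \<mu> \<nu>\<close> and \<open>a \<nu> + b \<lambda> = 0\<close>. Eliminating \<open>\<delta>\<^sub>2\<close> leaves
  \<open>(\<nu> - \<mu>) (\<epsilon>\<^sub>1 \<lambda>\<^sup>2 + \<epsilon>\<^sub>3 \<nu>\<^sup>2) = 0\<close>, and the second factor can only vanish if \<open>\<mu> = \<nu>\<close>.\<close>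

lemma classes_h0_generic:
  assumes h: "h = 0" and m: "m \<noteq> 0" and n: "n \<noteq> 0" and a: "a \<noteq> 0" and b: "b \<noteq> 0"
  shows "in_classes l m n r \<epsilon> h F d"
proof (cases "d 1 = 0 \<and> d 3 = 0 \<and> d 4 = 0 \<and> d 6 = 0")
  case True
  moreover have "d 0 = 0" using True L(4) a by simp
  ultimately have "class7 l m n r \<epsilon> h F d" using assms by (intro class7I) auto
  then show ?thesis by (simp add: in_classes_def)
next
  case False
  then have lr: "l * r = m * n" using delta_zero by blast
  have l: "l \<noteq> 0" using lr m n by auto
  have *: "x = 0 \<and> y = 0 \<or> a * n + b * l = 0"
    if "e1 * l * x + e3 * n * y = 0" "e1 * a * x = e3 * b * y" for x y
  proof -
    have "(a * n + b * l) * (e1 * x) = 0" "(a * n + b * l) * (e3 * y) = 0" using that by algebra+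
    then show ?thesis using eps_nz by auto
  qed
  have anbl: "a * n + b * l = 0" using *[OF L(1,3)] *[OF L(8,10)] False by blast
  have "a * (l * (d 2 + e1 * l) + e3 * n\<^sup>2) = 0" using E(2) anbl h by algebra
  then have i: "l * (d 2 + e1 * l) = - e3 * n\<^sup>2" using a by simp
  have "a * (n * (d 2 + e3 * r) + e1 * m * l) = 0" using E(3) anbl h by algebra
  then have ii: "n * (d 2 + e3 * r) = - e1 * m * l" using a by simp
  have mn: "m = n"
  proof (rule ccontr)
    assume "m \<noteq> n"
    have "(n - m) * (e1 * l\<^sup>2 + e3 * n\<^sup>2) = 0" using i ii lr by algebra
    then have z: "e1 * l\<^sup>2 + e3 * n\<^sup>2 = 0" using \<open>m \<noteq> n\<close> by simp
    then have "l * d 2 = 0" using i by algebra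
    then have d2: "d 2 = 0" using l by simp
    have n2: "n\<^sup>2 = - e1 * e3 * l\<^sup>2" using z sq by algebra
    have "l\<^sup>2 * (r\<^sup>2 + e1 * e3 * m\<^sup>2) = 0" using lr n2 by algebra
    then have r2: "r\<^sup>2 = - e1 * e3 * m\<^sup>2" using l by simp
    have l2: "l\<^sup>2 = - e1 * e3 * n\<^sup>2" using z sq by algebra
    have "2 * (l\<^sup>2 + r\<^sup>2) + e1 * e3 * (m + n)\<^sup>2 = 0" using E(4,5,6) d2 h by algebra
    then have "(m - n)\<^sup>2 = 0" using l2 r2 sq by algebra
    then show False using \<open>m \<noteq> n\<close> by simp
  qed
  have "l * (d 2 + (e1 * l + e3 * r)) = 0" using i lr mn by algebra
  then have "d 2 = - (e1 * l + e3 * r)" using l by (simp add: eq_neg_iff_add_eq_0)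
  then show ?thesis using mn h l n by (intro classes_parallel) auto
qed

end

lemma in_classes_swapped_eq:
  "in_classes_swapped l m n r \<epsilon> h F d \<longleftrightarrow> in_classes r n m l (\<epsilon> \<circ> swap13) (- h)
     (\<lambda>i j. F (swap13 i) (swap13 j)) (d \<circ> swap13_46)"
  by (simp add: in_classes_swapped_def)

theorem (in einstein_algebra) classification:
  "in_classes l m n r \<epsilon> h F d \<or> in_classes_swapped l m n r \<epsilon> h F d"
proof -
  interpret sw: einstein_algebra r n m l "- h" "\<epsilon> \<circ> swap13" "\<lambda>i j. F (swap13 i) (swap13 j)" "d \<circ> swap13_46"
    by (rule swapped)
  have F: "F (swap13 1) (swap13 2) = - b" "F (swap13 2) (swap13 3) = - a"
    using F_skew by simp_all
  have e: "(\<epsilon> \<circ> swap13) 1 = e3" "(\<epsilon> \<circ> swap13) 3 = e1" by simp_all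
  have d2s: "(d \<circ> swap13_46) 2 = d 2" by (simp only: o_apply[of d] swap13_46_simps)
  show ?thesis
  proof (cases "h = 0")
    case True
    consider "b = 0" | "a = 0" | "n = 0" "a \<noteq> 0" "b \<noteq> 0" | "m = 0" "a \<noteq> 0" "b \<noteq> 0"
      | "m \<noteq> 0" "n \<noteq> 0" "a \<noteq> 0" "b \<noteq> 0" by blast
    then show ?thesis
    proof cases
      case 2
      then show ?thesis using sw.classes_h0_b0 True F unfolding in_classes_swapped_eq by simp
    next
      case 4
      then show ?thesis using sw.classes_h0_n0 True F unfolding in_classes_swapped_eq by simp
    qed (use True classes_h0_b0 classes_h0_n0 classes_h0_generic in simp_all)
  next
    case False
    then have d2: "d 2 = - (e1 * l + e3 * r)" using E(7) by simp
    then have d2': "(d \<circ> swap13_46) 2 = - ((\<epsilon> \<circ> swap13) 1 * r + (\<epsilon> \<circ> swap13) 3 * l)"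
      unfolding d2s e by simp
    consider "h = m - n" | "3 * h = m - n"
      using parallel_squares(6)[OF d2] by force
    then show ?thesis
    proof cases
      case 1
      have lr: "l * r = m * n" using parallel_squares(3)[OF d2] 1 by simp
      consider "l * n \<noteq> 0" | "r * m \<noteq> 0" | "r = 0" "n = 0" | "l = 0" "m = 0"
        using lr trace by fastforce
      then show ?thesis
      proof cases
        case 2
        then show ?thesis using sw.classes_parallel[OF d2'] 1 unfolding in_classes_swapped_eq by simp
      next
        case 4
        then show ?thesis using sw.classes_parallel[OF d2'] 1 unfolding in_classes_swapped_eq by simp
      qed (use classes_parallel[OF d2 1] in simp_all)
    next
      case 2
      show ?thesis
      proof (cases "m + 2 * n = 0")
        case True
        then have "n + 2 * m \<noteq> 0" using 2 False by auto
        then show ?thesis using sw.classes_third[OF d2'] 2 False unfolding in_classes_swapped_eq by simp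
      qed (use classes_third[OF d2 2 False] in simp)
    qed
  qed
qed

subsection \<open>The seven classes solve the system\<close>

lemma class1_system:
  assumes "class1 l m n r \<epsilon> h F d" and e: "\<epsilon> 1 * \<epsilon> 1 = 1" "\<epsilon> 3 * \<epsilon> 3 = 1"
  shows "einstein_system l m n r (\<epsilon> 1) (\<epsilon> 3) h (F 1 2) (F 2 3) d"
proof -
  have c: "h = m" "F 2 3 = 0" "d 0 * F 1 2 = \<epsilon> 3 * m * d 3" "d 1 = 0" "d 4 = 0"
    "d 2 = - \<epsilon> 1 * l" "d 5 = - \<epsilon> 1 * l"
    using assms(1) unfolding class1_def by blast+
  consider (a) "r = 0" "n = 0" "(F 1 2)\<^sup>2 = - (\<epsilon> 1 * l\<^sup>2 + \<epsilon> 3 * m\<^sup>2)"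
    | (b) s t where "s \<in> {-1, 1}" "t \<in> {-1, 1}" "m = 0" "r = - 2 * l" "n = 2 * s * l"
      "\<epsilon> 1 = -1" "\<epsilon> 3 = 1" "F 1 2 = t * l * sqrt 3" "d 0 = 0" "d 3 = 0" "d 6 = 0"
    using assms(1) unfolding class1_def by blast
  then show ?thesis
  proof cases
    case a
    then show ?thesis
      unfolding einstein_system_def using a c e by (intro conjI; (algebra | simp))
  next
    case b
    have ss: "s * s = 1" and tt: "t * t = 1" using b by auto
    have "(F 1 2)\<^sup>2 = (t * t) * (sqrt 3 * sqrt 3) * l\<^sup>2"
      unfolding b(8) power2_eq_square by (simp only: mult_ac)
    then have "(F 1 2)\<^sup>2 = 3 * l\<^sup>2" using tt by simp
    note sq = ss this
    show ?thesis
      unfolding einstein_system_def using b(3-7,9-) c(1,2,4-7) sq by (intro conjI; (algebra | simp))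
  qed
qed

lemma class2_system:
  assumes "class2 l m n r \<epsilon> h F d"
  shows "einstein_system l m n r (\<epsilon> 1) (\<epsilon> 3) h (F 1 2) (F 2 3) d"
proof -
  obtain s t where st: "s \<in> {-1, 1}" "t \<in> {-1, 1}" and c: "l = 0" "n = - 2 * m" "r = t * m"
    "\<epsilon> 1 = -1" "\<epsilon> 3 = 1" "h = m" "F 2 3 = s * r" "F 1 2 = s * m"
    "d 0 = 0" "d 1 = 0" "d 3 = 0" "d 4 = 0" "d 6 = 0" "d 2 = - r" "d 5 = - r"
    using assms unfolding class2_def by blast
  have "s * s = 1" "t * t = 1" using st by auto
  then show ?thesis
    unfolding einstein_system_def using c by (intro conjI; (algebra | simp))
qed

lemma class3_system:
  assumes "class3 l m n r \<epsilon> h F d" and e: "\<epsilon> 1 * \<epsilon> 1 = 1" "\<epsilon> 3 * \<epsilon> 3 = 1"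
  shows "einstein_system l m n r (\<epsilon> 1) (\<epsilon> 3) h (F 1 2) (F 2 3) d"
proof -
  have c: "l * n * (\<epsilon> 1 * l + \<epsilon> 3 * r) \<noteq> 0" "l * r = m * n" "h = m - n" "F 2 3 = - (n / l) * F 1 2"
    "(F 1 2)\<^sup>2 = - (\<epsilon> 1 * l\<^sup>2 + \<epsilon> 3 * m\<^sup>2)" "d 0 * F 1 2 = \<epsilon> 1 * (l / n) * d 1 * (n - m)"
    "d 2 = - (\<epsilon> 1 * l + \<epsilon> 3 * r)" "d 5 = - (\<epsilon> 1 * l + \<epsilon> 3 * r)"
    "d 3 = - \<epsilon> 1 * \<epsilon> 3 * (l / n) * d 1" "d 6 = - \<epsilon> 1 * \<epsilon> 3 * (l / n) * d 4"
    using assms(1) unfolding class3_def by blast+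
  \<comment> \<open>In terms of \<open>k = \<nu> / \<lambda>\<close>, so that \<open>\<rho> = k \<mu>\<close> and \<open>b = - k a\<close>, all relations become polynomial.\<close>
  define k where "k = n / l"
  have nz: "l \<noteq> 0" "n \<noteq> 0" using c(1) by auto
  then have k: "n = k * l" "r = k * m" "F 2 3 = - k * F 1 2"
    using c(2,4) by (simp_all add: k_def field_simps)
  have "k * d 3 = - \<epsilon> 1 * \<epsilon> 3 * d 1" "k * d 6 = - \<epsilon> 1 * \<epsilon> 3 * d 4" "k * (d 0 * F 1 2) = \<epsilon> 1 * d 1 * (n - m)"
    unfolding c(6,9,10) k_def using nz by simp_all
  moreover have "k \<noteq> 0" using nz by (simp add: k_def)
  ultimately have d: "d 1 = - \<epsilon> 1 * \<epsilon> 3 * k * d 3" "d 4 = - \<epsilon> 1 * \<epsilon> 3 * k * d 6"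
    "k * (d 0 * F 1 2 - \<epsilon> 3 * d 3 * (m - n)) = 0"
    using e by algebra+
  then have d0: "d 0 * F 1 2 = \<epsilon> 3 * d 3 * (m - n)" using \<open>k \<noteq> 0\<close> by simp
  show ?thesis
    unfolding einstein_system_def using k c(3,5,7,8) d(1,2) d0 e by (intro conjI; (algebra | simp))
qed

lemma class4_system:
  assumes "class4 l m n r \<epsilon> h F d" and e: "\<epsilon> 1 * \<epsilon> 1 = 1"
  shows "einstein_system l m n r (\<epsilon> 1) (\<epsilon> 3) h (F 1 2) (F 2 3) d"
proof -
  obtain s where s: "s \<in> {-1, 1}" and c: "l = 0" "n = 0" "r * m \<noteq> 0" "\<epsilon> 3 = -1" "h = m"
    "F 1 2 = s * m" "F 2 3 = - s * r" "d 2 = r" "d 5 = r" "d 3 = - s * d 0"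
    "d 3 = \<epsilon> 1 * (m / r) * d 1" "d 6 = \<epsilon> 1 * (m / r) * d 4"
    using assms(1) unfolding class4_def by blast
  have "s * s = 1" using s by auto
  moreover have "r * d 3 = \<epsilon> 1 * m * d 1" "r * d 6 = \<epsilon> 1 * m * d 4"
    unfolding c(11,12) using c(3) by simp_all
  ultimately show ?thesis
    unfolding einstein_system_def using c(1,2,4-10) e by (intro conjI; (algebra | simp))
qed

lemma class5_system:
  assumes "class5 l m n r \<epsilon> h F d" and e: "\<epsilon> 1 * \<epsilon> 1 = 1"
  shows "einstein_system l m n r (\<epsilon> 1) (\<epsilon> 3) h (F 1 2) (F 2 3) d"
proof -
  obtain s where s: "s \<in> {-1, 1}" and c: "l = s / 3 * (2 * m + n)" "r = s / 3 * (2 * n + m)"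
    "\<epsilon> 3 = - \<epsilon> 1" "h = 1 / 3 * (m - n)" "F 2 3 = - s * F 1 2" "(F 1 2)\<^sup>2 = \<epsilon> 1 / 3 * (m\<^sup>2 - n\<^sup>2)"
    "d 0 = 0" "d 1 = 0" "d 3 = 0" "d 4 = 0" "d 6 = 0"
    "d 2 = s * \<epsilon> 1 / 3 * (n - m)" "d 5 = s * \<epsilon> 1 / 3 * (n - m)"
    using assms(1) unfolding class5_def by blast
  have ss: "s * s = 1" using s by auto
  have c': "3 * l = s * (2 * m + n)" "3 * r = s * (2 * n + m)" "3 * h = m - n"
    "3 * (F 1 2)\<^sup>2 = \<epsilon> 1 * (m\<^sup>2 - n\<^sup>2)" "3 * d 2 = s * \<epsilon> 1 * (n - m)" "d 5 = d 2"
    using c by simp_all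
  define p q where "p = m - h" and "q = n + h"
  have m: "m = 2 * p - q" and n: "n = 2 * q - p" and hpq: "h = p - q"
    using c' by (simp_all add: p_def q_def)
  have lr: "l = s * p" "r = s * q" "(F 1 2)\<^sup>2 = \<epsilon> 1 * (p\<^sup>2 - q\<^sup>2)" "d 2 = s * \<epsilon> 1 * (q - p)"
    using c'(1,2,4,5) unfolding m n by algebra+
  show ?thesis
    unfolding einstein_system_def using lr m n hpq c(3,5,7-11) c'(6) ss e by (intro conjI; (algebra | simp))
qed

lemma class6_system:
  assumes "class6 l m n r \<epsilon> h F d"
  shows "einstein_system l m n r (\<epsilon> 1) (\<epsilon> 3) h (F 1 2) (F 2 3) d"
proof -
  obtain s t where st: "s \<in> {-1, 1}" "t \<in> {-1, 1}" and c: "r = - 2 * l" "m = 2 * s * l" "n = 0"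
    "\<epsilon> 1 = 1" "\<epsilon> 3 = -1" "h = 0" "F 1 2 = t * l" "F 2 3 = 2 * s * t * l"
    "d 0 = 0" "d 1 = 0" "d 3 = 0" "d 4 = 0" "d 6 = 0" "d 2 = - l" "d 5 = - l"
    using assms unfolding class6_def by blast
  have "s * s = 1" "t * t = 1" using st by auto
  then show ?thesis
    unfolding einstein_system_def using c by (intro conjI; (algebra | simp))
qed

lemma class7_system:
  assumes "class7 l m n r \<epsilon> h F d" and e: "\<epsilon> 1 * \<epsilon> 1 = 1" "\<epsilon> 3 * \<epsilon> 3 = 1"
  shows "einstein_system l m n r (\<epsilon> 1) (\<epsilon> 3) h (F 1 2) (F 2 3) d"
proof -
  have z: "h = 0" "d 0 = 0" "d 1 = 0" "d 3 = 0" "d 4 = 0" "d 6 = 0" "d 2 = d 5"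
    and c: "F 1 2 * \<epsilon> 3 * (d 2 + \<epsilon> 1 * l) = F 2 3 * n"
      "F 1 2 * m = F 2 3 * \<epsilon> 1 * (\<epsilon> 3 * r + d 2)"
      "(F 1 2)\<^sup>2 = \<epsilon> 3 / 2 * (n\<^sup>2 - m\<^sup>2) + d 2 * l" "(F 2 3)\<^sup>2 = \<epsilon> 1 / 2 * (m\<^sup>2 - n\<^sup>2) + d 2 * r"
      "d 2 * (\<epsilon> 1 * l + \<epsilon> 3 * r) = - l\<^sup>2 - \<epsilon> 1 * \<epsilon> 3 / 2 * (m + n)\<^sup>2 - r\<^sup>2"
      "F 1 2 * F 2 3 = \<epsilon> 1 / 2 * l * (n - m) + \<epsilon> 3 / 2 * r * (m - n) - d 2 / 2 * (m + n)"
    using assms(1) unfolding class7_def by blast+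
  have sq: "2 * (F 1 2)\<^sup>2 = 2 * l * d 2 + \<epsilon> 3 * (n\<^sup>2 - m\<^sup>2)" "2 * (F 2 3)\<^sup>2 = 2 * r * d 2 + \<epsilon> 1 * (m\<^sup>2 - n\<^sup>2)"
    "2 * (d 2 * (\<epsilon> 1 * l + \<epsilon> 3 * r)) = - 2 * l\<^sup>2 - \<epsilon> 1 * \<epsilon> 3 * (m + n)\<^sup>2 - 2 * r\<^sup>2"
    "2 * F 1 2 * F 2 3 = \<epsilon> 1 * l * (n - m) + \<epsilon> 3 * r * (m - n) - d 2 * (m + n)"
    using c(3-6) by (simp_all add: field_simps)
  have "F 1 2 * (d 2 + \<epsilon> 1 * l) = \<epsilon> 3 * n * F 2 3" "F 2 3 * (d 2 + \<epsilon> 3 * r) = \<epsilon> 1 * m * F 1 2"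
    using c(1,2) e by algebra+
  moreover have "2 * (l\<^sup>2 + r\<^sup>2) + \<epsilon> 1 * \<epsilon> 3 * (m + n)\<^sup>2 + 2 * (\<epsilon> 1 * (F 1 2)\<^sup>2 + \<epsilon> 3 * (F 2 3)\<^sup>2) = 0"
    using sq(1-3) by algebra
  ultimately show ?thesis
    unfolding einstein_system_def using z sq by simp
qed

lemma in_classes_system:
  assumes "in_classes l m n r \<epsilon> h F d" "\<epsilon> 1 * \<epsilon> 1 = 1" "\<epsilon> 3 * \<epsilon> 3 = 1"
  shows "einstein_system l m n r (\<epsilon> 1) (\<epsilon> 3) h (F 1 2) (F 2 3) d"
  using assms(1) unfolding in_classes_def
  by (elim disjE) (rule class1_system class2_system class3_system class4_system class5_system
    class6_system class7_system, assumption, (rule assms(2,3))+ | (rule class2_system class6_system, assumption))+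

theorem einstein_system_iff_classes:
  assumes F: "F 1 3 = 0" "F 2 1 = - F 1 2" "F 3 2 = - F 2 3" "F 3 1 = 0"
    and eps: "\<epsilon> 1 \<in> {-1, 1}" "\<epsilon> 3 \<in> {-1, 1}"
    and trace: "\<epsilon> 1 * l + \<epsilon> 3 * r \<noteq> 0" and nonzero: "F 1 2 \<noteq> 0 \<or> F 2 3 \<noteq> 0"
  shows "einstein_system l m n r (\<epsilon> 1) (\<epsilon> 3) h (F 1 2) (F 2 3) d \<longleftrightarrow>
    in_classes l m n r \<epsilon> h F d \<or> in_classes_swapped l m n r \<epsilon> h F d"
proof
  assume "einstein_system l m n r (\<epsilon> 1) (\<epsilon> 3) h (F 1 2) (F 2 3) d"
  then interpret einstein_algebra l m n r h \<epsilon> F d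
    using assms by unfold_locales
  show "in_classes l m n r \<epsilon> h F d \<or> in_classes_swapped l m n r \<epsilon> h F d" by (rule classification)
next
  have sq: "\<epsilon> 1 * \<epsilon> 1 = 1" "\<epsilon> 3 * \<epsilon> 3 = 1" using eps by auto
  assume "in_classes l m n r \<epsilon> h F d \<or> in_classes_swapped l m n r \<epsilon> h F d"
  then show "einstein_system l m n r (\<epsilon> 1) (\<epsilon> 3) h (F 1 2) (F 2 3) d"
  proof
    assume "in_classes l m n r \<epsilon> h F d"
    then show ?thesis using sq by (rule in_classes_system)
  next
    assume "in_classes_swapped l m n r \<epsilon> h F d"
    then have "einstein_system r n m l (\<epsilon> 3) (\<epsilon> 1) (- h) (- F 2 3) (- F 1 2) (d \<circ> swap13_46)"
      using in_classes_system[of r n m l "\<epsilon> \<circ> swap13" "- h" "\<lambda>i j. F (swap13 i) (swap13 j)" "d \<circ> swap13_46"] sq F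
      unfolding in_classes_swapped_eq by simp
    then have "einstein_system l m n r (\<epsilon> 1) (\<epsilon> 3) h (F 1 2) (F 2 3) (d \<circ> swap13_46 \<circ> swap13_46)"
      using einstein_system_swap by fastforce
    moreover have "swap13_46 \<circ> swap13_46 = id"
      by (auto simp: fun_eq_iff Transposition.transpose_def)
    ultimately show ?thesis by (simp add: comp_assoc del: o_apply)
  qed
qed

section \<open>The Einstein equations as a polynomial system\<close>

context courant_frame
begin

lemma Fc_values:
  "Fc 2 1 = - Fc 1 2" "Fc 3 2 = - Fc 2 3" "Fc 3 1 = - Fc 1 3" "Fc 1 1 = 0" "Fc 2 2 = 0" "Fc 3 3 = 0"
  using Fc_skew[of 2 1] Fc_skew[of 3 2] Fc_skew[of 3 1] Fc_skew[of 1 1] Fc_skew[of 2 2] Fc_skew[of 3 3]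
  by simp_all

lemma eps_cases: "\<epsilon> (Suc 0) = 1 \<or> \<epsilon> (Suc 0) = -1" "\<epsilon> 2 = 1 \<or> \<epsilon> 2 = -1" "\<epsilon> 3 = 1 \<or> \<epsilon> 3 = -1"
  using eps[of 1] eps[of 2] eps[of 3] by auto

lemmas Bc_eval = Bc_def idx_def sg_def unit0_def fr_def fr2_def fc_def levi3_def eta_def

text \<open>The components are doubled to avoid denominators.\<close>

lemma ric_comp_plus:
  assumes "Fc 1 3 = 0"
  shows
    "2 * Ric_plus d 4 0 = 2 * \<epsilon> 2 * (\<epsilon> 3 * (\<nu> + h) * Fc 2 3 - Fc 1 2 * (d 2 + \<epsilon> 1 * lam))"
    "2 * Ric_plus d 4 1 = \<epsilon> 2 * (2 * lam * d 2 + \<epsilon> 3 * (\<nu>\<^sup>2 - \<mu>\<^sup>2 - h\<^sup>2) - 2 * (Fc 1 2)\<^sup>2)"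
    "2 * Ric_plus d 4 2 = 2 * Fc 1 2 * d 0 - 2 * \<epsilon> 1 * lam * d 1 - \<epsilon> 3 * (\<mu> + \<nu> + h) * d 3"
    "2 * Ric_plus d 4 3 = \<epsilon> 2 * (\<epsilon> 1 * lam * (\<mu> - \<nu> + h) + \<epsilon> 3 * \<rho> * (\<nu> - \<mu> + h)
        + d 2 * (\<mu> + \<nu> + h) + 2 * Fc 1 2 * Fc 2 3)"
    "2 * Ric_plus d 5 0 = 2 * (\<epsilon> 1 * Fc 1 2 * d 1 - \<epsilon> 3 * Fc 2 3 * d 3)"
    "2 * Ric_plus d 5 1 = \<epsilon> 3 * (\<mu> - \<nu> + h) * d 3 - 2 * Fc 1 2 * d 0"
    "2 * Ric_plus d 5 2 = - (2 * (lam\<^sup>2 + \<rho>\<^sup>2) + \<epsilon> 1 * \<epsilon> 3 * ((\<mu> + \<nu>)\<^sup>2 + h\<^sup>2)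
        + 2 * (\<epsilon> 1 * (Fc 1 2)\<^sup>2 + \<epsilon> 3 * (Fc 2 3)\<^sup>2))"
    "2 * Ric_plus d 5 3 = 2 * Fc 2 3 * d 0 - \<epsilon> 1 * (\<mu> - \<nu> + h) * d 1"
    "2 * Ric_plus d 6 0 = 2 * \<epsilon> 2 * (Fc 2 3 * (d 2 + \<epsilon> 3 * \<rho>) - \<epsilon> 1 * (\<mu> - h) * Fc 1 2)"
    "2 * Ric_plus d 6 1 = \<epsilon> 2 * (\<epsilon> 1 * lam * (\<mu> - \<nu> - h) + \<epsilon> 3 * \<rho> * (\<nu> - \<mu> - h)
        + d 2 * (\<mu> + \<nu> - h) + 2 * Fc 1 2 * Fc 2 3)"
    "2 * Ric_plus d 6 2 = - 2 * Fc 2 3 * d 0 - 2 * \<epsilon> 3 * \<rho> * d 3 - \<epsilon> 1 * (\<mu> + \<nu> - h) * d 1"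
    "2 * Ric_plus d 6 3 = \<epsilon> 2 * (2 * \<rho> * d 2 + \<epsilon> 1 * (\<mu>\<^sup>2 - \<nu>\<^sup>2 - h\<^sup>2) - 2 * (Fc 2 3)\<^sup>2)"
  unfolding ric_comp_def nat_0_3 nat_4_6
  by (simp add: Bc_eval Fc_values[simplified] assms[simplified];
      (insert eps_cases, elim disjE; simp add: field_simps power2_eq_square))+

lemma ric_comp_minus:
  assumes "Fc 1 3 = 0"
  shows
    "2 * Ric_minus d 0 4 = 2 * \<epsilon> 2 * (\<epsilon> 3 * (\<nu> + h) * Fc 2 3 - Fc 1 2 * (d 5 + \<epsilon> 1 * lam))"
    "2 * Ric_minus d 1 4 = \<epsilon> 2 * (2 * lam * d 5 + \<epsilon> 3 * (\<nu>\<^sup>2 - \<mu>\<^sup>2 - h\<^sup>2) - 2 * (Fc 1 2)\<^sup>2)"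
    "2 * Ric_minus d 2 4 = \<epsilon> 3 * ((\<mu> - \<nu> - h) * d 6)"
    "2 * Ric_minus d 3 4 = \<epsilon> 2 * (\<epsilon> 1 * lam * (\<mu> - \<nu> + h) + \<epsilon> 3 * \<rho> * (\<nu> - \<mu> + h)
        + d 5 * (\<mu> + \<nu> + h) + 2 * Fc 1 2 * Fc 2 3)"
    "2 * Ric_minus d 0 5 = 2 * (\<epsilon> 1 * Fc 1 2 * d 4 - \<epsilon> 3 * Fc 2 3 * d 6)"
    "2 * Ric_minus d 1 5 = - 2 * \<epsilon> 1 * lam * d 4 - \<epsilon> 3 * (\<mu> + \<nu> - h) * d 6"
    "2 * Ric_minus d 2 5 = - (2 * (lam\<^sup>2 + \<rho>\<^sup>2) + \<epsilon> 1 * \<epsilon> 3 * ((\<mu> + \<nu>)\<^sup>2 + h\<^sup>2)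
        + 2 * (\<epsilon> 1 * (Fc 1 2)\<^sup>2 + \<epsilon> 3 * (Fc 2 3)\<^sup>2))"
    "2 * Ric_minus d 3 5 = - \<epsilon> 1 * (\<mu> + \<nu> + h) * d 4 - 2 * \<epsilon> 3 * \<rho> * d 6"
    "2 * Ric_minus d 0 6 = 2 * \<epsilon> 2 * (Fc 2 3 * (d 5 + \<epsilon> 3 * \<rho>) - \<epsilon> 1 * (\<mu> - h) * Fc 1 2)"
    "2 * Ric_minus d 1 6 = \<epsilon> 2 * (\<epsilon> 1 * lam * (\<mu> - \<nu> - h) + \<epsilon> 3 * \<rho> * (\<nu> - \<mu> - h)
        + d 5 * (\<mu> + \<nu> - h) + 2 * Fc 1 2 * Fc 2 3)"
    "2 * Ric_minus d 2 6 = - \<epsilon> 1 * ((\<mu> - \<nu> - h) * d 4)"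
    "2 * Ric_minus d 3 6 = \<epsilon> 2 * (2 * \<rho> * d 5 + \<epsilon> 1 * (\<mu>\<^sup>2 - \<nu>\<^sup>2 - h\<^sup>2) - 2 * (Fc 2 3)\<^sup>2)"
  unfolding ric_comp_def nat_0_3 nat_4_6
  by (simp add: Bc_eval Fc_values[simplified] assms[simplified];
      (insert eps_cases, elim disjE; simp add: field_simps power2_eq_square))+

text \<open>The two equations with \<open>p = 4\<close>, \<open>j = 3\<close> and \<open>p = 6\<close>, \<open>j = 1\<close> differ by a multiple of
  \<open>h (\<epsilon>\<^sub>1 \<lambda> + \<epsilon>\<^sub>3 \<rho> + \<delta>\<^sub>2)\<close>. That \<open>\<delta>\<^sub>5 = \<delta>\<^sub>2\<close> needs \<open>F \<noteq> 0\<close>: the two tensors only give \<open>F\<^sub>1\<^sub>2 (\<delta>\<^sub>5 - \<delta>\<^sub>2) = 0\<close> and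
  \<open>F\<^sub>2\<^sub>3 (\<delta>\<^sub>5 - \<delta>\<^sub>2) = 0\<close>.\<close>

lemma ric_comp_iff_system:
  assumes F13: "Fc 1 3 = 0" and nonzero: "Fc 1 2 \<noteq> 0 \<or> Fc 2 3 \<noteq> 0"
  shows "(\<forall>p\<in>{4..6}. \<forall>j\<in>{0..3}. Ric_plus d p j = 0 \<and> Ric_minus d j p = 0)
    \<longleftrightarrow> einstein_system lam \<mu> \<nu> \<rho> (\<epsilon> 1) (\<epsilon> 3) h (Fc 1 2) (Fc 2 3) d"
    (is "?ric \<longleftrightarrow> ?sys")
proof
  have nz: "\<epsilon> 1 \<noteq> 0" "\<epsilon> 2 \<noteq> 0" "\<epsilon> 3 \<noteq> 0" using eps[of 1] eps[of 2] eps[of 3] by auto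
  note plus = ric_comp_plus[OF F13, of d] and minus = ric_comp_minus[OF F13, of d]
  assume ?ric
  then have ric: "2 * Ric_plus d p j = x \<Longrightarrow> p \<in> {4..6} \<Longrightarrow> j \<in> {0..3} \<Longrightarrow> x = 0"
    "2 * Ric_minus d j p = x \<Longrightarrow> p \<in> {4..6} \<Longrightarrow> j \<in> {0..3} \<Longrightarrow> x = 0" for p j x
    by auto
  have mem: "4 \<in> {4..6::nat}" "5 \<in> {4..6::nat}" "6 \<in> {4..6::nat}"
    "0 \<in> {0..3::nat}" "1 \<in> {0..3::nat}" "2 \<in> {0..3::nat}" "3 \<in> {0..3::nat}" by simp_all
  note p40 = ric(1)[OF plus(1) mem(1) mem(4)] and m40 = ric(2)[OF minus(1) mem(1) mem(4)]
    and p41 = ric(1)[OF plus(2) mem(1) mem(5)] and m41 = ric(2)[OF minus(2) mem(1) mem(5)]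
    and p42 = ric(1)[OF plus(3) mem(1) mem(6)] and m42 = ric(2)[OF minus(3) mem(1) mem(6)]
    and p43 = ric(1)[OF plus(4) mem(1) mem(7)] and m43 = ric(2)[OF minus(4) mem(1) mem(7)]
    and p50 = ric(1)[OF plus(5) mem(2) mem(4)] and m50 = ric(2)[OF minus(5) mem(2) mem(4)]
    and p51 = ric(1)[OF plus(6) mem(2) mem(5)] and m51 = ric(2)[OF minus(6) mem(2) mem(5)]
    and p52 = ric(1)[OF plus(7) mem(2) mem(6)] and m52 = ric(2)[OF minus(7) mem(2) mem(6)]
    and p53 = ric(1)[OF plus(8) mem(2) mem(7)] and m53 = ric(2)[OF minus(8) mem(2) mem(7)]
    and p60 = ric(1)[OF plus(9) mem(3) mem(4)] and m60 = ric(2)[OF minus(9) mem(3) mem(4)]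
    and p61 = ric(1)[OF plus(10) mem(3) mem(5)] and m61 = ric(2)[OF minus(10) mem(3) mem(5)]
    and p62 = ric(1)[OF plus(11) mem(3) mem(6)] and m62 = ric(2)[OF minus(11) mem(3) mem(6)]
    and p63 = ric(1)[OF plus(12) mem(3) mem(7)] and m63 = ric(2)[OF minus(12) mem(3) mem(7)]
  have d5: "d 5 = d 2"
  proof -
    have "Fc 1 2 * (d 5 - d 2) = 0" "Fc 2 3 * (d 5 - d 2) = 0"
      using p40 m40 p60 m60 nz by simp_all algebra+
    then show ?thesis using nonzero by auto
  qed
  have A: "Fc 1 2 * (d 2 + \<epsilon> 1 * lam) = \<epsilon> 3 * (\<nu> + h) * Fc 2 3"
    "Fc 2 3 * (d 2 + \<epsilon> 3 * \<rho>) = \<epsilon> 1 * (\<mu> - h) * Fc 1 2"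
    "2 * (Fc 1 2)\<^sup>2 = 2 * lam * d 2 + \<epsilon> 3 * (\<nu>\<^sup>2 - \<mu>\<^sup>2 - h\<^sup>2)"
    "2 * (Fc 2 3)\<^sup>2 = 2 * \<rho> * d 2 + \<epsilon> 1 * (\<mu>\<^sup>2 - \<nu>\<^sup>2 - h\<^sup>2)"
    "\<epsilon> 1 * lam * (\<mu> - \<nu> + h) + \<epsilon> 3 * \<rho> * (\<nu> - \<mu> + h) + d 2 * (\<mu> + \<nu> + h) + 2 * Fc 1 2 * Fc 2 3 = 0"
    "\<epsilon> 1 * lam * (\<mu> - \<nu> - h) + \<epsilon> 3 * \<rho> * (\<nu> - \<mu> - h) + d 2 * (\<mu> + \<nu> - h) + 2 * Fc 1 2 * Fc 2 3 = 0"
    using p40 p60 p41 p63 p43 p61 nz by simp_all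
  have B: "h * (\<epsilon> 1 * lam + \<epsilon> 3 * \<rho> + d 2) = 0"
    "2 * Fc 1 2 * Fc 2 3 = \<epsilon> 1 * lam * (\<nu> - \<mu>) + \<epsilon> 3 * \<rho> * (\<mu> - \<nu>) - d 2 * (\<mu> + \<nu>)"
    using A(5,6) by algebra+
  have C: "\<epsilon> 1 * lam * d 1 + \<epsilon> 3 * \<nu> * d 3 = 0" "\<epsilon> 1 * \<mu> * d 1 + \<epsilon> 3 * \<rho> * d 3 = 0"
    "\<epsilon> 1 * Fc 1 2 * d 1 = \<epsilon> 3 * Fc 2 3 * d 3"
    "2 * Fc 1 2 * d 0 = \<epsilon> 3 * (\<mu> - \<nu> + h) * d 3" "2 * Fc 2 3 * d 0 = \<epsilon> 1 * (\<mu> - \<nu> + h) * d 1"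
    using p42 p50 p51 p53 p62 by algebra+
  have E: "(\<mu> - \<nu> - h) * d 4 = 0" "(\<mu> - \<nu> - h) * d 6 = 0"
    using m62 m42 nz by simp_all
  then have E': "\<epsilon> 1 * lam * d 4 + \<epsilon> 3 * \<nu> * d 6 = 0" "\<epsilon> 1 * \<mu> * d 4 + \<epsilon> 3 * \<rho> * d 6 = 0"
    "\<epsilon> 1 * Fc 1 2 * d 4 = \<epsilon> 3 * Fc 2 3 * d 6"
    using m51 m53 m50 by algebra+
  have A5: "2 * (lam\<^sup>2 + \<rho>\<^sup>2) + \<epsilon> 1 * \<epsilon> 3 * ((\<mu> + \<nu>)\<^sup>2 + h\<^sup>2)
      + 2 * (\<epsilon> 1 * (Fc 1 2)\<^sup>2 + \<epsilon> 3 * (Fc 2 3)\<^sup>2) = 0"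
    using p52 by linarith
  show ?sys
    unfolding einstein_system_def using d5 A(1-4) A5 B C E E' by (intro conjI)
next
  note plus = ric_comp_plus[OF F13, of d] and minus = ric_comp_minus[OF F13, of d]
  assume ?sys
  note D = einstein_systemD[OF this]
  show ?ric
  proof (intro ballI)
    fix p j :: nat assume "p \<in> {4..6}" "j \<in> {0..3}"
    then have pj: "p = 4 \<or> p = 5 \<or> p = 6" "j = 0 \<or> j = 1 \<or> j = 2 \<or> j = 3" by auto
    have zp40: "2 * Ric_plus d 4 0 = 0" unfolding plus using D(2) by algebra
    have zp41: "2 * Ric_plus d 4 1 = 0" unfolding plus using D(4) by algebra
    have zp42: "2 * Ric_plus d 4 2 = 0" unfolding plus using D(9,12) by algebra
    have zp43: "2 * Ric_plus d 4 3 = 0" unfolding plus using D(7,8) by algebra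
    have zp50: "2 * Ric_plus d 5 0 = 0" unfolding plus using D(11) by algebra
    have zp51: "2 * Ric_plus d 5 1 = 0" unfolding plus using D(12) by algebra
    have zp52: "2 * Ric_plus d 5 2 = 0" unfolding plus using D(6) by algebra
    have zp53: "2 * Ric_plus d 5 3 = 0" unfolding plus using D(13) by algebra
    have zp60: "2 * Ric_plus d 6 0 = 0" unfolding plus using D(3) by algebra
    have zp61: "2 * Ric_plus d 6 1 = 0" unfolding plus using D(7,8) by algebra
    have zp62: "2 * Ric_plus d 6 2 = 0" unfolding plus using D(10,13) by algebra
    have zp63: "2 * Ric_plus d 6 3 = 0" unfolding plus using D(5) by algebra
    have zm40: "2 * Ric_minus d 0 4 = 0" unfolding minus D(1) using D(2) by algebra
    have zm41: "2 * Ric_minus d 1 4 = 0" unfolding minus D(1) using D(4) by algebra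
    have zm42: "2 * Ric_minus d 2 4 = 0" unfolding minus using D(15) by algebra
    have zm43: "2 * Ric_minus d 3 4 = 0" unfolding minus D(1) using D(7,8) by algebra
    have zm50: "2 * Ric_minus d 0 5 = 0" unfolding minus using D(18) by algebra
    have zm51: "2 * Ric_minus d 1 5 = 0" unfolding minus using D(15,16) by algebra
    have zm52: "2 * Ric_minus d 2 5 = 0" unfolding minus using D(6) by algebra
    have zm53: "2 * Ric_minus d 3 5 = 0" unfolding minus using D(14,17) by algebra
    have zm60: "2 * Ric_minus d 0 6 = 0" unfolding minus D(1) using D(3) by algebra
    have zm61: "2 * Ric_minus d 1 6 = 0" unfolding minus D(1) using D(7,8) by algebra
    have zm62: "2 * Ric_minus d 2 6 = 0" unfolding minus using D(14) by algebra
    have zm63: "2 * Ric_minus d 3 6 = 0" unfolding minus D(1) using D(5) by algebra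
    have "2 * Ric_plus d p j = 0 \<and> 2 * Ric_minus d j p = 0"
      by (insert pj, elim disjE; simp only: zp40 zp41 zp42 zp43 zp50 zp51 zp52 zp53 zp60 zp61 zp62 zp63 zm40 zm41 zm42 zm43 zm50 zm51 zm52 zm53 zm60 zm61 zm62 zm63 simp_thms)
    then show "Ric_plus d p j = 0 \<and> Ric_minus d j p = 0" by simp
  qed
qed

end

theorem theorem36:
  fixes G :: "'g::{t2_space,second_countable_topology} lie_structure"
    and g :: "'g form2" and H :: "'g form3" and F :: "'g form2"
    and \<delta> :: "'g sect \<Rightarrow> 'g \<Rightarrow> real"
    and v :: "nat \<Rightarrow> 'g field"
    and \<epsilon> :: "nat \<Rightarrow> real" and lam \<mu> \<nu> \<rho> h :: real
    and Fc :: "nat \<Rightarrow> nat \<Rightarrow> real" and dc :: "nat \<Rightarrow> real"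
  assumes "lie_group G" and "\<not> unimodular G"
    and "pseudo_riemannian G g" and "left_invariant2 G g"
    and "\<forall>x\<in>unimodular_kernel G. (\<forall>y\<in>unimodular_kernel G. g x y = 0) \<longrightarrow> x = 0"
    and "module_basis UNIV rscale (lie_algebra G) {1..3} v"
    and "v 1 \<in> unimodular_kernel G" and "v 3 \<in> unimodular_kernel G"
    and "\<forall>a\<in>{1..3}. \<epsilon> a \<in> {-1, 1}"
    and "\<forall>a\<in>{1..3}. \<forall>b\<in>{1..3}. g (v a) (v b) = cst (if a = b then \<epsilon> a else 0)"
    and "lie_bracket (v 1) (v 3) = 0"
    and "lie_bracket (v 2) (v 1) = rscale (\<epsilon> 1 * lam) (v 1) + rscale (\<epsilon> 3 * \<mu>) (v 3)"
    and "lie_bracket (v 2) (v 3) = rscale (\<epsilon> 1 * \<nu>) (v 1) + rscale (\<epsilon> 3 * \<rho>) (v 3)"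
    and "\<epsilon> 1 * lam + \<epsilon> 3 * \<rho> \<noteq> 0"
    and "H \<in> three_forms G" and "left_invariant3 G H"
    and "H (v 1) (v 2) (v 3) = cst h"
    and "closed_two_form G F" and "left_invariant2 G F" and "F \<noteq> 0"
    and "\<forall>a\<in>{1..3}. \<forall>b\<in>{1..3}. F (v a) (v b) = cst (Fc a b)"
    and "left_inv_divergence G \<delta>"
    and "\<forall>A\<in>{0..6}. \<delta> (e_basis g v A) = cst (dc A)"
  shows "generalized_einstein G H F (E_minus G g) \<delta> \<longleftrightarrow>
           in_classes lam \<mu> \<nu> \<rho> \<epsilon> h Fc dc \<or> in_classes_swapped lam \<mu> \<nu> \<rho> \<epsilon> h Fc dc"
proof -
  interpret group G using assms(1) by (simp add: lie_group_def)
  interpret courant_frame G v g F H \<epsilon> lam \<mu> \<nu> \<rho> h Fc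
  proof
    show "smooth_atlas (charts G)" "carrier G = UNIV"
      using assms(1) by (simp_all add: lie_group_def)
    show "g \<in> tensors2 G" "F \<in> two_forms G"
      using assms(3,18) by (simp_all add: pseudo_riemannian_def closed_two_form_def)
    show "g X Y = g Y X" if "X \<in> vector_fields G" "Y \<in> vector_fields G" for X Y
      using assms(3) that by (simp add: pseudo_riemannian_def)
  qed (use assms in \<open>simp_all\<close>)
  \<comment> \<open>Evaluated on the frame, \<open>dF = 0\<close> reads \<open>(\<epsilon>\<^sub>1 \<lambda> + \<epsilon>\<^sub>3 \<rho>) F\<^sub>1\<^sub>3 = 0\<close>.\<close>
  have F13: "Fc 1 3 = 0"
  proof -
    have v: "v 1 \<in> VF" "v 2 \<in> VF" "v 3 \<in> VF" by simp_all
    have const: "v a (F (v b) (v c)) = 0" if "a \<in> {1..3}" "b \<in> {1..3}" "c \<in> {1..3}" for a b c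
      using vf_cst[OF v_VF[OF that(1)], of "Fc b c"] F_v[OF that(2,3)] by simp
    have br: "lie_bracket (v 1) (v 2) = - (rscale (\<epsilon> 1 * lam) (v 1) + rscale (\<epsilon> 3 * \<mu>) (v 3))"
      "lie_bracket (v 3) (v 1) = 0"
      using lie_bracket_skew[of "v 1" "v 2"] lie_bracket_skew[of "v 3" "v 1"] br_21 br_13 by simp_all
    have "v 1 (F (v 2) (v 3)) + v 2 (F (v 3) (v 1)) + v 3 (F (v 1) (v 2))
        - F (lie_bracket (v 1) (v 2)) (v 3) - F (lie_bracket (v 2) (v 3)) (v 1)
        - F (lie_bracket (v 3) (v 1)) (v 2) = 0"
      using assms(18) v unfolding closed_two_form_def by blast
    moreover have "v 1 (F (v 2) (v 3)) = 0" "v 2 (F (v 3) (v 1)) = 0" "v 3 (F (v 1) (v 2)) = 0"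
      by (rule const; simp)+
    moreover have "A + B + C = 0" if "0 + 0 + 0 - A - B - C = 0" for A B C :: "'g \<Rightarrow> real"
    proof
      fix x show "(A + B + C) x = 0 x" using fun_cong[OF that, of x] by simp
    qed
    ultimately have "F (lie_bracket (v 1) (v 2)) (v 3) + F (lie_bracket (v 2) (v 3)) (v 1)
        + F (lie_bracket (v 3) (v 1)) (v 2) = 0"
      by (simp only:)
    moreover have "F (lie_bracket (v 1) (v 2)) (v 3) = - (cst (\<epsilon> 1 * lam) * F (v 1) (v 3) + cst (\<epsilon> 3 * \<mu>) * F (v 3) (v 3))"
      unfolding br using F1_uminus[OF F_F1_left[OF v(3)]] F1_diff[OF F_F1_left[OF v(3)]]
        F1_fscale[OF F_F1_left[OF v(3)]] v by simp
    moreover have "F (lie_bracket (v 2) (v 3)) (v 1) = cst (\<epsilon> 1 * \<nu>) * F (v 1) (v 1) + cst (\<epsilon> 3 * \<rho>) * F (v 3) (v 1)"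
      unfolding br_23 using F1_add[OF F_F1_left[OF v(1)]] F1_fscale[OF F_F1_left[OF v(1)]] v by simp
    moreover have "F (lie_bracket (v 3) (v 1)) (v 2) = 0"
      unfolding br using F1_0[OF F_F1_left[OF v(2)]] by simp
    ultimately have "\<epsilon> 1 * lam * Fc 1 3 + \<epsilon> 3 * \<rho> * Fc 1 3 = 0"
      using F_v[of 1 3] F_v[of 3 3] F_v[of 1 1] F_v[of 3 1] Fc_values
      by (simp add: fun_eq_iff)
    then have "(\<epsilon> 1 * lam + \<epsilon> 3 * \<rho>) * Fc 1 3 = 0" by (simp add: distrib_right)
    then show ?thesis using assms(14) by simp
  qed
  have nonzero: "Fc 1 2 \<noteq> 0 \<or> Fc 2 3 \<noteq> 0"
  proof (rule ccontr)
    assume "\<not> (Fc 1 2 \<noteq> 0 \<or> Fc 2 3 \<noteq> 0)"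
    then have Fc: "Fc a b = 0" if "a \<in> {1..3}" "b \<in> {1..3}" for a b
      using that F13 Fc_values unfolding nat_1_3 by auto
    have zero: "F (v a) = 0" if a: "a \<in> {1..3}" for a
    proof (rule F1_eqI[OF F_F1[OF v_VF[OF a]] zero_F1])
      fix b :: nat assume b: "b \<in> {1..3}"
      show "F (v a) (v b) = 0 (v b)" using F_v[OF a b] Fc[OF a b] by (simp add: fun_eq_iff)
    qed
    have "F X = 0" for X
    proof (cases "X \<in> VF")
      case True
      show ?thesis
      proof (rule F1_eqI[OF F_F1[OF True] zero_F1])
        fix b :: nat assume b: "b \<in> {1..3}"
        have "(\<lambda>X. F X (v b)) = 0"
          by (rule F1_eqI[OF F_F1_left[OF v_VF[OF b]] zero_F1]) (simp add: zero)
        then show "F X (v b) = 0 (v b)" by (metis zero_fun_apply)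
      qed
    next
      case False
      then show ?thesis using F_form by (simp add: two_forms_def tensors2_def)
    qed
    then show False using assms(20) by (simp add: fun_eq_iff)
  qed
  have "generalized_einstein G H F (E_minus G g) \<delta> \<longleftrightarrow>
      (\<forall>p\<in>{4..6}. \<forall>j\<in>{0..3}. Ric_plus dc p j = 0 \<and> Ric_minus dc j p = 0)"
    by (rule generalized_einstein_iff) (use assms(22,23) in \<open>simp_all add: left_inv_divergence_def\<close>)
  also have "\<dots> \<longleftrightarrow> einstein_system lam \<mu> \<nu> \<rho> (\<epsilon> 1) (\<epsilon> 3) h (Fc 1 2) (Fc 2 3) dc"
    by (rule ric_comp_iff_system[OF F13 nonzero])
  also have "\<dots> \<longleftrightarrow> in_classes lam \<mu> \<nu> \<rho> \<epsilon> h Fc dc \<or> in_classes_swapped lam \<mu> \<nu> \<rho> \<epsilon> h Fc dc"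
    by (rule einstein_system_iff_classes) (use F13 Fc_values nonzero assms(9,14) in simp_all)
  finally show ?thesis .
qed

end
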